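(* Let $-\infty<a<b<\infty$ and let $X=(X_t:t\in\mathbb R)$ be a real-valued centered Gaussian process with continuous sample paths and covariance function $R(s,t)=\mathrm E(X_sX_t)$. Assume that at least one of the following holds. (a) (i) There are real numbers $(r_{mn}:m,n\ge 0)$ with $R(s,t)=\sum_{m=0}^\infty\sum_{n=0}^\infty r_{mn}s^mt^n$ for all $s,t\in\mathbb R$; (ii) for every compact interval $[c,d]$ and every Borel probability measure $\nu$ on $[c,d]$, $\int_c^d\int_c^dR(s,t)\,\nu(ds)\,\nu(dt)>0$; (iii) the sample paths of $X$ are infinitely differentiable, and for any finitely many distinct pairs $(s_1,n_1),\ldots,(s_p,n_p)\in\mathbb R\times\{0,1,2,\ldots\}$ the covariance matrix of $(X^{(n_1)}_{s_1},\ldots,X^{(n_p)}_{s_p})$ is non-singular; (iv) $\limsup_{t\to\infty}R(s,t)\le 0$ for every $s\in[a,b]$. (b) $X$ is stationary, and its spectral measure $F_X$ satisfies $\int_{-\infty}^\infty e^{tx}F_X(dx)<\infty$ for all $t\in\mathbb R$, and the support of $F_X$ has at least one accumulation point. Let $\nu_*$, $S$ and $\mu$ be as defined in the context, and assume also that $\mu^{(2)}(t)>0$ for all $t\in S\cap(a,b)$. Let $$T_*:=\arg\min_{s\in[a,b]}X_s,$$ where the leftmost location of the minimum is chosen in case there are ties. Then, as $u\to\infty$, $$\mathrm P\left(T_*\in\cdot\,\Big|\,\min_{s\in[a,b]}X_s>u\right)\Rightarrow\nu_*$$ (weak convergence of probability measures on $[a,b]$).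
   Context: Notation: $f^{(n)}$ is the $n$-th derivative, $f^{(0)}=f$. The spectral measure of a stationary process $X$ is the finite symmetric Borel measure $F_X$ on $\mathbb R$ with $R(s,t)=\int_{-\infty}^\infty e^{i(t-s)x}F_X(dx)$. In case (b), a version of $X$ with infinitely differentiable sample paths is used. $M_1[a,b]$ is the set of Borel probability measures on $[a,b]$. Under (a) or (b) the problem $\min_{\nu\in M_1[a,b]}\int_a^b\int_a^bR(s,t)\,\nu(ds)\,\nu(dt)$ has a unique minimizer, denoted $\nu_*$, whose support $S=\{t_1,\ldots,t_k\}$ is finite. The covariance matrix of $(X_{t_1},\ldots,X_{t_k})$ is invertible. For $t\in\mathbb R$, $\mu(t)=\mathrm E(X_t\mid X_s=1\text{ for all }s\in S)$; that is, if $\mathrm E(X_t\mid X_{t_1},\ldots,X_{t_k})=\sum_{j=1}^k a_j(t)X_{t_j}$ then $\mu(t)=\sum_{j=1}^k a_j(t)$. The function $\mu$ is infinitely differentiable. *)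

theory Defs
  imports "HOL-Probability.Probability" "Jordan_Normal_Form.Matrix"
begin

section \<open>Gaussian processes\<close>

text \<open>Constants count as (degenerate) Gaussian variables.\<close>

definition gaussian_law :: "real \<Rightarrow> real \<Rightarrow> real measure" where
  "gaussian_law m \<sigma> =
     (if \<sigma> = 0 then return borel m else density lborel (\<lambda>x. ennreal (normal_density m \<sigma> x)))"

definition gaussian_rv :: "'w measure \<Rightarrow> ('w \<Rightarrow> real) \<Rightarrow> bool" where
  "gaussian_rv M Y \<longleftrightarrow>
     Y \<in> borel_measurable M \<and> (\<exists>m \<sigma>. 0 \<le> \<sigma> \<and> distr M borel Y = gaussian_law m \<sigma>)"

definition gaussian_process :: "'w measure \<Rightarrow> (real \<Rightarrow> 'w \<Rightarrow> real) \<Rightarrow> bool" where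
  "gaussian_process M X \<longleftrightarrow>
     (\<forall>J c. finite J \<longrightarrow> gaussian_rv M (\<lambda>\<omega>. \<Sum>t\<in>J. c t * X t \<omega>))"

definition centered_process :: "'w measure \<Rightarrow> (real \<Rightarrow> 'w \<Rightarrow> real) \<Rightarrow> bool" where
  "centered_process M X \<longleftrightarrow> (\<forall>t. (\<integral>\<omega>. X t \<omega> \<partial>M) = 0)"

definition cov_fun :: "'w measure \<Rightarrow> (real \<Rightarrow> 'w \<Rightarrow> real) \<Rightarrow> real \<Rightarrow> real \<Rightarrow> real" where
  "cov_fun M X s t = (\<integral>\<omega>. X s \<omega> * X t \<omega> \<partial>M)"

definition covariance :: "'w measure \<Rightarrow> ('w \<Rightarrow> real) \<Rightarrow> ('w \<Rightarrow> real) \<Rightarrow> real" where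
  "covariance M Y Z =
     (\<integral>\<omega>. (Y \<omega> - (\<integral>\<omega>'. Y \<omega>' \<partial>M)) * (Z \<omega> - (\<integral>\<omega>'. Z \<omega>' \<partial>M)) \<partial>M)"

definition covariance_mat :: "'w measure \<Rightarrow> ('w \<Rightarrow> real) list \<Rightarrow> real Matrix.mat" where
  "covariance_mat M Ys =
     Matrix.mat (length Ys) (length Ys) (\<lambda>(i, j). covariance M (Ys ! i) (Ys ! j))"

definition path_deriv :: "(real \<Rightarrow> 'w \<Rightarrow> real) \<Rightarrow> nat \<Rightarrow> real \<Rightarrow> 'w \<Rightarrow> real" where
  "path_deriv X n t \<omega> = (deriv ^^ n) (\<lambda>s. X s \<omega>) t"

definition smooth_paths :: "'w measure \<Rightarrow> (real \<Rightarrow> 'w \<Rightarrow> real) \<Rightarrow> bool" where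
  "smooth_paths M X \<longleftrightarrow>
     (\<forall>\<omega>\<in>space M. \<forall>n t. ((deriv ^^ n) (\<lambda>s. X s \<omega>)) field_differentiable (at t))"

definition stationary_process :: "'w measure \<Rightarrow> (real \<Rightarrow> 'w \<Rightarrow> real) \<Rightarrow> bool" where
  "stationary_process M X \<longleftrightarrow>
     (\<forall>J h. finite J \<longrightarrow>
        distr M (\<Pi>\<^sub>M t\<in>J. borel) (\<lambda>\<omega>. \<lambda>t\<in>J. X (t + h) \<omega>) =
        distr M (\<Pi>\<^sub>M t\<in>J. borel) (\<lambda>\<omega>. \<lambda>t\<in>J. X t \<omega>))"

definition is_spectral_measure ::
    "'w measure \<Rightarrow> (real \<Rightarrow> 'w \<Rightarrow> real) \<Rightarrow> real measure \<Rightarrow> bool" where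
  "is_spectral_measure M X F \<longleftrightarrow>
     finite_measure F \<and> sets F = sets borel \<and> distr F borel uminus = F \<and>
     (\<forall>s t. complex_of_real (cov_fun M X s t) = (\<integral>x. iexp ((t - s) * x) \<partial>F))"

section \<open>Probability measures on an interval\<close>

text \<open>Measures on \<open>[a,b]\<close> are measures whose underlying space is \<open>[a,b]\<close>, with the Borel
  sets of \<open>[a,b]\<close>; they are not extended by zero to the real line.\<close>

definition borel_probs :: "real \<Rightarrow> real \<Rightarrow> real measure set" where
  "borel_probs a b = space (prob_algebra (restrict_space borel {a..b}))"

lemma borel_probs_iff:
  "\<nu> \<in> borel_probs a b \<longleftrightarrow> prob_space \<nu> \<and> sets \<nu> = sets (restrict_space borel {a..b})"
  by (auto simp: borel_probs_def space_prob_algebra)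

definition measure_support :: "'a::topological_space measure \<Rightarrow> 'a set" where
  "measure_support \<nu> =
     {x \<in> space \<nu>. \<forall>U. open U \<and> x \<in> U \<longrightarrow> emeasure \<nu> (U \<inter> space \<nu>) > 0}"

definition energy :: "(real \<Rightarrow> real \<Rightarrow> real) \<Rightarrow> real measure \<Rightarrow> real" where
  "energy R \<nu> = (\<integral>t. (\<integral>s. R s t \<partial>\<nu>) \<partial>\<nu>)"

text \<open>Weak convergence, along an arbitrary filter, of measures on a subspace \<open>K\<close>.  The library
  notion \<^const>\<open>weak_conv_m\<close> covers only sequences of measures on the whole real line, where
  the two agree.\<close>

definition weak_conv_on ::
    "'a::topological_space set \<Rightarrow> ('i \<Rightarrow> 'a measure) \<Rightarrow> 'a measure \<Rightarrow> 'i filter \<Rightarrow> bool" where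
  "weak_conv_on K N \<nu> G \<longleftrightarrow>
     (\<forall>f :: 'a \<Rightarrow> real. continuous_on K f \<and> bounded (f ` K) \<longrightarrow>
        ((\<lambda>i. \<integral>x. f x \<partial>(N i)) \<longlongrightarrow> (\<integral>x. f x \<partial>\<nu>)) G)"

lemma weak_conv_on_UNIV_iff:
  assumes "\<And>n. real_distribution (N n)" "real_distribution \<nu>"
  shows "weak_conv_on UNIV N \<nu> sequentially \<longleftrightarrow> weak_conv_m N \<nu>"
proof
  assume *: "weak_conv_on UNIV N \<nu> sequentially"
  show "weak_conv_m N \<nu>"
  proof (rule integral_bdd_continuous_conv_imp_weak_conv[OF assms])
    fix f :: "real \<Rightarrow> real" and B
    assume "\<And>x. isCont f x" "\<And>x. abs (f x) \<le> B"
    then have "continuous_on UNIV f" "bounded (range f)"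
      by (auto simp: continuous_on_eq_continuous_at bounded_iff)
    with * show "(\<lambda>n. integral\<^sup>L (N n) f) \<longlonglongrightarrow> integral\<^sup>L \<nu> f"
      by (simp add: weak_conv_on_def)
  qed
next
  assume *: "weak_conv_m N \<nu>"
  show "weak_conv_on UNIV N \<nu> sequentially"
    unfolding weak_conv_on_def
  proof (intro allI impI)
    fix f :: "real \<Rightarrow> real"
    assume f: "continuous_on UNIV f \<and> bounded (range f)"
    then obtain B where "\<And>x. norm (f x) \<le> B"
      by (auto simp: bounded_iff)
    with f show "(\<lambda>n. \<integral>x. f x \<partial>N n) \<longlonglongrightarrow> (\<integral>x. f x \<partial>\<nu>)"
      by (intro weak_conv_imp_integral_bdd_continuous_conv[OF assms *])
         (auto simp: continuous_on_eq_continuous_at)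
  qed
qed

section \<open>The two sets of assumptions on the process\<close>

text \<open>The double series is an iterated one, as written in the formula; absolute convergence is not
  presupposed.\<close>

definition condition_a :: "'w measure \<Rightarrow> (real \<Rightarrow> 'w \<Rightarrow> real) \<Rightarrow> real \<Rightarrow> real \<Rightarrow> bool" where
  "condition_a M X a b \<longleftrightarrow>
     (\<exists>r :: nat \<Rightarrow> nat \<Rightarrow> real. \<forall>s t.
        (\<forall>m. summable (\<lambda>n. r m n * s ^ m * t ^ n)) \<and>
        (\<lambda>m. \<Sum>n. r m n * s ^ m * t ^ n) sums cov_fun M X s t) \<and>
     (\<forall>c d. \<forall>\<nu>\<in>borel_probs c d. energy (cov_fun M X) \<nu> > 0) \<and>
     smooth_paths M X \<and>
     (\<forall>ps :: (real \<times> nat) list. distinct ps \<longrightarrow>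
        invertible_mat (covariance_mat M (map (\<lambda>(s, n). path_deriv X n s) ps))) \<and>
     (\<forall>s\<in>{a..b}. Limsup at_top (\<lambda>t. ereal (cov_fun M X s t)) \<le> 0)"

text \<open>The process is taken to be a version with smooth paths here as well.\<close>

definition condition_b :: "'w measure \<Rightarrow> (real \<Rightarrow> 'w \<Rightarrow> real) \<Rightarrow> bool" where
  "condition_b M X \<longleftrightarrow>
     stationary_process M X \<and>
     (\<exists>F. is_spectral_measure M X F \<and>
        (\<forall>t. (\<integral>\<^sup>+x. ennreal (exp (t * x)) \<partial>F) < \<infinity>) \<and>
        (\<exists>x. x islimpt measure_support F)) \<and>
     smooth_paths M X"

section \<open>Conditional mean and location of the minimum\<close>

text \<open>The sum of the coefficients \<open>c s\<close>, \<open>s \<in> S\<close>, for which \<open>\<Sum>s\<in>S. c s * X s\<close> is a version of the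
  conditional expectation of \<open>X t\<close> given the \<open>X s\<close>, \<open>s \<in> S\<close>; that is, this conditional expectation
  evaluated where every \<open>X s\<close> equals 1.  Intended for finite \<open>S\<close> for which the covariance matrix of
  the \<open>X s\<close> is invertible, so that the coefficients are unique.\<close>

definition cond_mean_given_one ::
    "'w measure \<Rightarrow> (real \<Rightarrow> 'w \<Rightarrow> real) \<Rightarrow> real set \<Rightarrow> real \<Rightarrow> real" where
  "cond_mean_given_one M X S t =
     (THE m. \<exists>c :: real \<Rightarrow> real.
        (AE \<omega> in M.
           real_cond_exp M
             (vimage_algebra (space M) (\<lambda>\<omega>. \<lambda>s\<in>S. X s \<omega>) (\<Pi>\<^sub>M s\<in>S. borel)) (X t) \<omega>
           = (\<Sum>s\<in>S. c s * X s \<omega>)) \<and>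
        m = (\<Sum>s\<in>S. c s))"

definition leftmost_argmin :: "real \<Rightarrow> real \<Rightarrow> (real \<Rightarrow> real) \<Rightarrow> real" where
  "leftmost_argmin a b f = (LEAST t. is_arg_min f (\<lambda>s. s \<in> {a..b}) t)"

text \<open>The law of the leftmost argmin over \<open>[a,b]\<close>, conditionally on the minimum over \<open>[a,b]\<close>
  exceeding \<open>u\<close>; \<^const>\<open>uniform_measure\<close> \<open>M A\<close> is \<open>M\<close> conditioned on the event \<open>A\<close>.\<close>

definition cond_argmin_law ::
    "'w measure \<Rightarrow> (real \<Rightarrow> 'w \<Rightarrow> real) \<Rightarrow> real \<Rightarrow> real \<Rightarrow> real \<Rightarrow> real measure" where
  "cond_argmin_law M X a b u =
     distr (uniform_measure M {\<omega> \<in> space M. (INF s\<in>{a..b}. X s \<omega>) > u})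
       (restrict_space borel {a..b}) (\<lambda>\<omega>. leftmost_argmin a b (\<lambda>s. X s \<omega>))"

end

theory Submission
  imports
    Defs
    "HOL-Complex_Analysis.Complex_Analysis"
    "HOL-Real_Asymp.Real_Asymp"
begin

text \<open>The minimizer is \<open>\<nu> = (\<Sum>j. \<theta> j \<delta>(t j))\<close> and, with \<open>Z = (\<Sum>j. \<theta> j X(t j))\<close> of variance \<open>v\<close>,
  minimality gives \<open>E (X t Z) \<ge> v\<close> on \<open>[a,b]\<close> with equality on the support.  Given \<open>min X > u\<close>, the
  process concentrates around \<open>u E (X t Z) / v\<close>, because \<open>Z > u\<close> on this event and \<open>Z\<close> is independent
  of the residual.  By the Cameron-Martin formula, raising the level \<open>u\<close> to \<open>u + h / u\<close>, where \<open>h\<close> is the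
  covariance of \<open>X\<close> with \<open>L = (\<Sum>j. c j X(t j))\<close>, multiplies the probability by
  \<open>E (exp (- L / u - Var L / (2 u\<^sup>2)) | min X > u)\<close>, which tends to
  \<open>exp (- (\<Sum>j. c j)) = exp (- (\<Sum>j. \<theta> j h(t j)) / v)\<close>.  Since \<open>h(t j)\<close> can be prescribed
  freely, the minima of \<open>u (X - u)\<close> near the points \<open>t j\<close> behave like independent exponential variables
  of rates \<open>\<theta> j / v\<close>, and the smallest of these is the \<open>j\<close>-th one with probability \<open>\<theta> j\<close>.\<close>

section \<open>Uniqueness of the Fourier transform and centered Gaussian variables\<close>

text \<open>The asymptotics of \<open>g u\<close>, the probability of exceeding \<open>u\<close> on
  all of [a,b], are never computed. All estimates are ratios: errors are bounded by small multiples
  of \<open>g u\<close>, and the Cameron-Martin formula compares \<open>g u\<close> with the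
  probability at a nearby level. Because only \<open>comb c / u\<close> enters the density,
  concentration of the paths at scale \<open>e * u\<close> suffices, although the minimum is
  resolved at scale 1 / u. The exponential variables are a heuristic: their joint law is replaced by
  a fixed-point inequality for the best lower bound on the probability of a minimum near a given
  point. Lower bounds are enough, because the weights \<theta> add up to 1 and leave no room for an
  excess. Conditions (a) and (b) enter through smooth paths, linear independence of the variables
  \<open>X t\<close>, and finiteness of the set where the potential is minimal. This finiteness
  comes from analyticity: an infinite contact set would make the potential constant.\<close>

lemma exp_mult_normal_density:
  assumes "0 < \<sigma>"
  shows "exp (p * x) * normal_density 0 \<sigma> x =
    exp (p\<^sup>2 * \<sigma>\<^sup>2 / 2) * normal_density (p * \<sigma>\<^sup>2) \<sigma> x"
proof -
  have "p * x + - (x - 0)\<^sup>2 / (2 * \<sigma>\<^sup>2) = p\<^sup>2 * \<sigma>\<^sup>2 / 2 + - (x - p * \<sigma>\<^sup>2)\<^sup>2 / (2 * \<sigma>\<^sup>2)"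
    using assms by (simp add: field_simps power2_eq_square)
  then show ?thesis
    by (simp add: normal_density_def exp_add[symmetric])
qed

lemma (in prob_space) centered_gaussian_cases:
  assumes g: "gaussian_rv M Y" and E: "expectation Y = 0"
  obtains "AE \<omega> in M. Y \<omega> = 0"
  | \<sigma> where "0 < \<sigma>" "distributed M lborel Y (normal_density 0 \<sigma>)"
proof -
  from g obtain m \<sigma> where Y[measurable]: "Y \<in> borel_measurable M"
    and \<sigma>: "0 \<le> \<sigma>" and d: "distr M borel Y = gaussian_law m \<sigma>"
    by (auto simp: gaussian_rv_def)
  show thesis
  proof (cases "\<sigma> = 0")
    case True
    then have d: "distr M borel Y = return borel m"
      using d by (simp add: gaussian_law_def)
    have "0 = (\<integral>x. x \<partial>distr M borel Y)"
      using E by (simp add: integral_distr)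
    also have "\<dots> = m"
      unfolding d by (subst integral_return) auto
    finally have "m = 0" by simp
    have "AE x in distr M borel Y. x = 0"
      unfolding d \<open>m = 0\<close> by (subst AE_return) auto
    then have "AE \<omega> in M. Y \<omega> = 0"
      by (subst (asm) AE_distr_iff) auto
    then show thesis by (rule that(1))
  next
    case False
    with \<sigma> have "0 < \<sigma>" by simp
    have "distr M lborel Y = distr M borel Y"
      by (rule distr_cong) auto
    then have D: "distributed M lborel Y (normal_density m \<sigma>)"
      using d False by (simp add: distributed_def gaussian_law_def)
    have "m = 0"
      using normal_distributed_expectation[OF \<open>0 < \<sigma>\<close> D] E by simp
    with D \<open>0 < \<sigma>\<close> show thesis by (intro that(2)) auto
  qed
qed

lemma (in prob_space) centered_gaussian_square_integrable:
  assumes g: "gaussian_rv M Y" and E: "expectation Y = 0"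
  shows "integrable M (\<lambda>\<omega>. (Y \<omega>)\<^sup>2)"
proof -
  have [measurable]: "Y \<in> borel_measurable M" using g by (simp add: gaussian_rv_def)
  show ?thesis
    using centered_gaussian_cases[OF g E]
  proof cases
    case 1
    then show ?thesis
      by (subst integrable_cong_AE[where g="\<lambda>_. 0"]) auto
  next
    case (2 \<sigma>)
    show ?thesis
      using distributed_integrable[OF 2(2), of "\<lambda>x. x\<^sup>2"] integrable_normal_moment[OF 2(1), of 0 2]
      by simp
  qed
qed

lemma (in prob_space) centered_gaussian_distributed:
  assumes g: "gaussian_rv M Y" and E: "expectation Y = 0"
    and v: "expectation (\<lambda>\<omega>. (Y \<omega>)\<^sup>2) > 0"
  shows "distributed M lborel Y (normal_density 0 (sqrt (expectation (\<lambda>\<omega>. (Y \<omega>)\<^sup>2))))"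
  using centered_gaussian_cases[OF g E]
proof cases
  case 1
  have [measurable]: "Y \<in> borel_measurable M" using g by (simp add: gaussian_rv_def)
  have "expectation (\<lambda>\<omega>. (Y \<omega>)\<^sup>2) = expectation (\<lambda>\<omega>. 0)"
    using 1 by (intro integral_cong_AE) auto
  with v show ?thesis by simp
next
  case (2 \<sigma>)
  have "expectation (\<lambda>\<omega>. (Y \<omega>)\<^sup>2) = \<sigma>\<^sup>2"
    using normal_distributed_variance[OF 2] E by simp
  then show ?thesis using 2 by simp
qed

lemma (in prob_space) centered_gaussian_mgf:
  assumes g: "gaussian_rv M Y" and E: "expectation Y = 0"
  shows "integrable M (\<lambda>\<omega>. exp (Y \<omega>))" (is ?int)
    and "expectation (\<lambda>\<omega>. exp (Y \<omega>)) = exp (expectation (\<lambda>\<omega>. (Y \<omega>)\<^sup>2) / 2)" (is ?eq)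
proof -
  have [measurable]: "Y \<in> borel_measurable M" using g by (simp add: gaussian_rv_def)
  have "?int \<and> ?eq"
    using centered_gaussian_cases[OF g E]
  proof cases
    case 1
    have "expectation (\<lambda>\<omega>. exp (Y \<omega>)) = expectation (\<lambda>\<omega>. 1)"
      using 1 by (intro integral_cong_AE) auto
    moreover have "expectation (\<lambda>\<omega>. (Y \<omega>)\<^sup>2) = expectation (\<lambda>\<omega>. 0)"
      using 1 by (intro integral_cong_AE) auto
    moreover have ?int
      using 1 by (subst integrable_cong_AE[where g="\<lambda>_. 1"]) auto
    ultimately show ?thesis by (simp add: prob_space)
  next
    case (2 \<sigma>)
    have v: "expectation (\<lambda>\<omega>. (Y \<omega>)\<^sup>2) = \<sigma>\<^sup>2"
      using normal_distributed_variance[OF 2] E by simp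
    have *: "normal_density 0 \<sigma> x * exp x = exp (\<sigma>\<^sup>2 / 2) * normal_density (\<sigma>\<^sup>2) \<sigma> x" for x
      using exp_mult_normal_density[OF 2(1), of 1 x] by (simp add: mult.commute)
    have "integrable M (\<lambda>\<omega>. exp (Y \<omega>))"
      using distributed_integrable[OF 2(2), of exp] 2(1) unfolding * by simp
    moreover have "expectation (\<lambda>\<omega>. exp (Y \<omega>)) = exp (\<sigma>\<^sup>2 / 2)"
      using distributed_integral[OF 2(2), of exp] 2(1) unfolding * by simp
    ultimately show ?thesis by (simp add: v)
  qed
  then show ?int ?eq by auto
qed

lemma (in prob_space) centered_gaussian_char:
  assumes g: "gaussian_rv M Y" and E: "expectation Y = 0"
  shows "expectation (\<lambda>\<omega>. iexp (Y \<omega>)) = of_real (exp (- expectation (\<lambda>\<omega>. (Y \<omega>)\<^sup>2) / 2))"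
proof -
  have [measurable]: "Y \<in> borel_measurable M" using g by (simp add: gaussian_rv_def)
  show ?thesis
    using centered_gaussian_cases[OF g E]
  proof cases
    case 1
    have "expectation (\<lambda>\<omega>. iexp (Y \<omega>)) = expectation (\<lambda>\<omega>. 1::complex)"
      using 1 by (intro integral_cong_AE) auto
    moreover have "expectation (\<lambda>\<omega>. (Y \<omega>)\<^sup>2) = expectation (\<lambda>\<omega>. 0)"
      using 1 by (intro integral_cong_AE) auto
    ultimately show ?thesis by (simp add: prob_space)
  next
    case (2 \<sigma>)
    have v: "expectation (\<lambda>\<omega>. (Y \<omega>)\<^sup>2) = \<sigma>\<^sup>2"
      using normal_distributed_variance[OF 2] E by simp
    have "distributed M lborel (\<lambda>x. (Y x - 0) / \<sigma>) std_normal_density"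
      using 2 normal_standard_normal_convert[OF 2(1), of Y 0] by simp
    then have d: "distr M lborel (\<lambda>x. Y x / \<sigma>) = std_normal_distribution"
      by (simp add: distributed_def)
    have "expectation (\<lambda>\<omega>. iexp (Y \<omega>)) = (\<integral>x. iexp (\<sigma> * x) \<partial>distr M lborel (\<lambda>x. Y x / \<sigma>))"
      using 2(1) by (subst integral_distr) auto
    also have "\<dots> = char std_normal_distribution \<sigma>"
      unfolding d char_def ..
    finally show ?thesis by (simp add: char_std_normal_distribution v)
  qed
qed

text \<open>The positive and negative parts of \<open>V\<close> have equal mass (take p = 0).
  Divided by this mass they become probability densities under which \<open>Y\<close> has the same
  characteristic function, and Levy's uniqueness theorem identifies the two laws. Mass zero cannot
  be normalized, but then \<open>V\<close> vanishes almost surely.\<close>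

lemma (in prob_space) char_zero_imp_zero_real:
  fixes V :: "'a \<Rightarrow> real"
  assumes V: "integrable M V" and Y[measurable]: "Y \<in> borel_measurable M"
    and z: "\<And>p. expectation (\<lambda>\<omega>. V \<omega> * iexp (p * Y \<omega>)) = 0"
    and B[measurable]: "B \<in> sets borel"
  shows "expectation (\<lambda>\<omega>. V \<omega> * indicator B (Y \<omega>)) = 0"
proof -
  have [measurable]: "V \<in> borel_measurable M" using V by auto
  define P where "P = (\<lambda>\<omega>. max 0 (V \<omega>))"
  define N where "N = (\<lambda>\<omega>. max 0 (- V \<omega>))"
  have [measurable]: "P \<in> borel_measurable M" "N \<in> borel_measurable M"
    by (auto simp: P_def N_def)
  have int: "integrable M P" "integrable M N"
    using V by (auto simp: P_def N_def intro!: integrable_max)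
  have nn: "P \<omega> \<ge> 0" "N \<omega> \<ge> 0" and V_eq: "V \<omega> = P \<omega> - N \<omega>" for \<omega>
    by (auto simp: P_def N_def)
  have ci: "integrable M (\<lambda>\<omega>. complex_of_real (F \<omega>) * iexp (p * Y \<omega>))"
    if "integrable M F" for F p
    by (rule Bochner_Integration.integrable_bound[OF that])
      (use that in \<open>auto simp: norm_mult\<close>)
  have eqc: "expectation (\<lambda>\<omega>. P \<omega> * iexp (p * Y \<omega>)) = expectation (\<lambda>\<omega>. N \<omega> * iexp (p * Y \<omega>))" for p
    using z[of p] ci[OF int(1), of p] ci[OF int(2), of p]
    by (simp add: V_eq left_diff_distrib of_real_diff)
  have "complex_of_real (expectation P) = complex_of_real (expectation N)"
    using eqc[of 0] by simp
  then have m: "expectation P = expectation N" by simp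
  have fin: "integrable M (\<lambda>\<omega>. F \<omega> * indicator B (Y \<omega>))" if "integrable M F" for F :: "'a \<Rightarrow> real"
    by (rule Bochner_Integration.integrable_bound[OF that])
      (use that in \<open>auto simp: indicator_def\<close>)
  show ?thesis
  proof (cases "expectation P = 0")
    case True
    have "AE \<omega> in M. P \<omega> = 0" "AE \<omega> in M. N \<omega> = 0"
      using True m int nn integral_nonneg_eq_0_iff_AE[of M P] integral_nonneg_eq_0_iff_AE[of M N] by auto
    then have "AE \<omega> in M. V \<omega> * indicator B (Y \<omega>) = 0"
      by eventually_elim (simp add: V_eq)
    then have "expectation (\<lambda>\<omega>. V \<omega> * indicator B (Y \<omega>)) = expectation (\<lambda>\<omega>. 0)"
      by (intro integral_cong_AE) auto
    then show ?thesis by simp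
  next
    case False
    define c where "c = expectation P"
    have "c > 0" using False nn by (simp add: c_def integral_nonneg_AE less_le)
    define D where "D = (\<lambda>F. distr (density M (\<lambda>\<omega>. ennreal (F \<omega> / c))) borel Y)"
    have Dprob: "real_distribution (D F)"
      if "integrable M F" "\<And>\<omega>. F \<omega> \<ge> 0" "expectation F = c" for F
    proof -
      have [measurable]: "F \<in> borel_measurable M" using that by auto
      have "(\<integral>\<^sup>+\<omega>. ennreal (F \<omega> / c) \<partial>M) = ennreal (\<integral>\<omega>. F \<omega> / c \<partial>M)"
        using that \<open>c > 0\<close> by (intro nn_integral_eq_integral) auto
      also have "\<dots> = 1" using that \<open>c > 0\<close> by simp
      finally have "prob_space (density M (\<lambda>\<omega>. ennreal (F \<omega> / c)))"
        by (intro prob_spaceI) (simp add: emeasure_density cong: nn_integral_cong)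
      then show ?thesis
        unfolding D_def by (intro prob_space.real_distribution_distr) (use Y in simp_all)
    qed
    have Dchar: "char (D F) p = expectation (\<lambda>\<omega>. F \<omega> * iexp (p * Y \<omega>)) / c"
      if "integrable M F" "\<And>\<omega>. F \<omega> \<ge> 0" for F p
    proof -
      have [measurable]: "F \<in> borel_measurable M" using that by auto
      have "char (D F) p = expectation (\<lambda>\<omega>. (F \<omega> / c) *\<^sub>R iexp (p * Y \<omega>))"
        unfolding D_def char_def using that \<open>c > 0\<close>
        by (simp add: integral_distr integral_density)
      also have "\<dots> = expectation (\<lambda>\<omega>. (F \<omega> * iexp (p * Y \<omega>)) / c)"
        by (intro Bochner_Integration.integral_cong) (auto simp: scaleR_conv_of_real)
      finally show ?thesis by simp
    qed
    have DPN: "D P = D N"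
    proof (rule Levy_uniqueness)
      show "real_distribution (D P)" "real_distribution (D N)"
        using Dprob int nn m by (auto simp: c_def)
      show "char (D P) = char (D N)"
        using Dchar int nn eqc by (auto simp: fun_eq_iff)
    qed
    have mD: "measure (D F) B = expectation (\<lambda>\<omega>. F \<omega> * indicator B (Y \<omega>)) / c"
      if "integrable M F" "\<And>\<omega>. F \<omega> \<ge> 0" "expectation F = c" for F
    proof -
      have [measurable]: "F \<in> borel_measurable M" using that by auto
      interpret d: real_distribution "D F" by (rule Dprob[OF that])
      have "measure (D F) B = (\<integral>x. indicator B x \<partial>D F)" by simp
      also have "(\<integral>x. indicat_real B x \<partial>D F) = expectation (\<lambda>\<omega>. (F \<omega> / c) *\<^sub>R indicat_real B (Y \<omega>))"
        unfolding D_def using that \<open>c > 0\<close>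
        by (subst integral_distr) (simp_all add: integral_density)
      also have "\<dots> = expectation (\<lambda>\<omega>. (F \<omega> * indicator B (Y \<omega>)) / c)"
        by (intro Bochner_Integration.integral_cong) auto
      finally show ?thesis by simp
    qed
    have "expectation (\<lambda>\<omega>. P \<omega> * indicator B (Y \<omega>)) / c = expectation (\<lambda>\<omega>. N \<omega> * indicator B (Y \<omega>)) / c"
      using mD[OF int(1) nn(1) c_def[symmetric]] mD[OF int(2) nn(2), folded m, OF c_def[symmetric]] DPN
      by metis
    then have "expectation (\<lambda>\<omega>. P \<omega> * indicator B (Y \<omega>)) = expectation (\<lambda>\<omega>. N \<omega> * indicator B (Y \<omega>))"
      using \<open>c > 0\<close> by simp
    then show ?thesis
      using fin[OF int(1)] fin[OF int(2)] by (simp add: V_eq left_diff_distrib)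
  qed
qed

text \<open>Conjugating the hypothesis at - p gives the same hypothesis for \<open>cnj V\<close>,
  hence for the real and imaginary parts of \<open>V\<close>.\<close>

lemma (in prob_space) char_zero_imp_zero:
  fixes V :: "'a \<Rightarrow> complex"
  assumes V: "integrable M V" and Y[measurable]: "Y \<in> borel_measurable M"
    and z: "\<And>p. expectation (\<lambda>\<omega>. V \<omega> * iexp (p * Y \<omega>)) = 0"
    and B[measurable]: "B \<in> sets borel"
  shows "expectation (\<lambda>\<omega>. V \<omega> * indicator B (Y \<omega>)) = 0"
proof -
  have [measurable]: "V \<in> borel_measurable M" using V by auto
  have z': "expectation (\<lambda>\<omega>. cnj (V \<omega>) * iexp (p * Y \<omega>)) = 0" for p
  proof -
    have "expectation (\<lambda>\<omega>. cnj (V \<omega>) * iexp (p * Y \<omega>)) = expectation (\<lambda>\<omega>. cnj (V \<omega> * iexp (- p * Y \<omega>)))"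
      by (intro Bochner_Integration.integral_cong) (auto simp: exp_cnj)
    also have "\<dots> = cnj (expectation (\<lambda>\<omega>. V \<omega> * iexp (- p * Y \<omega>)))"
      by (rule Bochner_Integration.integral_cnj)
    also have "\<dots> = cnj 0" by (simp only: z)
    finally show ?thesis by simp
  qed
  have ci: "integrable M (\<lambda>\<omega>. F \<omega> * iexp (p * Y \<omega>))" if "integrable M F" for F :: "'a \<Rightarrow> complex" and p
    by (rule Bochner_Integration.integrable_bound[OF that])
      (use that in \<open>auto simp: norm_mult\<close>)
  have icnj: "integrable M (\<lambda>\<omega>. cnj (V \<omega>))" using V by simp
  have re: "expectation (\<lambda>\<omega>. Re (V \<omega>) * iexp (p * Y \<omega>)) = 0" for p
  proof -
    have "expectation (\<lambda>\<omega>. Re (V \<omega>) * iexp (p * Y \<omega>)) =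
       expectation (\<lambda>\<omega>. (V \<omega> * iexp (p * Y \<omega>) + cnj (V \<omega>) * iexp (p * Y \<omega>)) / 2)"
      by (intro Bochner_Integration.integral_cong refl)
        (simp add: complex_add_cnj distrib_right[symmetric] del: distrib_right_numeral)
    also have "\<dots> = 0"
      using z[of p] z'[of p] ci[OF V, of p] ci[OF icnj, of p]
      by (simp add: Bochner_Integration.integral_add del: integrable_cnj)
    finally show ?thesis .
  qed
  have im: "expectation (\<lambda>\<omega>. Im (V \<omega>) * iexp (p * Y \<omega>)) = 0" for p
  proof -
    have "expectation (\<lambda>\<omega>. Im (V \<omega>) * iexp (p * Y \<omega>)) =
       expectation (\<lambda>\<omega>. (V \<omega> * iexp (p * Y \<omega>) - cnj (V \<omega>) * iexp (p * Y \<omega>)) / (2 * \<i>))"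
      by (intro Bochner_Integration.integral_cong refl)
        (simp add: complex_diff_cnj left_diff_distrib[symmetric] field_simps)
    also have "\<dots> = 0"
      using z[of p] z'[of p] ci[OF V, of p] ci[OF icnj, of p]
      by (simp add: Bochner_Integration.integral_diff del: integrable_cnj)
    finally show ?thesis .
  qed
  have r: "expectation (\<lambda>\<omega>. Re (V \<omega>) * indicator B (Y \<omega>)) = 0"
    by (rule char_zero_imp_zero_real[OF _ Y re B]) (use V in simp)
  have i: "expectation (\<lambda>\<omega>. Im (V \<omega>) * indicator B (Y \<omega>)) = 0"
    by (rule char_zero_imp_zero_real[OF _ Y im B]) (use V in simp)
  have fin: "integrable M (\<lambda>\<omega>. V \<omega> * indicator B (Y \<omega>))"
    by (rule Bochner_Integration.integrable_bound[OF V])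
      (auto simp: indicator_def)
  have "Re (expectation (\<lambda>\<omega>. V \<omega> * indicator B (Y \<omega>))) = expectation (\<lambda>\<omega>. Re (V \<omega>) * indicator B (Y \<omega>))"
    using fin by (subst integral_Re[symmetric]) (auto intro!: Bochner_Integration.integral_cong simp: indicator_def)
  moreover have "Im (expectation (\<lambda>\<omega>. V \<omega> * indicator B (Y \<omega>))) = expectation (\<lambda>\<omega>. Im (V \<omega>) * indicator B (Y \<omega>))"
    using fin by (subst integral_Im[symmetric]) (auto intro!: Bochner_Integration.integral_cong simp: indicator_def)
  ultimately show ?thesis using r i by (simp add: complex_eq_iff)
qed

text \<open>One exponential at a time is traded for an indicator, and all other factors are absorbed
  into the weight. This is why the weight has to be complex: at the step for the new index it
  contains the exponential of the remaining sum.\<close>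

lemma (in prob_space) char_zero_imp_zero_finite:
  fixes V :: "'a \<Rightarrow> complex"
  assumes "finite J" and V: "integrable M V" and Y: "\<And>j. j \<in> J \<Longrightarrow> Y j \<in> borel_measurable M"
    and z: "\<And>l. expectation (\<lambda>\<omega>. V \<omega> * iexp (\<Sum>j\<in>J. l j * Y j \<omega>)) = 0"
    and B: "\<And>j. j \<in> J \<Longrightarrow> B j \<in> sets borel"
  shows "expectation (\<lambda>\<omega>. V \<omega> * (\<Prod>j\<in>J. indicator (B j) (Y j \<omega>))) = 0"
  using assms
proof (induction J arbitrary: V rule: finite_induct)
  case empty
  then show ?case by simp
next
  case (insert j J)
  have Yj[measurable]: "Y j \<in> borel_measurable M" and Bj[measurable]: "B j \<in> sets borel"
    and YJ: "\<And>i. i \<in> J \<Longrightarrow> Y i \<in> borel_measurable M"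
    using insert.prems by auto
  have [measurable]: "V \<in> borel_measurable M" using insert.prems(1) by auto
  have m[measurable]: "(\<lambda>\<omega>. \<Sum>j\<in>J. l j * Y j \<omega>) \<in> borel_measurable M" for l
    using YJ by (intro borel_measurable_sum borel_measurable_times) auto
  have "expectation (\<lambda>\<omega>. V \<omega> * indicator (B j) (Y j \<omega>) * (\<Prod>j\<in>J. indicator (B j) (Y j \<omega>))) = 0"
  proof (rule insert.IH)
    show "integrable M (\<lambda>\<omega>. V \<omega> * indicator (B j) (Y j \<omega>))"
      by (rule Bochner_Integration.integrable_bound[OF insert.prems(1)])
        (auto simp: indicator_def)
    fix l :: "'b \<Rightarrow> real"
    have "expectation (\<lambda>\<omega>. (V \<omega> * iexp (\<Sum>j\<in>J. l j * Y j \<omega>)) * indicator (B j) (Y j \<omega>)) = 0"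
    proof (rule char_zero_imp_zero[OF _ Yj _ Bj])
      show "integrable M (\<lambda>\<omega>. V \<omega> * iexp (\<Sum>j\<in>J. l j * Y j \<omega>))"
        by (rule Bochner_Integration.integrable_bound[OF insert.prems(1)])
          (use m[of l] in \<open>auto simp: norm_mult simp del: of_real_sum of_real_mult\<close>)
      fix p
      have *: "(\<Sum>i\<in>J. (l(j := p)) i * Y i \<omega>) = (\<Sum>i\<in>J. l i * Y i \<omega>)" for \<omega>
        using insert.hyps by (intro sum.cong) auto
      have **: "V \<omega> * iexp (\<Sum>i\<in>insert j J. (l(j := p)) i * Y i \<omega>) =
          V \<omega> * iexp (\<Sum>j\<in>J. l j * Y j \<omega>) * iexp (p * Y j \<omega>)" for \<omega>
        unfolding sum.insert[OF insert.hyps] * by (simp add: distrib_left exp_add mult_ac)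
      have "expectation (\<lambda>\<omega>. V \<omega> * iexp (\<Sum>i\<in>insert j J. (l(j := p)) i * Y i \<omega>)) = 0"
        by (rule insert.prems)
      then show "expectation (\<lambda>\<omega>. V \<omega> * iexp (\<Sum>j\<in>J. l j * Y j \<omega>) * iexp (p * Y j \<omega>)) = 0"
        unfolding ** .
    qed
    then show "expectation (\<lambda>\<omega>. V \<omega> * indicator (B j) (Y j \<omega>) * iexp (\<Sum>j\<in>J. l j * Y j \<omega>)) = 0"
      by (simp add: mult_ac)
  qed (use insert.prems in auto)
  then show ?case using insert.hyps by (simp add: mult_ac)
qed

section \<open>The Gaussian space of a process\<close>

lemma (in prob_space) prob_eq_expectation:
  assumes "{\<omega> \<in> space M. P \<omega>} \<in> events" "\<And>\<omega>. \<omega> \<in> space M \<Longrightarrow> f \<omega> = of_bool (P \<omega>)"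
  shows "prob {\<omega> \<in> space M. P \<omega>} = expectation f"
proof -
  have "expectation f = expectation (indicator {\<omega> \<in> space M. P \<omega>})"
    using assms by (intro Bochner_Integration.integral_cong) (auto simp: indicator_def)
  also have "\<dots> = prob ({\<omega> \<in> space M. P \<omega>} \<inter> space M)" by (rule Bochner_Integration.integral_indicator)
  also have "{\<omega> \<in> space M. P \<omega>} \<inter> space M = {\<omega> \<in> space M. P \<omega>}" by auto
  finally show ?thesis by simp
qed

lemma (in prob_space) emeasure_eq_nn_integral:
  assumes "{\<omega> \<in> space M. P \<omega>} \<in> events" "\<And>\<omega>. \<omega> \<in> space M \<Longrightarrow> f \<omega> = of_bool (P \<omega>)"
  shows "emeasure M {\<omega> \<in> space M. P \<omega>} = (\<integral>\<^sup>+\<omega>. f \<omega> \<partial>M)"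
  unfolding nn_integral_indicator[OF assms(1), symmetric]
  using assms by (intro nn_integral_cong) (auto simp: indicator_def)

locale centered_gaussian_process = prob_space M
  for M :: "'w measure" and X :: "real \<Rightarrow> 'w \<Rightarrow> real" +
  assumes gaussian: "gaussian_process M X" and centered: "centered_process M X"
begin

text \<open>The linear span of the process without its closure in L2: finite combinations are all
  that is needed, and for them Gaussianity holds by definition of the process.\<close>

definition lin :: "('w \<Rightarrow> real) \<Rightarrow> bool" where
  "lin L \<longleftrightarrow> (\<exists>J c. finite J \<and> L = (\<lambda>\<omega>. \<Sum>t\<in>J. c t * X t \<omega>))"

lemma lin_finite_sum: "finite J \<Longrightarrow> lin (\<lambda>\<omega>. \<Sum>t\<in>J. c t * X t \<omega>)"
  by (auto simp: lin_def)

lemma lin_X: "lin (X t)"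
  using lin_finite_sum[of "{t}" "\<lambda>_. 1"] by simp

lemma lin_zero: "lin (\<lambda>\<omega>. 0)"
  using lin_finite_sum[of "{}"] by simp

lemma lin_scale: assumes "lin L" shows "lin (\<lambda>\<omega>. c * L \<omega>)"
proof -
  from assms obtain J d where J: "finite J" "L = (\<lambda>\<omega>. \<Sum>t\<in>J. d t * X t \<omega>)"
    by (auto simp: lin_def)
  show ?thesis
    using lin_finite_sum[OF J(1), of "\<lambda>t. c * d t"] by (simp add: J(2) sum_distrib_left mult.assoc)
qed

lemma lin_add: assumes "lin L" "lin K" shows "lin (\<lambda>\<omega>. L \<omega> + K \<omega>)"
proof -
  from assms obtain J d I e where J: "finite J" "L = (\<lambda>\<omega>. \<Sum>t\<in>J. d t * X t \<omega>)"
    and I: "finite I" "K = (\<lambda>\<omega>. \<Sum>t\<in>I. e t * X t \<omega>)"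
    by (auto simp: lin_def)
  have "(\<Sum>t\<in>J. d t * X t \<omega>) = (\<Sum>t\<in>J \<union> I. (if t \<in> J then d t else 0) * X t \<omega>)" for \<omega>
    using J I by (intro sum.mono_neutral_cong_left) auto
  moreover have "(\<Sum>t\<in>I. e t * X t \<omega>) = (\<Sum>t\<in>J \<union> I. (if t \<in> I then e t else 0) * X t \<omega>)" for \<omega>
    using J I by (intro sum.mono_neutral_cong_left) auto
  ultimately have "(\<lambda>\<omega>. L \<omega> + K \<omega>) =
      (\<lambda>\<omega>. \<Sum>t\<in>J \<union> I. ((if t \<in> J then d t else 0) + (if t \<in> I then e t else 0)) * X t \<omega>)"
    by (simp add: J(2) I(2) sum.distrib[symmetric] distrib_right)
  then show ?thesis
    using lin_finite_sum[of "J \<union> I"] J I by simp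
qed

lemma lin_diff: "lin L \<Longrightarrow> lin K \<Longrightarrow> lin (\<lambda>\<omega>. L \<omega> - K \<omega>)"
  using lin_add[of L "\<lambda>\<omega>. - 1 * K \<omega>"] lin_scale[of K "-1"] by simp

lemma lin_sum: assumes "finite J" "\<And>j. j \<in> J \<Longrightarrow> lin (L j)" shows "lin (\<lambda>\<omega>. \<Sum>j\<in>J. L j \<omega>)"
  using assms by (induction J) (auto intro: lin_zero lin_add)

lemma X_measurable[measurable]: "X t \<in> borel_measurable M"
  using gaussian[unfolded gaussian_process_def, rule_format, of "{t}" "\<lambda>_. 1"]
  by (simp add: gaussian_rv_def)

lemma lin_gaussian: assumes "lin L" shows "gaussian_rv M L"
  using assms gaussian by (auto simp: lin_def gaussian_process_def)

lemma lin_measurable: "lin L \<Longrightarrow> L \<in> borel_measurable M"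
  using lin_gaussian by (auto simp: gaussian_rv_def)

lemma X_square_integrable: "integrable M (\<lambda>\<omega>. (X t \<omega>)\<^sup>2)"
  using centered_gaussian_square_integrable[OF lin_gaussian[OF lin_X]] centered
  by (simp add: centered_process_def)

lemma X_integrable: "integrable M (X t)"
  by (rule square_integrable_imp_integrable[OF _ X_square_integrable]) simp

lemma lin_mean: assumes "lin L" shows "expectation L = 0"
proof -
  from assms obtain J c where J: "finite J" "L = (\<lambda>\<omega>. \<Sum>t\<in>J. c t * X t \<omega>)"
    by (auto simp: lin_def)
  show ?thesis
    using X_integrable centered by (simp add: J(2) centered_process_def)
qed

lemma lin_square_integrable: "lin L \<Longrightarrow> integrable M (\<lambda>\<omega>. (L \<omega>)\<^sup>2)"
  by (intro centered_gaussian_square_integrable lin_gaussian lin_mean)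

lemma lin_mult_integrable:
  assumes L: "lin L" and K: "lin K" shows "integrable M (\<lambda>\<omega>. L \<omega> * K \<omega>)"
proof -
  have [measurable]: "L \<in> borel_measurable M" "K \<in> borel_measurable M"
    using L K lin_measurable by auto
  show ?thesis
  proof (rule Bochner_Integration.integrable_bound)
    show "integrable M (\<lambda>\<omega>. (L \<omega>)\<^sup>2 + (K \<omega>)\<^sup>2)"
      using L K lin_square_integrable by auto
    have "\<bar>x * y\<bar> \<le> x\<^sup>2 + y\<^sup>2" for x y :: real
    proof -
      have "2 * \<bar>x * y\<bar> \<le> x\<^sup>2 + y\<^sup>2"
        using sum_squares_bound[of "\<bar>x\<bar>" "\<bar>y\<bar>"] by (simp add: abs_mult mult.assoc)
      then show ?thesis using abs_ge_zero[of "x * y"] by linarith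
    qed
    then show "AE \<omega> in M. norm (L \<omega> * K \<omega>) \<le> norm ((L \<omega>)\<^sup>2 + (K \<omega>)\<^sup>2)"
      by auto
  qed measurable
qed

text \<open>The uncentered second moment; on \<open>lin\<close> it is the covariance because of
  \<open>lin_mean\<close>.\<close>

definition cov :: "('w \<Rightarrow> real) \<Rightarrow> ('w \<Rightarrow> real) \<Rightarrow> real" where
  "cov L K = expectation (\<lambda>\<omega>. L \<omega> * K \<omega>)"

lemma cov_fun_eq: "cov_fun M X s t = cov (X s) (X t)"
  by (simp add: cov_fun_def cov_def)

lemma cov_commute: "cov L K = cov K L"
  by (simp add: cov_def mult.commute)

lemma cov_nonneg: "0 \<le> cov L L"
  by (simp add: cov_def integral_nonneg_AE)

lemma cov_add: "lin L \<Longrightarrow> lin K \<Longrightarrow> lin N \<Longrightarrow> cov (\<lambda>\<omega>. L \<omega> + K \<omega>) N = cov L N + cov K N"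
  by (simp add: cov_def distrib_right lin_mult_integrable)

lemma cov_diff: "lin L \<Longrightarrow> lin K \<Longrightarrow> lin N \<Longrightarrow> cov (\<lambda>\<omega>. L \<omega> - K \<omega>) N = cov L N - cov K N"
  by (simp add: cov_def left_diff_distrib lin_mult_integrable)

lemma cov_scale: "cov (\<lambda>\<omega>. c * L \<omega>) N = c * cov L N"
  by (simp add: cov_def mult.assoc)

lemma cov_scale_right: "cov N (\<lambda>\<omega>. c * L \<omega>) = c * cov N L"
  using cov_scale by (metis cov_commute)

lemma cov_add_right: "lin L \<Longrightarrow> lin K \<Longrightarrow> lin N \<Longrightarrow> cov N (\<lambda>\<omega>. L \<omega> + K \<omega>) = cov N L + cov N K"
  using cov_add by (metis cov_commute)

lemma cov_diff_right: "lin L \<Longrightarrow> lin K \<Longrightarrow> lin N \<Longrightarrow> cov N (\<lambda>\<omega>. L \<omega> - K \<omega>) = cov N L - cov N K"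
  using cov_diff by (metis cov_commute)

lemma cov_sum:
  fixes c :: "'i \<Rightarrow> real" and L :: "'i \<Rightarrow> 'w \<Rightarrow> real"
  assumes "finite J" "\<And>j. j \<in> J \<Longrightarrow> lin (L j)" "lin N"
  shows "cov (\<lambda>\<omega>. \<Sum>j\<in>J. c j * L j \<omega>) N = (\<Sum>j\<in>J. c j * cov (L j) N)"
  using assms
proof (induction J)
  case empty
  then show ?case by (simp add: cov_def)
next
  case (insert j J)
  have "lin (\<lambda>\<omega>. \<Sum>j\<in>J. c j * L j \<omega>)"
    using insert by (intro lin_sum lin_scale) auto
  then show ?case
    using insert by (simp add: cov_add cov_scale lin_scale)
qed

lemma cov_sum_right:
  fixes c :: "'i \<Rightarrow> real" and L :: "'i \<Rightarrow> 'w \<Rightarrow> real"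
  assumes "finite J" "\<And>j. j \<in> J \<Longrightarrow> lin (L j)" "lin N"
  shows "cov N (\<lambda>\<omega>. \<Sum>j\<in>J. c j * L j \<omega>) = (\<Sum>j\<in>J. c j * cov N (L j))"
  using cov_sum[OF assms, where c=c] by (simp add: cov_commute)

lemma lin_char: "lin L \<Longrightarrow> expectation (\<lambda>\<omega>. iexp (L \<omega>)) = of_real (exp (- cov L L / 2))"
  using centered_gaussian_char[OF lin_gaussian lin_mean, of L]
  by (simp add: cov_def power2_eq_square)

lemma lin_exp_integrable: "lin L \<Longrightarrow> integrable M (\<lambda>\<omega>. exp (L \<omega>))"
  by (intro centered_gaussian_mgf lin_gaussian lin_mean)

lemma lin_mgf: "lin L \<Longrightarrow> expectation (\<lambda>\<omega>. exp (L \<omega>)) = exp (cov L L / 2)"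
  using centered_gaussian_mgf(2)[OF lin_gaussian lin_mean, of L]
  by (simp add: cov_def power2_eq_square)

lemma lin_distributed:
  assumes "lin L" "cov L L > 0"
  shows "distributed M lborel L (normal_density 0 (sqrt (cov L L)))"
  using centered_gaussian_distributed[OF lin_gaussian lin_mean, of L] assms
  by (simp add: cov_def power2_eq_square)

lemma cov_eq_0_iff: assumes "lin L" shows "cov L L = 0 \<longleftrightarrow> (AE \<omega> in M. L \<omega> = 0)"
  unfolding cov_def using lin_mult_integrable[OF assms assms]
  by (subst integral_nonneg_eq_0_iff_AE) auto

lemma cov_eq_0_AE: assumes "lin L" "AE \<omega> in M. L \<omega> = 0" "lin K" shows "cov L K = 0"
proof -
  have [measurable]: "L \<in> borel_measurable M" "K \<in> borel_measurable M"
    using assms lin_measurable by auto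
  have "cov L K = expectation (\<lambda>\<omega>. 0)"
    unfolding cov_def using assms(2) by (intro integral_cong_AE) auto
  then show ?thesis by simp
qed

lemma uncorrelated_imp_char_factor:
  assumes L: "lin L" and K: "lin K" and "cov K L = 0"
  shows "expectation (\<lambda>\<omega>. iexp (L \<omega>) * iexp (K \<omega>)) =
    expectation (\<lambda>\<omega>. iexp (L \<omega>)) * expectation (\<lambda>\<omega>. iexp (K \<omega>))"
proof -
  have "cov (\<lambda>\<omega>. L \<omega> + K \<omega>) (\<lambda>\<omega>. L \<omega> + K \<omega>) = cov L L + cov K K"
    using assms by (simp add: cov_add cov_add_right lin_add cov_commute[of L K])
  moreover have "iexp (L \<omega>) * iexp (K \<omega>) = iexp (L \<omega> + K \<omega>)" for \<omega>
    by (simp add: exp_add distrib_left)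
  ultimately show ?thesis
    using lin_char[OF lin_add[OF L K]] lin_char[OF L] lin_char[OF K]
    by (simp add: exp_add[symmetric] of_real_mult[symmetric] add_divide_distrib del: of_real_mult)
qed

text \<open>Vanishing covariance factorizes characteristic functions, whereas independence concerns
  indicators. Fourier uniqueness is therefore applied twice: with weight \<open>iexp K - q\<close>
  it replaces the exponential of \<open>L\<close> by the indicator of \<open>A\<close>, and with
  weight \<open>indicator A L - p\<close> it replaces the exponentials of the
  \<open>Y j\<close>.\<close>

lemma uncorrelated_imp_indep_rect:
  assumes L: "lin L" and "finite J" and Y: "\<And>j. j \<in> J \<Longrightarrow> lin (Y j)"
    and unc: "\<And>j. j \<in> J \<Longrightarrow> cov (Y j) L = 0"
    and A[measurable]: "A \<in> sets borel" and B: "\<And>j. j \<in> J \<Longrightarrow> B j \<in> sets borel"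
  shows "expectation (\<lambda>\<omega>. indicator A (L \<omega>) * (\<Prod>j\<in>J. indicator (B j) (Y j \<omega>))) =
    expectation (\<lambda>\<omega>. indicator A (L \<omega>)) * expectation (\<lambda>\<omega>. \<Prod>j\<in>J. indicator (B j) (Y j \<omega>) :: real)"
proof -
  have Lm[measurable]: "L \<in> borel_measurable M" using L lin_measurable by auto
  have Ym: "\<And>j. j \<in> J \<Longrightarrow> Y j \<in> borel_measurable M" using Y lin_measurable by auto
  define p where "p = expectation (\<lambda>\<omega>. indicator A (L \<omega>) :: real)"
  have pc: "expectation (\<lambda>\<omega>. indicator A (L \<omega>) :: complex) = of_real p"
  proof -
    have "(indicator A (L \<omega>) :: complex) = of_real (indicator A (L \<omega>))" for \<omega>
      by (simp add: indicator_def)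
    then show ?thesis by (simp only: integral_complex_of_real p_def)
  qed
  define I where "I = (\<lambda>\<omega>. \<Prod>j\<in>J. indicator (B j) (Y j \<omega>) :: real)"
  have [measurable]: "I \<in> borel_measurable M"
    unfolding I_def by (intro borel_measurable_prod measurable_compose[OF Ym borel_measurable_indicator[OF B]])
  have Ib: "0 \<le> I \<omega>" "I \<omega> \<le> 1" for \<omega>
    by (auto simp: I_def indicator_def intro!: prod_nonneg prod_le_1)
  have iI: "integrable M I"
    by (rule integrable_const_bound[where B=1]) (use Ib in auto)
  have iAI: "integrable M (\<lambda>\<omega>. indicator A (L \<omega>) * I \<omega>)"
    by (rule integrable_const_bound[where B=1]) (use Ib in \<open>auto simp: indicator_def\<close>)
  have iA: "integrable M (\<lambda>\<omega>. indicator A (L \<omega>) :: complex)"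
    by (rule integrable_const_bound[where B=1]) (auto simp: indicator_def)
  have "expectation (\<lambda>\<omega>. (indicator A (L \<omega>) - of_real p) * (\<Prod>j\<in>J. indicator (B j) (Y j \<omega>))) = (0::complex)"
  proof (rule char_zero_imp_zero_finite[OF \<open>finite J\<close> _ Ym _ B])
    show "complex_integrable M (\<lambda>\<omega>. indicator A (L \<omega>) - of_real p)"
      using iA by simp
    fix l :: "'a \<Rightarrow> real"
    define K where "K = (\<lambda>\<omega>. \<Sum>j\<in>J. l j * Y j \<omega>)"
    have K: "lin K" unfolding K_def using Y \<open>finite J\<close> by (intro lin_sum lin_scale) auto
    then have [measurable]: "K \<in> borel_measurable M" using lin_measurable by auto
    have KL: "cov K L = 0" unfolding K_def using \<open>finite J\<close> Y L unc by (simp add: cov_sum)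
    define q where "q = expectation (\<lambda>\<omega>. iexp (K \<omega>))"
    have iK: "integrable M (\<lambda>\<omega>. iexp (K \<omega>))"
      by (rule integrable_const_bound[where B=1]) auto
    have "expectation (\<lambda>\<omega>. (iexp (K \<omega>) - q) * indicator A (L \<omega>)) = 0"
    proof (rule char_zero_imp_zero[OF _ Lm _ A])
      show "complex_integrable M (\<lambda>\<omega>. iexp (K \<omega>) - q)" using iK by simp
      fix r
      have iL: "integrable M (\<lambda>\<omega>. iexp (r * L \<omega>))"
        by (rule integrable_const_bound[where B=1]) auto
      have iLK: "integrable M (\<lambda>\<omega>. iexp (r * L \<omega>) * iexp (K \<omega>))"
        by (rule integrable_const_bound[where B=1]) (auto simp: norm_mult)
      have "expectation (\<lambda>\<omega>. iexp (r * L \<omega>) * iexp (K \<omega>)) = expectation (\<lambda>\<omega>. iexp (r * L \<omega>)) * q"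
        unfolding q_def using KL K lin_scale[OF L]
        by (intro uncorrelated_imp_char_factor) (auto simp: cov_scale_right)
      moreover have "(iexp (K \<omega>) - q) * iexp (r * L \<omega>) = iexp (r * L \<omega>) * iexp (K \<omega>) - iexp (r * L \<omega>) * q" for \<omega>
        by (simp add: algebra_simps)
      ultimately show "expectation (\<lambda>\<omega>. (iexp (K \<omega>) - q) * iexp (r * L \<omega>)) = 0"
        using iL iLK by simp
    qed
    moreover have iKA: "integrable M (\<lambda>\<omega>. iexp (K \<omega>) * indicator A (L \<omega>))"
      by (rule integrable_const_bound[where B=1]) (auto simp: norm_mult indicator_def)
    ultimately have "expectation (\<lambda>\<omega>. iexp (K \<omega>) * indicator A (L \<omega>)) = q * of_real p"
      using iA pc by (simp add: left_diff_distrib)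
    then have "expectation (\<lambda>\<omega>. iexp (K \<omega>) * indicator A (L \<omega>) - of_real p * iexp (K \<omega>)) = 0"
      using iKA iK by (simp add: q_def)
    moreover have "iexp (K \<omega>) * indicator A (L \<omega>) - of_real p * iexp (K \<omega>) =
        (indicator A (L \<omega>) - of_real p) * iexp (\<Sum>j\<in>J. l j * Y j \<omega>)" for \<omega>
      by (simp add: K_def algebra_simps)
    ultimately show "expectation (\<lambda>\<omega>. (indicator A (L \<omega>) - of_real p) * iexp (\<Sum>j\<in>J. l j * Y j \<omega>)) = 0"
      by simp
  qed
  moreover have "(indicator A (L \<omega>) - of_real p) * (\<Prod>j\<in>J. indicator (B j) (Y j \<omega>)) =
      complex_of_real ((indicator A (L \<omega>) - p) * I \<omega>)" for \<omega>
  proof -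
    have "(\<Prod>j\<in>J. indicator (B j) (Y j \<omega>)) = complex_of_real (I \<omega>)"
      unfolding I_def of_real_prod by (intro prod.cong) (auto simp: indicator_def)
    then show ?thesis by (simp add: indicator_def)
  qed
  ultimately have "expectation (\<lambda>\<omega>. (indicator A (L \<omega>) - p) * I \<omega>) = 0"
    by (simp only: integral_complex_of_real of_real_eq_0_iff)
  then have "expectation (\<lambda>\<omega>. indicator A (L \<omega>) * I \<omega>) = p * expectation I"
    using iI iAI by (simp add: left_diff_distrib)
  then show ?thesis by (simp add: I_def p_def)
qed

end

section \<open>Independence and the Cameron-Martin formula\<close>

text \<open>The Cameron-Martin formula in dimension one, for a shift equal to the variance: N(v, v)
  has density exp (z - v / 2) with respect to N(0, v).\<close>

lemma nn_integral_normal_shift: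
  fixes F :: "real \<Rightarrow> ennreal"
  assumes [measurable]: "F \<in> borel_measurable borel" and v: "0 < v"
  shows "(\<integral>\<^sup>+z. ennreal (normal_density 0 (sqrt v) z) * F (z + v) \<partial>lborel) =
    (\<integral>\<^sup>+z. ennreal (normal_density 0 (sqrt v) z) * (ennreal (exp (z - v / 2)) * F z) \<partial>lborel)"
proof -
  have *: "normal_density 0 (sqrt v) (z - v) = normal_density 0 (sqrt v) z * exp (z - v / 2)" for z
  proof -
    have "normal_density 0 (sqrt v) (z - v) = normal_density v (sqrt v) z"
      by (simp add: normal_density_def)
    moreover have "exp z * normal_density 0 (sqrt v) z = exp (v / 2) * normal_density v (sqrt v) z"
      using exp_mult_normal_density[of "sqrt v" 1 z] v by simp
    moreover have "normal_density 0 (sqrt v) z * exp (z - v / 2) =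
        (exp z * normal_density 0 (sqrt v) z) / exp (v / 2)"
      by (simp add: exp_diff)
    ultimately show ?thesis by simp
  qed
  have "(\<integral>\<^sup>+z. ennreal (normal_density 0 (sqrt v) (z - v)) * F z \<partial>lborel) =
     (\<integral>\<^sup>+z. ennreal (normal_density 0 (sqrt v) z) * F (z + v) \<partial>lborel)"
    by (subst nn_integral_real_affine[where c=1 and t=v]) (auto simp: add.commute)
  then show ?thesis
    unfolding * by (simp add: ennreal_mult mult.assoc)
qed

context centered_gaussian_process
begin

abbreviation "PX D \<equiv> PiM D (\<lambda>_::real. borel :: real measure)"

lemma measurable_restrict_lin:
  "(\<And>t. t \<in> D \<Longrightarrow> Y t \<in> borel_measurable M) \<Longrightarrow> (\<lambda>\<omega>. \<lambda>t\<in>D. Y t \<omega>) \<in> measurable M (PX D)"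
  by (rule measurable_restrict) auto

text \<open>For fixed \<open>A\<close> both sides are finite measures in the second coordinate, so
  comparing them on finite-dimensional cylinders is enough for an arbitrary index set
  \<open>D\<close>.\<close>

lemma uncorrelated_imp_indep:
  assumes L: "lin L" and Y: "\<And>t. t \<in> D \<Longrightarrow> lin (Y t)"
    and unc: "\<And>t. t \<in> D \<Longrightarrow> cov (Y t) L = 0"
  shows "distr M borel L \<Otimes>\<^sub>M distr M (PX D) (\<lambda>\<omega>. \<lambda>t\<in>D. Y t \<omega>) =
    distr M (borel \<Otimes>\<^sub>M PX D) (\<lambda>\<omega>. (L \<omega>, \<lambda>t\<in>D. Y t \<omega>))"
proof (rule pair_measure_eqI)
  have Lm[measurable]: "L \<in> borel_measurable M" using L lin_measurable by auto
  have Ym: "\<And>t. t \<in> D \<Longrightarrow> Y t \<in> borel_measurable M" using Y lin_measurable by auto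
  define y where "y = (\<lambda>\<omega>. \<lambda>t\<in>D. Y t \<omega>)"
  have yw: "(\<lambda>t\<in>D. Y t \<omega>) = y \<omega>" for \<omega> by (simp add: y_def)
  have ym[measurable]: "y \<in> measurable M (PX D)"
    unfolding y_def using Ym by (rule measurable_restrict_lin)
  interpret d1: prob_space "distr M borel L" by (rule prob_space_distr) simp
  interpret d2: prob_space "distr M (PX D) y" by (rule prob_space_distr) simp
  show "sigma_finite_measure (distr M borel L)" ..
  show "sigma_finite_measure (distr M (PX D) (\<lambda>\<omega>. \<lambda>t\<in>D. Y t \<omega>))"
    unfolding y_def[symmetric] ..
  show "sets (distr M borel L \<Otimes>\<^sub>M distr M (PX D) (\<lambda>\<omega>. \<lambda>t\<in>D. Y t \<omega>)) =
     sets (distr M (borel \<Otimes>\<^sub>M PX D) (\<lambda>\<omega>. (L \<omega>, \<lambda>t\<in>D. Y t \<omega>)))"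
    by (simp cong: sets_pair_measure_cong)
  fix A B assume "A \<in> sets (distr M borel L)" and B: "B \<in> sets (distr M (PX D) (\<lambda>\<omega>. \<lambda>t\<in>D. Y t \<omega>))"
  then have A[measurable]: "A \<in> sets borel" and Bm[measurable]: "B \<in> sets (PX D)" by auto
  define N1 where "N1 = distr (density M (\<lambda>\<omega>. indicator A (L \<omega>))) (PX D) y"
  define N2 where "N2 = scale_measure (emeasure (distr M borel L) A) (distr M (PX D) y)"
  have ym'[measurable]: "y \<in> measurable (density M (\<lambda>\<omega>. indicator A (L \<omega>))) (PX D)" by simp
  have em1: "emeasure N1 E = emeasure M {\<omega> \<in> space M. L \<omega> \<in> A \<and> y \<omega> \<in> E}" if [measurable]: "E \<in> sets (PX D)" for E
  proof -
    have "emeasure N1 E = (\<integral>\<^sup>+\<omega>. indicator A (L \<omega>) * indicator (y -` E \<inter> space M) \<omega> \<partial>M)"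
      unfolding N1_def by (subst emeasure_distr) (auto simp: emeasure_density)
    also have "\<dots> = (\<integral>\<^sup>+\<omega>. indicator {\<omega> \<in> space M. L \<omega> \<in> A \<and> y \<omega> \<in> E} \<omega> \<partial>M)"
      by (intro nn_integral_cong) (auto simp: indicator_def)
    also have "\<dots> = emeasure M {\<omega> \<in> space M. L \<omega> \<in> A \<and> y \<omega> \<in> E}"
      by (rule nn_integral_indicator) measurable
    finally show ?thesis .
  qed
  have em2: "emeasure N2 E = emeasure M {\<omega> \<in> space M. L \<omega> \<in> A} * emeasure M {\<omega> \<in> space M. y \<omega> \<in> E}" if [measurable]: "E \<in> sets (PX D)" for E
  proof -
    have "L -` A \<inter> space M = {\<omega> \<in> space M. L \<omega> \<in> A}" "y -` E \<inter> space M = {\<omega> \<in> space M. y \<omega> \<in> E}" by auto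
    then show ?thesis unfolding N2_def by (simp add: emeasure_distr)
  qed
  have "N1 = N2"
  proof (rule measure_eqI_PiM_infinite)
    show "sets N1 = sets (PX D)" "sets N2 = sets (PX D)" by (auto simp: N1_def N2_def)
    show "finite_measure N1"
    proof (rule finite_measureI)
      have "emeasure N1 (space N1) = emeasure M {\<omega> \<in> space M. L \<omega> \<in> A \<and> y \<omega> \<in> space (PX D)}"
        using em1[of "space (PX D)"] by (simp add: N1_def)
      also have "\<dots> \<noteq> \<infinity>" by simp
      finally show "emeasure N1 (space N1) \<noteq> \<infinity>" .
    qed
    fix C J assume J: "finite J" "J \<subseteq> D" and C: "\<And>i. i \<in> J \<Longrightarrow> C i \<in> sets (borel :: real measure)"
    let ?E = "prod_emb D (\<lambda>_. borel) J (Pi\<^sub>E J C)"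
    have E: "?E \<in> sets (PX D)" using J C by (intro sets_PiM_I) auto
    have yE: "y \<omega> \<in> ?E \<longleftrightarrow> (\<forall>j\<in>J. Y j \<omega> \<in> C j)" for \<omega>
      using J by (auto simp: prod_emb_def y_def PiE_iff extensional_def restrict_def subset_eq)
    have ind: "(\<Prod>j\<in>J. indicator (C j) (Y j \<omega>) :: real) = indicator ?E (y \<omega>)" for \<omega>
      using J(1) by (auto simp: indicator_def yE prod_zero_iff)
    have Em[measurable]: "{\<omega> \<in> space M. y \<omega> \<in> ?E} \<in> sets M"
      using E by measurable
    have "prob {\<omega> \<in> space M. L \<omega> \<in> A \<and> y \<omega> \<in> ?E} =
        expectation (\<lambda>\<omega>. indicator A (L \<omega>) * (\<Prod>j\<in>J. indicator (C j) (Y j \<omega>)))"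
      unfolding ind by (rule prob_eq_expectation) (use E in \<open>measurable, auto simp: indicator_def\<close>)
    also have "\<dots> = expectation (\<lambda>\<omega>. indicator A (L \<omega>)) * expectation (\<lambda>\<omega>. \<Prod>j\<in>J. indicator (C j) (Y j \<omega>))"
      by (rule uncorrelated_imp_indep_rect[OF L J(1)]) (use J Y unc C in auto)
    also have "expectation (\<lambda>\<omega>. indicator A (L \<omega>)) = prob {\<omega> \<in> space M. L \<omega> \<in> A}"
      by (rule prob_eq_expectation[symmetric]) (auto simp: indicator_def)
    also have "expectation (\<lambda>\<omega>. \<Prod>j\<in>J. indicator (C j) (Y j \<omega>)) = prob {\<omega> \<in> space M. y \<omega> \<in> ?E}"
      unfolding ind by (rule prob_eq_expectation[symmetric, OF Em]) (auto simp: indicator_def)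
    finally show "emeasure N1 ?E = emeasure N2 ?E"
      unfolding em1[OF E] em2[OF E] by (simp add: emeasure_eq_measure ennreal_mult)
  qed
  moreover have "emeasure (distr M (borel \<Otimes>\<^sub>M PX D) (\<lambda>\<omega>. (L \<omega>, y \<omega>))) (A \<times> B) =
      emeasure M {\<omega> \<in> space M. L \<omega> \<in> A \<and> y \<omega> \<in> B}"
    by (subst emeasure_distr) (auto intro!: arg_cong[where f="emeasure M"])
  ultimately show "emeasure (distr M borel L) A * emeasure (distr M (PX D) (\<lambda>\<omega>. \<lambda>t\<in>D. Y t \<omega>)) B =
     emeasure (distr M (borel \<Otimes>\<^sub>M PX D) (\<lambda>\<omega>. (L \<omega>, \<lambda>t\<in>D. Y t \<omega>))) (A \<times> B)"
    unfolding yw using em1[OF Bm] by (simp add: N2_def)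
qed

text \<open>Write X t = m t * L + Y t with \<open>Y\<close> uncorrelated with \<open>L\<close>,
  hence independent of it. Adding \<open>cov (X t) L\<close> to every X t is the same as adding v to
  \<open>L\<close> and leaving \<open>Y\<close> alone, so by Fubini the one-dimensional shift
  finishes the proof. If v = 0, then \<open>L\<close> is almost surely zero and nothing is
  shifted.\<close>

theorem Cameron_Martin:
  assumes L: "lin L" and B[measurable]: "B \<in> sets (PX D)"
  shows "emeasure M {\<omega> \<in> space M. (\<lambda>t\<in>D. X t \<omega> + cov (X t) L) \<in> B} =
    (\<integral>\<^sup>+\<omega>. ennreal (exp (L \<omega> - cov L L / 2)) * indicator B (\<lambda>t\<in>D. X t \<omega>) \<partial>M)"
proof -
  have Lm[measurable]: "L \<in> borel_measurable M" using L lin_measurable by auto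
  have Xr[measurable]: "(\<lambda>\<omega>. \<lambda>t\<in>D. X t \<omega> + c t) \<in> measurable M (PX D)" for c
    by (rule measurable_restrict_lin) auto
  have Xr'[measurable]: "(\<lambda>\<omega>. \<lambda>t\<in>D. X t \<omega>) \<in> measurable M (PX D)"
    by (rule measurable_restrict_lin) auto
  define v where "v = cov L L"
  have LHS: "emeasure M {\<omega> \<in> space M. (\<lambda>t\<in>D. X t \<omega> + cov (X t) L) \<in> B} =
      (\<integral>\<^sup>+\<omega>. indicator B (\<lambda>t\<in>D. X t \<omega> + cov (X t) L) \<partial>M)"
    by (rule emeasure_eq_nn_integral) (auto simp: indicator_def)
  show ?thesis
  proof (cases "v = 0")
    case True
    then have ae: "AE \<omega> in M. L \<omega> = 0" using L by (simp add: v_def cov_eq_0_iff)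
    have "cov (X t) L = 0" for t using cov_eq_0_AE[OF L ae lin_X[of t]] by (simp add: cov_commute)
    then show ?thesis
      unfolding LHS using ae True[unfolded v_def] by (intro nn_integral_cong_AE) auto
  next
    case False
    then have v: "v > 0" using cov_nonneg[of L] by (simp add: v_def less_le)
    define m where "m = (\<lambda>t. cov (X t) L / v)"
    define Y where "Y = (\<lambda>t \<omega>. X t \<omega> - m t * L \<omega>)"
    define y where "y = (\<lambda>\<omega>. \<lambda>t\<in>D. Y t \<omega>)"
    define T where "T = (\<lambda>(z, y). \<lambda>t\<in>D. m t * z + y t)"
    have Y: "lin (Y t)" for t unfolding Y_def by (intro lin_diff lin_X lin_scale L)
    have unc: "cov (Y t) L = 0" for t
    proof -
      have "cov (Y t) L = cov (X t) L - m t * cov L L"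
        unfolding Y_def by (simp only: cov_diff[OF lin_X lin_scale[OF L] L] cov_scale)
      then show ?thesis using v by (simp add: m_def v_def)
    qed
    have [measurable]: "T \<in> measurable (borel \<Otimes>\<^sub>M PX D) (PX D)"
      unfolding T_def split_beta' by (rule measurable_restrict) (auto intro!: measurable_compose[OF measurable_snd])
    have ym[measurable]: "y \<in> measurable M (PX D)"
      unfolding y_def using Y lin_measurable by (intro measurable_restrict_lin) auto
    have Xy: "(\<lambda>t\<in>D. X t \<omega>) = T (L \<omega>, y \<omega>)" for \<omega>
      by (auto simp: T_def y_def Y_def)
    have Xy': "(\<lambda>t\<in>D. X t \<omega> + cov (X t) L) = T (L \<omega> + v, y \<omega>)" for \<omega>
      using v by (auto simp: T_def y_def Y_def m_def fun_eq_iff restrict_def distrib_left add_divide_distrib)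
    let ?N1 = "distr M borel L" and ?N2 = "distr M (PX D) y"
    interpret d1: prob_space ?N1 by (rule prob_space_distr) simp
    interpret d2: prob_space ?N2 by (rule prob_space_distr) simp
    interpret pair_sigma_finite ?N1 ?N2 ..
    have "distr M lborel L = distr M borel L" by (rule distr_cong) auto
    then have N1: "?N1 = density lborel (\<lambda>x. ennreal (normal_density 0 (sqrt v) x))"
      using lin_distributed[OF L] v by (simp add: distributed_def v_def)
    have pair: "(\<integral>\<^sup>+\<omega>. F (L \<omega>, y \<omega>) \<partial>M) =
        (\<integral>\<^sup>+x. (\<integral>\<^sup>+z. ennreal (normal_density 0 (sqrt v) z) * F (z, x) \<partial>lborel) \<partial>?N2)"
      if F[measurable]: "F \<in> borel_measurable (borel \<Otimes>\<^sub>M PX D)" for F :: "_ \<Rightarrow> ennreal"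
    proof -
      have "(\<integral>\<^sup>+\<omega>. F (L \<omega>, y \<omega>) \<partial>M) = nn_integral (distr M (borel \<Otimes>\<^sub>M PX D) (\<lambda>\<omega>. (L \<omega>, y \<omega>))) F"
        by (subst nn_integral_distr) auto
      also have "\<dots> = nn_integral (?N1 \<Otimes>\<^sub>M ?N2) F"
        unfolding y_def using uncorrelated_imp_indep[OF L Y unc] by simp
      also have "\<dots> = (\<integral>\<^sup>+x. (\<integral>\<^sup>+z. F (z, x) \<partial>?N1) \<partial>?N2)"
        by (rule nn_integral_snd[symmetric]) simp
      also have "\<dots> = (\<integral>\<^sup>+x. (\<integral>\<^sup>+z. ennreal (normal_density 0 (sqrt v) z) * F (z, x) \<partial>lborel) \<partial>?N2)"
      proof (rule nn_integral_cong)
        fix x assume "x \<in> space ?N2"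
        then have [measurable]: "(\<lambda>z. F (z, x)) \<in> borel_measurable borel" by simp
        show "(\<integral>\<^sup>+z. F (z, x) \<partial>?N1) = (\<integral>\<^sup>+z. ennreal (normal_density 0 (sqrt v) z) * F (z, x) \<partial>lborel)"
          unfolding N1 by (subst nn_integral_density) auto
      qed
      finally show ?thesis .
    qed
    have "(\<integral>\<^sup>+\<omega>. indicator B (T (L \<omega> + v, y \<omega>)) \<partial>M) =
        (\<integral>\<^sup>+x. (\<integral>\<^sup>+z. ennreal (normal_density 0 (sqrt v) z) * indicator B (T (z + v, x)) \<partial>lborel) \<partial>?N2)"
      using pair[of "\<lambda>(z, x). indicator B (T (z + v, x))"] by simp
    also have "\<dots> = (\<integral>\<^sup>+x. (\<integral>\<^sup>+z. ennreal (normal_density 0 (sqrt v) z) *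
        (ennreal (exp (z - v / 2)) * indicator B (T (z, x))) \<partial>lborel) \<partial>?N2)"
    proof (rule nn_integral_cong)
      fix x assume "x \<in> space ?N2"
      then have [measurable]: "x \<in> space (PX D)" by simp
      show "(\<integral>\<^sup>+z. ennreal (normal_density 0 (sqrt v) z) * indicator B (T (z + v, x)) \<partial>lborel) =
        (\<integral>\<^sup>+z. ennreal (normal_density 0 (sqrt v) z) * (ennreal (exp (z - v / 2)) * indicator B (T (z, x))) \<partial>lborel)"
        using v by (intro nn_integral_normal_shift) measurable
    qed
    also have "\<dots> = (\<integral>\<^sup>+\<omega>. ennreal (exp (L \<omega> - v / 2)) * indicator B (T (L \<omega>, y \<omega>)) \<partial>M)"
      using pair[of "\<lambda>(z, x). ennreal (exp (z - v / 2)) * indicator B (T (z, x))"] by simp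
    finally show ?thesis
      unfolding LHS unfolding Xy Xy' v_def .
  qed
qed

end

section \<open>Smooth paths and tail bounds\<close>

context centered_gaussian_process
begin

text \<open>The absolute value is removed by bounding exp (c |U|) by exp (c U) + exp (- c U).
  Keeping the factor in \<open>Z\<close> lets a single exponential moment control \<open>Z\<close>
  and a residual at once.\<close>

lemma expectation_exp_abs:
  assumes Z: "lin Z" and U: "lin U" and "cov U Z = 0"
  shows "integrable M (\<lambda>\<omega>. exp (l * Z \<omega> + c * \<bar>U \<omega>\<bar>))" (is ?int)
    and "expectation (\<lambda>\<omega>. exp (l * Z \<omega> + c * \<bar>U \<omega>\<bar>)) \<le> 2 * exp (l\<^sup>2 * cov Z Z / 2 + c\<^sup>2 * cov U U / 2)"
      (is ?le)
proof -
  have [measurable]: "Z \<in> borel_measurable M" "U \<in> borel_measurable M"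
    using Z U lin_measurable by auto
  have lin: "lin (\<lambda>\<omega>. l * Z \<omega> + e * U \<omega>)" for e
    using Z U by (intro lin_add lin_scale)
  have v: "cov (\<lambda>\<omega>. l * Z \<omega> + e * U \<omega>) (\<lambda>\<omega>. l * Z \<omega> + e * U \<omega>) = l\<^sup>2 * cov Z Z + e\<^sup>2 * cov U U" for e
    using assms cov_commute[of Z U]
    by (simp add: cov_add cov_add_right lin_scale lin_add cov_scale cov_scale_right power2_eq_square)
  let ?f = "\<lambda>\<omega>. exp (l * Z \<omega> + c * U \<omega>) + exp (l * Z \<omega> + (- c) * U \<omega>)"
  have f: "integrable M ?f"
    using lin_exp_integrable[OF lin] by (intro Bochner_Integration.integrable_add)
  have le: "exp (l * Z \<omega> + c * \<bar>U \<omega>\<bar>) \<le> ?f \<omega>" for \<omega>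
    by (cases "U \<omega> \<ge> 0") auto
  show ?int
    by (rule Bochner_Integration.integrable_bound[OF f]) (use le in \<open>auto intro: order_trans\<close>)
  then have "expectation (\<lambda>\<omega>. exp (l * Z \<omega> + c * \<bar>U \<omega>\<bar>)) \<le> expectation ?f"
    using f le by (intro integral_mono) auto
  also have "\<dots> = 2 * exp (l\<^sup>2 * cov Z Z / 2 + c\<^sup>2 * cov U U / 2)"
    using lin_exp_integrable[OF lin, of c] lin_exp_integrable[OF lin, of "- c"]
      lin_mgf[OF lin, of c] lin_mgf[OF lin, of "- c"]
    by (simp add: v[of c] v[of "- c", simplified] add_divide_distrib)
  finally show ?le .
qed

end

locale smooth_gaussian_process = centered_gaussian_process M X
  for M :: "'w measure" and X :: "real \<Rightarrow> 'w \<Rightarrow> real" +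
  fixes a b :: real
  assumes ab: "a < b" and smooth: "smooth_paths M X"
begin

lemma path_continuous: assumes "\<omega> \<in> space M" shows "continuous_on A (\<lambda>t. X t \<omega>)"
proof -
  have "((deriv ^^ 0) (\<lambda>s. X s \<omega>)) field_differentiable (at t)" for t
    using smooth assms unfolding smooth_paths_def by blast
  then have "isCont (\<lambda>s. X s \<omega>) t" for t
    by (auto intro: field_differentiable_imp_continuous_at)
  then show ?thesis by (simp add: continuous_at_imp_continuous_on)
qed

section \<open>Dyadic points of [a,b]\<close>

definition pt :: "nat \<Rightarrow> nat \<Rightarrow> real" where
  "pt n k = a + (b - a) * (real k / 2 ^ n)"

definition grid :: "nat \<Rightarrow> real set" where
  "grid n = pt n ` {..2 ^ n}"

definition dyadic :: "real set" where
  "dyadic = (\<Union>n. grid n)"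

lemma finite_grid[simp]: "finite (grid n)" by (simp add: grid_def)

lemma countable_dyadic[simp]: "countable dyadic"
  unfolding dyadic_def by (intro countable_UN) (auto intro: countable_finite)

lemma pt_0[simp]: "pt n 0 = a" by (simp add: pt_def)

lemma grid_subset: "grid n \<subseteq> {a..b}"
proof
  fix t assume "t \<in> grid n"
  then obtain k where k: "k \<le> 2 ^ n" "t = pt n k" by (auto simp: grid_def)
  have "real k \<le> 2 ^ n" using k(1) by (metis of_nat_le_iff of_nat_numeral of_nat_power)
  then have "real k / 2 ^ n \<le> 1" by simp
  then have "(b - a) * (real k / 2 ^ n) \<le> (b - a) * 1"
    using ab by (intro mult_left_mono) auto
  then show "t \<in> {a..b}" using k(2) ab by (simp add: pt_def)
qed

lemma dyadic_subset: "dyadic \<subseteq> {a..b}"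
  using grid_subset by (auto simp: dyadic_def)

lemma grid_mono_Suc: "grid n \<subseteq> grid (Suc n)"
proof
  fix t assume "t \<in> grid n"
  then obtain k where k: "k \<le> 2 ^ n" "t = pt n k" by (auto simp: grid_def)
  have "t = pt (Suc n) (2 * k)" using k(2) by (simp add: pt_def)
  then show "t \<in> grid (Suc n)" using k(1) by (auto simp: grid_def)
qed

text \<open>Approximation is from the left because \<open>argmin_le_iff\<close> needs dyadic points
  that stay below a prescribed bound.\<close>

lemma dyadic_approx_left:
  assumes t: "t \<in> {a..b}"
  obtains s where "\<And>n. s n \<in> dyadic" "\<And>n. s n \<le> t" "s \<longlonglongrightarrow> t"
proof -
  define r where "r = (t - a) / (b - a)"
  have r: "0 \<le> r" "r \<le> 1" and tr: "t = a + (b - a) * r"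
    using t ab by (auto simp: r_def field_simps)
  define k where "k = (\<lambda>n. nat \<lfloor>r * 2 ^ n\<rfloor>)"
  have k: "real (k n) \<le> r * 2 ^ n" "r * 2 ^ n - 1 \<le> real (k n)" for n
    using r(1) by (auto simp: k_def)
  have k': "k n \<le> 2 ^ n" for n
  proof -
    have "real (k n) \<le> 1 * 2 ^ n" using k(1)[of n] r(2) by (meson mult_right_mono order_trans zero_le_numeral zero_le_power)
    then have "real (k n) \<le> real (2 ^ n)" by simp
    then show ?thesis by (simp only: of_nat_le_iff)
  qed
  define s where "s = (\<lambda>n. pt n (k n))"
  have s1: "real (k n) / 2 ^ n \<le> r" "r - (1/2) ^ n \<le> real (k n) / 2 ^ n" for n
  proof -
    have "real (k n) / 2 ^ n \<le> (r * 2 ^ n) / 2 ^ n" using k(1) by (rule divide_right_mono) simp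
    then show "real (k n) / 2 ^ n \<le> r" by simp
    have "(r * 2 ^ n - 1) / 2 ^ n \<le> real (k n) / 2 ^ n" using k(2) by (rule divide_right_mono) simp
    moreover have "(r * 2 ^ n - 1) / 2 ^ n = r - (1/2) ^ n"
      by (simp add: diff_divide_distrib power_one_over)
    ultimately show "r - (1/2) ^ n \<le> real (k n) / 2 ^ n" by simp
  qed
  have "(\<lambda>n. (1/2::real) ^ n) \<longlonglongrightarrow> 0"
    by (rule LIMSEQ_realpow_zero) auto
  then have "(\<lambda>n. r - (1/2) ^ n) \<longlonglongrightarrow> r - 0"
    by (intro tendsto_diff tendsto_const)
  then have "(\<lambda>n. r - (1/2) ^ n) \<longlonglongrightarrow> r" by simp
  then have "(\<lambda>n. real (k n) / 2 ^ n) \<longlonglongrightarrow> r"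
    by (rule tendsto_sandwich[OF always_eventually[OF allI[OF s1(2)]] always_eventually[OF allI[OF s1(1)]] _ tendsto_const])
  then have "s \<longlonglongrightarrow> a + (b - a) * r"
    unfolding s_def pt_def by (intro tendsto_intros)
  moreover have "s n \<le> t" for n
    unfolding s_def pt_def tr using s1(1)[of n] ab by (intro add_left_mono mult_left_mono) auto
  moreover have "s n \<in> dyadic" for n
    using k'[of n] by (auto simp: s_def dyadic_def grid_def)
  ultimately show ?thesis using that tr by auto
qed

lemma dyadic_dense:
  assumes w: "continuous_on {a..b} w" and ge: "\<And>t. t \<in> dyadic \<Longrightarrow> w t \<ge> (d::real)" and t: "t \<in> {a..b}"
  shows "w t \<ge> d"
proof -
  obtain s where s: "\<And>n. s n \<in> dyadic" "\<And>n. s n \<le> t" "s \<longlonglongrightarrow> t"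
    by (rule dyadic_approx_left[OF t]) blast
  have "(\<lambda>n. w (s n)) \<longlonglongrightarrow> w t"
    using continuous_on_tendsto_compose[OF w s(3) t] s(1) dyadic_subset
    by (meson always_eventually subsetD)
  moreover have "d \<le> w (s n)" for n by (rule ge[OF s(1)])
  ultimately show ?thesis by (intro LIMSEQ_le_const[of "\<lambda>n. w (s n)"]) blast+
qed

section \<open>Variances of increments from pathwise Lipschitz bounds\<close>

lemma path_lipschitz:
  assumes \<omega>: "\<omega> \<in> space M"
  shows "\<exists>K::nat. \<forall>s\<in>{a..b}. \<forall>t\<in>{a..b}. \<bar>X s \<omega> - X t \<omega>\<bar> \<le> real K * \<bar>s - t\<bar>"
proof -
  have d: "((deriv ^^ n) (\<lambda>s. X s \<omega>)) field_differentiable (at t)" for n t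
    using smooth \<omega> unfolding smooth_paths_def by blast
  have d0: "((\<lambda>s. X s \<omega>) has_field_derivative deriv (\<lambda>s. X s \<omega>) t) (at t)" for t
    using d[of 0 t] by (simp add: DERIV_deriv_iff_field_differentiable)
  have "isCont (deriv (\<lambda>s. X s \<omega>)) t" for t
    using d[of 1 t] by (auto intro: field_differentiable_imp_continuous_at)
  then have "compact (deriv (\<lambda>s. X s \<omega>) ` {a..b})"
    by (intro compact_continuous_image continuous_at_imp_continuous_on) auto
  then obtain B where B: "\<And>t. t \<in> {a..b} \<Longrightarrow> \<bar>deriv (\<lambda>s. X s \<omega>) t\<bar> \<le> B"
    using compact_imp_bounded by (fastforce simp: bounded_iff)
  \<comment> \<open>A natural number as constant makes the Lipschitz events in
    \<open>increment_bound\<close> an increasing sequence.\<close>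
  obtain K :: nat where K: "B \<le> real K" using real_arch_simple by blast
  have "\<bar>X s \<omega> - X t \<omega>\<bar> \<le> real K * \<bar>s - t\<bar>" if "s \<in> {a..b}" "t \<in> {a..b}" for s t
    using field_differentiable_bound[of "{a..b}" "\<lambda>s. X s \<omega>" "deriv (\<lambda>s. X s \<omega>)" "real K" s t]
      d0 B K that by (fastforce intro: has_field_derivative_at_within)
  then show ?thesis by blast
qed

text \<open>With standard deviation s the density is at most 1 / s, so [- K, K] has mass at most 2 K
  / s. Mass 1/2 then forces s \<le> 4 K.\<close>

lemma small_ball_variance_bound:
  assumes G: "lin G" and K: "0 \<le> K" and p: "prob {\<omega> \<in> space M. \<bar>G \<omega>\<bar> \<le> K} \<ge> 1 / 2"
  shows "cov G G \<le> 16 * K\<^sup>2"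
proof (cases "cov G G = 0")
  case False
  then have v: "0 < cov G G" using cov_nonneg[of G] by simp
  define s where "s = sqrt (cov G G)"
  have s: "0 < s" using v by (simp add: s_def)
  have D: "distributed M lborel G (normal_density 0 s)"
    using lin_distributed[OF G v] by (simp add: s_def)
  have [measurable]: "G \<in> borel_measurable M" using G lin_measurable by auto
  have le: "normal_density 0 s x \<le> 1 / s" for x
  proof -
    have "1 \<le> sqrt (2 * pi)" using pi_gt3 by simp
    then have "s * 1 \<le> sqrt (2 * pi * s\<^sup>2)" using s by (simp add: real_sqrt_mult)
    then have "1 / sqrt (2 * pi * s\<^sup>2) \<le> 1 / s" using s by (intro divide_left_mono) auto
    moreover have "exp (- (x - 0)\<^sup>2 / (2 * s\<^sup>2)) \<le> 1" by simp
    ultimately show ?thesis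
      unfolding normal_density_def by (intro order_trans[OF mult_left_le]) auto
  qed
  have "G -` {- K..K} \<inter> space M = {\<omega> \<in> space M. \<bar>G \<omega>\<bar> \<le> K}" by auto
  then have "emeasure M {\<omega> \<in> space M. \<bar>G \<omega>\<bar> \<le> K} =
      (\<integral>\<^sup>+x. ennreal (normal_density 0 s x) * indicator {- K..K} x \<partial>lborel)"
    using distributed_emeasure[OF D, of "{- K..K}"] by simp
  also have "\<dots> \<le> (\<integral>\<^sup>+x. ennreal (1 / s) * indicator {- K..K} x \<partial>lborel)"
    using le by (intro nn_integral_mono mult_right_mono ennreal_leI) auto
  also have "\<dots> = ennreal (1 / s * (2 * K))"
    using K s by (simp add: nn_integral_cmult_indicator ennreal_mult[symmetric])
  finally have "prob {\<omega> \<in> space M. \<bar>G \<omega>\<bar> \<le> K} \<le> 1 / s * (2 * K)"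
    using K s by (simp add: emeasure_eq_measure ennreal_le_iff)
  with p have "1 / 2 \<le> 1 / s * (2 * K)" by linarith
  then have "s \<le> 4 * K" using s by (simp add: field_simps)
  then have "s\<^sup>2 \<le> (4 * K)\<^sup>2" using s by (intro power_mono) auto
  then show ?thesis using v by (simp add: s_def power_mult_distrib)
qed simp

text \<open>Differentiability is given path by path, with no moments of the derivative. Still, some
  deterministic \<open>K\<close> is a Lipschitz constant of the path with probability above 1/2, and
  for a Gaussian increment an event of that size already bounds the variance.\<close>

lemma increment_bound:
  "\<exists>C>0. \<forall>s\<in>{a..b}. \<forall>t\<in>{a..b}.
     cov (\<lambda>\<omega>. X s \<omega> - X t \<omega>) (\<lambda>\<omega>. X s \<omega> - X t \<omega>) \<le> C * (s - t)\<^sup>2"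
proof -
  define E where "E = (\<lambda>K::nat. {\<omega> \<in> space M. \<forall>s\<in>dyadic. \<forall>t\<in>dyadic. \<bar>X s \<omega> - X t \<omega>\<bar> \<le> real K * \<bar>s - t\<bar>})"
  have E_meas: "E K \<in> events" for K unfolding E_def by measurable
  have "incseq E"
  proof (rule incseq_SucI)
    fix K
    have "y \<le> real (Suc K) * \<bar>s - t\<bar>" if "y \<le> real K * \<bar>s - t\<bar>" for s t y :: real
      using that mult_right_mono[of "real K" "real (Suc K)" "\<bar>s - t\<bar>"] by simp
    then show "E K \<subseteq> E (Suc K)" unfolding E_def by blast
  qed
  moreover have "(\<Union>K. E K) = space M"
  proof
    show "(\<Union>K. E K) \<subseteq> space M" by (auto simp: E_def)
    show "space M \<subseteq> (\<Union>K. E K)"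
    proof
      fix \<omega> assume \<omega>: "\<omega> \<in> space M"
      obtain K :: nat where K: "\<forall>s\<in>{a..b}. \<forall>t\<in>{a..b}. \<bar>X s \<omega> - X t \<omega>\<bar> \<le> real K * \<bar>s - t\<bar>"
        using path_lipschitz[OF \<omega>] by blast
      have "\<omega> \<in> E K" unfolding E_def using \<omega> K dyadic_subset by blast
      then show "\<omega> \<in> (\<Union>K. E K)" by blast
    qed
  qed
  ultimately have "(\<lambda>K. prob (E K)) \<longlonglongrightarrow> 1"
    using finite_Lim_measure_incseq[of E] E_meas by (auto simp: prob_space)
  then have "eventually (\<lambda>K. prob (E K) > 1/2) sequentially"
    by (rule order_tendstoD) simp
  then obtain K where K: "prob (E K) > 1/2"
    using eventually_happens by (force simp: eventually_sequentially)
  \<comment> \<open>The summand 1 only serves to make \<open>C\<close> positive.\<close>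
  define C where "C = 16 * (real K)\<^sup>2 + 1"
  have "cov (\<lambda>\<omega>. X s \<omega> - X t \<omega>) (\<lambda>\<omega>. X s \<omega> - X t \<omega>) \<le> C * (s - t)\<^sup>2"
    if st: "s \<in> {a..b}" "t \<in> {a..b}" for s t
  proof -
    let ?G = "\<lambda>\<omega>. X s \<omega> - X t \<omega>"
    have G: "lin ?G" by (intro lin_diff lin_X)
    have "\<bar>X s \<omega> - X t \<omega>\<bar> \<le> real K * \<bar>s - t\<bar>" if \<omega>: "\<omega> \<in> E K" for \<omega>
    proof -
      have sp: "\<omega> \<in> space M" using \<omega> by (simp add: E_def)
      note cX = path_continuous[OF sp, of "{a..b}"]
      have 1: "0 \<le> real K * \<bar>s' - t\<bar> - \<bar>X s' \<omega> - X t \<omega>\<bar>" if "s' \<in> dyadic" for s'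
      proof (rule dyadic_dense[OF _ _ st(2)])
        show "continuous_on {a..b} (\<lambda>t. real K * \<bar>s' - t\<bar> - \<bar>X s' \<omega> - X t \<omega>\<bar>)"
          by (intro continuous_intros cX)
        show "0 \<le> real K * \<bar>s' - t\<bar> - \<bar>X s' \<omega> - X t \<omega>\<bar>" if "t \<in> dyadic" for t
          using \<omega> \<open>s' \<in> dyadic\<close> that by (simp add: E_def)
      qed
      have "0 \<le> real K * \<bar>s - t\<bar> - \<bar>X s \<omega> - X t \<omega>\<bar>"
      proof (rule dyadic_dense[OF _ 1 st(1)])
        show "continuous_on {a..b} (\<lambda>s. real K * \<bar>s - t\<bar> - \<bar>X s \<omega> - X t \<omega>\<bar>)"
          by (intro continuous_intros cX)
      qed
      then show ?thesis by simp
    qed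
    then have "E K \<subseteq> {\<omega> \<in> space M. \<bar>?G \<omega>\<bar> \<le> real K * \<bar>s - t\<bar>}" by (auto simp: E_def)
    then have "prob (E K) \<le> prob {\<omega> \<in> space M. \<bar>?G \<omega>\<bar> \<le> real K * \<bar>s - t\<bar>}"
      by (intro finite_measure_mono) auto
    then have "cov ?G ?G \<le> 16 * (real K * \<bar>s - t\<bar>)\<^sup>2"
      using K by (intro small_ball_variance_bound[OF G]) auto
    also have "\<dots> \<le> C * (s - t)\<^sup>2" by (simp add: C_def power_mult_distrib distrib_right)
    finally show ?thesis .
  qed
  moreover have "C > 0" by (simp add: C_def add_nonneg_pos)
  ultimately show ?thesis by blast
qed

lemma grid_variation:
  assumes "t \<in> grid n"
  shows "\<bar>f t\<bar> \<le> \<bar>f a\<bar> + (\<Sum>k<2 ^ n. \<bar>f (pt n (Suc k)) - f (pt n k) :: real\<bar>)"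
proof -
  obtain j where j: "j \<le> 2 ^ n" "t = pt n j" using assms by (auto simp: grid_def)
  have "f (pt n j) - f a = (\<Sum>k<j. f (pt n (Suc k)) - f (pt n k))"
    using sum_lessThan_telescope[of "\<lambda>k. f (pt n k)" j] by simp
  then have "\<bar>f (pt n j) - f a\<bar> \<le> (\<Sum>k<j. \<bar>f (pt n (Suc k)) - f (pt n k)\<bar>)" by simp
  also have "\<dots> \<le> (\<Sum>k<2 ^ n. \<bar>f (pt n (Suc k)) - f (pt n k)\<bar>)"
    using j by (intro sum_mono2) auto
  finally show ?thesis using j by simp
qed

text \<open>On a grid the supremum is at most the initial value plus the total variation; by Jensen's
  inequality the exponential moment of the latter is at most the largest exponential moment of
  the rescaled increments.\<close>

lemma joint_tail_bound:
  assumes Z: "lin Z" and Y: "\<And>t. t \<in> {a..b} \<Longrightarrow> lin (Y t)"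
    and unc: "\<And>t. t \<in> {a..b} \<Longrightarrow> cov (Y t) Z = 0"
    and inc: "\<And>s t. s \<in> {a..b} \<Longrightarrow> t \<in> {a..b} \<Longrightarrow>
      cov (\<lambda>\<omega>. Y s \<omega> - Y t \<omega>) (\<lambda>\<omega>. Y s \<omega> - Y t \<omega>) \<le> C * (s - t)\<^sup>2"
    and C: "C * (b - a)\<^sup>2 \<le> C'" "cov (Y a) (Y a) \<le> C'" "0 < C'"
    and v: "0 < cov Z Z" and x: "0 \<le> x" and w: "0 \<le> w"
  shows "prob {\<omega> \<in> space M. w < Z \<omega> \<and> (\<exists>t\<in>dyadic. x < \<bar>Y t \<omega>\<bar>)} \<le>
    2 * exp (- w\<^sup>2 / (2 * cov Z Z) - x\<^sup>2 / (8 * C'))"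
proof -
  \<comment> \<open>These values minimize the exponent - l w - r x + l^2 cov Z Z / 2 + 2 r^2 C' that
    the Chernoff argument produces.\<close>
  define l r where "l = w / cov Z Z" and "r = x / (4 * C')"
  have lr: "0 \<le> l" "0 \<le> r" using v x w C by (auto simp: l_def r_def)
  have [measurable]: "Z \<in> borel_measurable M" using Z lin_measurable by auto
  have Ym[measurable]: "t \<in> {a..b} \<Longrightarrow> Y t \<in> borel_measurable M" for t using Y lin_measurable by auto
  have Ym': "Y t \<in> borel_measurable M" if "t \<in> dyadic" for t using Y lin_measurable that dyadic_subset by auto
  define E where "E = (\<lambda>n. {\<omega> \<in> space M. w < Z \<omega> \<and> (\<exists>t\<in>grid n. x < \<bar>Y t \<omega>\<bar>)})"
  have E_meas: "E n \<in> events" for n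
  proof -
    have "{\<omega> \<in> space M. x < \<bar>Y t \<omega>\<bar>} \<in> events" if "t \<in> grid n" for t
    proof -
      have [measurable]: "Y t \<in> borel_measurable M" using that grid_subset[of n] by (intro Ym) blast
      show ?thesis by measurable
    qed
    then have "(\<Union>t\<in>grid n. {\<omega> \<in> space M. x < \<bar>Y t \<omega>\<bar>}) \<in> events" by (intro sets.finite_UN) auto
    moreover have "E n = {\<omega> \<in> space M. w < Z \<omega>} \<inter> (\<Union>t\<in>grid n. {\<omega> \<in> space M. x < \<bar>Y t \<omega>\<bar>})"
      by (auto simp: E_def)
    ultimately show ?thesis by simp
  qed
  have bound: "prob (E n) \<le> 2 * exp (- w\<^sup>2 / (2 * cov Z Z) - x\<^sup>2 / (8 * C'))" for n
  proof -
    define N :: real where "N = 2 ^ n"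
    have N: "0 < N" by (simp add: N_def)
    define U where "U = (\<lambda>k \<omega>. Y (pt n (Suc k)) \<omega> - Y (pt n k) \<omega>)"
    have pt_in: "pt n k \<in> {a..b}" if "k \<le> 2 ^ n" for k
      using grid_subset[of n] that by (auto simp: grid_def)
    have U: "lin (U k)" "cov (U k) Z = 0" "cov (U k) (U k) \<le> C * ((b - a) / N)\<^sup>2" if "k < 2 ^ n" for k
    proof -
      have p: "pt n (Suc k) \<in> {a..b}" "pt n k \<in> {a..b}" using that by (intro pt_in; simp add: Suc_le_eq)+
      show "lin (U k)" unfolding U_def using Y p by (intro lin_diff)
      show "cov (U k) Z = 0" unfolding U_def using Y p unc Z by (simp add: cov_diff)
      have "pt n (Suc k) - pt n k = (b - a) / N" by (simp add: pt_def N_def field_simps)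
      then show "cov (U k) (U k) \<le> C * ((b - a) / N)\<^sup>2" using inc[OF p] by (simp add: U_def)
    qed
    \<comment> \<open>The factors 2 here and 2 N in \<open>F\<close> undo the convex weights 1/2 and
      1 / (2 N) given below to the initial value and to each increment. An increment has standard
      deviation of order 1 / N, so its multiple by N has a variance bounded independently of the
      grid.\<close>
    define F0 where "F0 = (\<lambda>\<omega>. exp (l * Z \<omega> + 2 * r * \<bar>Y a \<omega>\<bar>))"
    define F where "F = (\<lambda>k \<omega>. exp (l * Z \<omega> + 2 * r * N * \<bar>U k \<omega>\<bar>))"
    define B where "B = 2 * exp (l\<^sup>2 * cov Z Z / 2 + 2 * r\<^sup>2 * C')"
    have aab: "a \<in> {a..b}" using ab by simp
    have "expectation F0 \<le> 2 * exp (l\<^sup>2 * cov Z Z / 2 + (2 * r)\<^sup>2 * cov (Y a) (Y a) / 2)"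
      unfolding F0_def by (rule expectation_exp_abs(2)[OF Z Y[OF aab] unc[OF aab]])
    also have "\<dots> \<le> B"
      unfolding B_def using mult_left_mono[OF C(2), of "2 * r\<^sup>2"] by (simp add: power_mult_distrib)
    finally have F0: "expectation F0 \<le> B" .
    have F0i: "integrable M F0"
      unfolding F0_def by (rule expectation_exp_abs(1)[OF Z Y[OF aab] unc[OF aab]])
    have Fi: "integrable M (F k)" if "k < 2 ^ n" for k
      unfolding F_def by (rule expectation_exp_abs(1)[OF Z U(1,2)[OF that]])
    have FB: "expectation (F k) \<le> B" if "k < 2 ^ n" for k
    proof -
      have "expectation (F k) \<le> 2 * exp (l\<^sup>2 * cov Z Z / 2 + (2 * r * N)\<^sup>2 * cov (U k) (U k) / 2)"
        unfolding F_def by (rule expectation_exp_abs(2)[OF Z U(1,2)[OF that]])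
      moreover have "(2 * r * N)\<^sup>2 * cov (U k) (U k) / 2 \<le> (2 * r * N)\<^sup>2 * (C * ((b - a) / N)\<^sup>2) / 2"
        using U(3)[OF that] by (intro divide_right_mono mult_left_mono) auto
      moreover have "(2 * r * N)\<^sup>2 * (C * ((b - a) / N)\<^sup>2) / 2 = 2 * r\<^sup>2 * (C * (b - a)\<^sup>2)"
        using N by (simp add: power_mult_distrib power_divide)
      moreover have "2 * r\<^sup>2 * (C * (b - a)\<^sup>2) \<le> 2 * r\<^sup>2 * C'"
        using C(1) by (intro mult_left_mono) auto
      ultimately show ?thesis unfolding B_def by (smt (verit) exp_le_cancel_iff)
    qed
    define G where "G = (\<lambda>\<omega>. exp (- l * w - r * x) * (F0 \<omega> / 2 + (\<Sum>k<2 ^ n. F k \<omega>) / (2 * N)))"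
    have Gi: "integrable M G"
      unfolding G_def using F0i Fi by (intro integrable_mult_right Bochner_Integration.integrable_add integrable_divide Bochner_Integration.integrable_sum) auto
    have G_nonneg: "0 \<le> G \<omega>" for \<omega>
      unfolding G_def F0_def F_def using N by (intro mult_nonneg_nonneg add_nonneg_nonneg divide_nonneg_nonneg sum_nonneg) auto
    have G1: "1 \<le> G \<omega>" if wE: "\<omega> \<in> E n" for \<omega>
    proof -
      obtain t where t: "t \<in> grid n" "x < \<bar>Y t \<omega>\<bar>" and zw: "w < Z \<omega>" using wE by (auto simp: E_def)
      define V where "V = (\<Sum>k<2 ^ n. \<bar>U k \<omega>\<bar>)"
      have "\<bar>Y t \<omega>\<bar> \<le> \<bar>Y a \<omega>\<bar> + V"
        unfolding V_def U_def by (rule grid_variation[OF t(1)])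
      with t have xV: "x \<le> \<bar>Y a \<omega>\<bar> + V" by simp
      have convex: "convex_on UNIV (exp :: real \<Rightarrow> real)" by (rule exp_convex)
      have "exp (l * Z \<omega> + r * (\<bar>Y a \<omega>\<bar> + V)) =
          exp ((1 - 1/2) *\<^sub>R (l * Z \<omega> + 2 * r * \<bar>Y a \<omega>\<bar>) + (1/2) *\<^sub>R (l * Z \<omega> + 2 * r * V))"
        by (simp add: field_simps)
      also have "\<dots> \<le> (1 - 1/2) * F0 \<omega> + (1/2) * exp (l * Z \<omega> + 2 * r * V)"
        unfolding F0_def by (rule convex_onD[OF convex]) auto
      also have "exp (l * Z \<omega> + 2 * r * V) =
          exp (\<Sum>k<2 ^ n. (1 / N) *\<^sub>R (l * Z \<omega> + 2 * r * N * \<bar>U k \<omega>\<bar>))"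
        using N by (simp add: V_def distrib_left sum.distrib sum_distrib_left N_def mult.assoc)
      also have "\<dots> \<le> (\<Sum>k<2 ^ n. (1 / N) * F k \<omega>)"
        unfolding F_def by (rule convex_on_sum[OF _ _ convex]) (auto simp: N_def lessThan_empty_iff)
      also have "(1 - 1/2) * F0 \<omega> + (1/2) * (\<Sum>k<2 ^ n. (1 / N) * F k \<omega>) =
          F0 \<omega> / 2 + (\<Sum>k<2 ^ n. F k \<omega>) / (2 * N)"
        by (simp add: sum_divide_distrib[symmetric])
      finally have 1: "exp (l * Z \<omega> + r * (\<bar>Y a \<omega>\<bar> + V)) \<le> F0 \<omega> / 2 + (\<Sum>k<2 ^ n. F k \<omega>) / (2 * N)"
        by simp
      have "l * w \<le> l * Z \<omega>" "r * x \<le> r * (\<bar>Y a \<omega>\<bar> + V)"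
        using zw xV lr by (auto intro!: mult_left_mono)
      then have "1 \<le> exp (- l * w - r * x + (l * Z \<omega> + r * (\<bar>Y a \<omega>\<bar> + V)))" by simp
      also have "\<dots> \<le> G \<omega>" unfolding G_def exp_add[of "- l * w - r * x"] using 1 by (intro mult_left_mono) auto
      finally show ?thesis .
    qed
    have "prob (E n) = expectation (indicator (E n))" using E_meas[of n] sets.sets_into_space[of "E n" M] by (simp add: Int_absorb2)
    also have "\<dots> \<le> expectation G"
      using G1 G_nonneg Gi E_meas[of n] by (intro integral_mono integrable_real_indicator) (auto simp: indicator_def less_top[symmetric])
    also have "\<dots> = exp (- l * w - r * x) * (expectation F0 / 2 + (\<Sum>k<2 ^ n. expectation (F k)) / (2 * N))"
    proof -
      have "integrable M (\<lambda>\<omega>. \<Sum>k<2 ^ n. F k \<omega>)"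
        using Fi by (intro Bochner_Integration.integrable_sum) auto
      moreover have "expectation (\<lambda>\<omega>. \<Sum>k<2 ^ n. F k \<omega>) = (\<Sum>k<2 ^ n. expectation (F k))"
        using Fi by (intro Bochner_Integration.integral_sum) auto
      ultimately show ?thesis unfolding G_def using F0i by simp
    qed
    also have "\<dots> \<le> exp (- l * w - r * x) * (B / 2 + (\<Sum>k<(2::nat) ^ n. B) / (2 * N))"
      using F0 FB N by (intro mult_left_mono add_mono divide_right_mono sum_mono) auto
    also have "(\<Sum>k<(2::nat) ^ n. B) / (2 * N) = B / 2" using N by (simp add: N_def)
    also have "exp (- l * w - r * x) * (B / 2 + B / 2) = 2 * exp (- l * w - r * x + (l\<^sup>2 * cov Z Z / 2 + 2 * r\<^sup>2 * C'))"
      by (simp add: B_def exp_add)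
    also have "- l * w - r * x + (l\<^sup>2 * cov Z Z / 2 + 2 * r\<^sup>2 * C') = - w\<^sup>2 / (2 * cov Z Z) - x\<^sup>2 / (8 * C')"
      using v C(3) by (simp add: l_def r_def power2_eq_square field_simps)
    finally show ?thesis .
  qed
  have "incseq E"
    using grid_mono_Suc by (intro incseq_SucI) (fastforce simp: E_def)
  then have "(\<lambda>n. prob (E n)) \<longlonglongrightarrow> prob (\<Union>n. E n)"
    using E_meas by (intro finite_Lim_measure_incseq) auto
  then have "prob (\<Union>n. E n) \<le> 2 * exp (- w\<^sup>2 / (2 * cov Z Z) - x\<^sup>2 / (8 * C'))"
    by (rule LIMSEQ_le_const2) (use bound in auto)
  moreover have "(\<Union>n. E n) = {\<omega> \<in> space M. w < Z \<omega> \<and> (\<exists>t\<in>dyadic. x < \<bar>Y t \<omega>\<bar>)}"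
    by (auto simp: E_def dyadic_def)
  ultimately show ?thesis by simp
qed

end

section \<open>Exceedance events\<close>

text \<open>Only the quadratic coefficient matters. Constants and linear terms may be lost freely in
  the tail estimates, which is why crude bounds suffice in \<open>concentration\<close>.\<close>

lemma gaussian_scale_dominated:
  fixes p p0 q q0 K K0 :: real
  assumes "p0 < p" "0 < K0"
  shows "eventually (\<lambda>u. K * exp (- p * u\<^sup>2 + q * u) \<le> K0 * exp (- p0 * u\<^sup>2 + q0 * u)) at_top"
proof -
  define d where "d = p - p0"
  define s where "s = q - q0"
  have d: "d > 0" using assms by (simp add: d_def)
  have "((\<lambda>u. K * exp (- d * u\<^sup>2 + s * u)) \<longlongrightarrow> 0) at_top"
    using d by real_asymp
  then have "eventually (\<lambda>u. K * exp (- d * u\<^sup>2 + s * u) < K0) at_top"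
    by (rule order_tendstoD(2)) (use assms in simp)
  then show ?thesis
  proof eventually_elim
    case (elim u)
    have "K * exp (- p * u\<^sup>2 + q * u) = (K * exp (- d * u\<^sup>2 + s * u)) * exp (- p0 * u\<^sup>2 + q0 * u)"
      by (simp add: d_def s_def exp_add[symmetric] algebra_simps)
    also have "\<dots> \<le> K0 * exp (- p0 * u\<^sup>2 + q0 * u)"
      using elim by (intro mult_right_mono) auto
    finally show ?case .
  qed
qed

context centered_gaussian_process
begin

section \<open>Cauchy-Schwarz and one-dimensional tails\<close>

lemma cov_Cauchy_Schwarz:
  assumes K: "lin K" and L: "lin L"
  shows "(cov K L)\<^sup>2 \<le> cov K K * cov L L"
proof (cases "cov L L = 0")
  case True
  then have "AE \<omega> in M. L \<omega> = 0" using cov_eq_0_iff[OF L] by simp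
  then have "cov L K = 0" using L K by (intro cov_eq_0_AE)
  then show ?thesis using True by (simp add: cov_commute)
next
  case False
  then have v: "0 < cov L L" using cov_nonneg[of L] by simp
  define c where "c = cov K L / cov L L"
  have "0 \<le> cov (\<lambda>\<omega>. K \<omega> - c * L \<omega>) (\<lambda>\<omega>. K \<omega> - c * L \<omega>)" by (rule cov_nonneg)
  also have "\<dots> = cov K K - 2 * c * cov K L + c\<^sup>2 * cov L L"
    using K L by (simp add: cov_diff cov_diff_right lin_scale lin_diff cov_scale cov_scale_right
        cov_commute[of L K] power2_eq_square algebra_simps)
  also have "\<dots> = cov K K - (cov K L)\<^sup>2 / cov L L"
    using v by (simp add: c_def power2_eq_square field_simps)
  finally show ?thesis using v by (simp add: field_simps)
qed

lemma Chernoff_bound: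
  assumes Z: "lin Z" and v: "0 < cov Z Z" and w: "0 \<le> w"
  shows "prob {\<omega> \<in> space M. w < Z \<omega>} \<le> exp (- w\<^sup>2 / (2 * cov Z Z))"
proof -
  have [measurable]: "Z \<in> borel_measurable M" using Z lin_measurable by auto
  define l where "l = w / cov Z Z"
  have l: "0 \<le> l" using v w by (simp add: l_def)
  have i: "integrable M (\<lambda>\<omega>. exp (l * Z \<omega>))" by (intro lin_exp_integrable lin_scale Z)
  have "prob {\<omega> \<in> space M. w < Z \<omega>} = expectation (indicator {\<omega> \<in> space M. w < Z \<omega>})"
    by (simp add: Int_absorb2)
  also have "\<dots> \<le> expectation (\<lambda>\<omega>. exp (- l * w) * exp (l * Z \<omega>))"
  proof (rule integral_mono)
    fix \<omega> assume "\<omega> \<in> space M"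
    have "w < Z \<omega> \<Longrightarrow> l * w \<le> l * Z \<omega>" using l by (intro mult_left_mono) auto
    then show "indicator {\<omega> \<in> space M. w < Z \<omega>} \<omega> \<le> exp (- l * w) * exp (l * Z \<omega>)"
      by (auto simp: indicator_def exp_add[symmetric])
  qed (use i in \<open>auto intro!: integrable_real_indicator simp: less_top[symmetric]\<close>)
  also have "\<dots> = exp (- l * w) * exp (l\<^sup>2 * cov Z Z / 2)"
    using lin_mgf[OF lin_scale[OF Z, of l]]
    by (simp add: cov_scale cov_scale_right power2_eq_square mult.assoc)
  also have "\<dots> = exp (- l * w + l\<^sup>2 * cov Z Z / 2)" by (rule exp_add[symmetric])
  also have "- l * w + l\<^sup>2 * cov Z Z / 2 = - w\<^sup>2 / (2 * cov Z Z)"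
    using v by (simp add: l_def power2_eq_square field_simps)
  finally show ?thesis .
qed

text \<open>The density is bounded below on (w, w + 1]. Compared with the sharp tail this costs a
  factor that is exponential in a linear function of w, which
  \<open>gaussian_scale_dominated\<close> tolerates.\<close>

lemma Gaussian_tail_lower:
  assumes Z: "lin Z" and v: "0 < cov Z Z" and w: "0 \<le> w"
  shows "1 / sqrt (2 * pi * cov Z Z) * exp (- (w + 1)\<^sup>2 / (2 * cov Z Z)) \<le> prob {\<omega> \<in> space M. w < Z \<omega>}"
proof -
  define s where "s = sqrt (cov Z Z)"
  have s: "0 < s" "s\<^sup>2 = cov Z Z" using v by (auto simp: s_def)
  have D: "distributed M lborel Z (normal_density 0 s)"
    using lin_distributed[OF Z v] by (simp add: s_def)
  define m where "m = 1 / sqrt (2 * pi * cov Z Z) * exp (- (w + 1)\<^sup>2 / (2 * cov Z Z))"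
  have m: "0 \<le> m" using v by (simp add: m_def)
  have le: "m \<le> normal_density 0 s x" if "x \<in> {w<..w+1}" for x
  proof -
    have "x\<^sup>2 \<le> (w + 1)\<^sup>2" using that w by (intro power_mono) auto
    then have "exp (- (w + 1)\<^sup>2 / (2 * cov Z Z)) \<le> exp (- x\<^sup>2 / (2 * cov Z Z))"
      using v by (simp add: divide_right_mono)
    then show ?thesis using v by (auto simp: m_def normal_density_def s intro!: mult_left_mono divide_right_mono)
  qed
  have "ennreal m = (\<integral>\<^sup>+x. ennreal m * indicator {w<..w+1} x \<partial>lborel)"
    using w by (simp add: nn_integral_cmult_indicator)
  also have "\<dots> \<le> (\<integral>\<^sup>+x. ennreal (normal_density 0 s x) * indicator {w<..} x \<partial>lborel)"
    using le by (intro nn_integral_mono) (auto simp: indicator_def intro!: ennreal_leI)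
  also have "\<dots> = emeasure M (Z -` {w<..} \<inter> space M)"
    using distributed_emeasure[OF D, of "{w<..}"] by simp
  also have "Z -` {w<..} \<inter> space M = {\<omega> \<in> space M. w < Z \<omega>}" by auto
  finally show ?thesis using m by (simp add: emeasure_eq_measure ennreal_le_iff m_def)
qed

end

context smooth_gaussian_process
begin

section \<open>Continuity of potentials and exceedance of varying levels\<close>

lemma cov_lipschitz:
  assumes L: "lin L"
  shows "\<exists>B\<ge>0. \<forall>s\<in>{a..b}. \<forall>t\<in>{a..b}. \<bar>cov (X s) L - cov (X t) L\<bar> \<le> B * \<bar>s - t\<bar>"
proof -
  obtain C where C: "C > 0" and inc: "\<And>s t. s \<in> {a..b} \<Longrightarrow> t \<in> {a..b} \<Longrightarrow>
      cov (\<lambda>\<omega>. X s \<omega> - X t \<omega>) (\<lambda>\<omega>. X s \<omega> - X t \<omega>) \<le> C * (s - t)\<^sup>2"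
    using increment_bound by blast
  have "\<bar>cov (X s) L - cov (X t) L\<bar> \<le> sqrt (C * cov L L) * \<bar>s - t\<bar>"
    if "s \<in> {a..b}" "t \<in> {a..b}" for s t
  proof -
    have "(cov (X s) L - cov (X t) L)\<^sup>2 = (cov (\<lambda>\<omega>. X s \<omega> - X t \<omega>) L)\<^sup>2"
      using L by (simp add: cov_diff lin_X)
    also have "\<dots> \<le> cov (\<lambda>\<omega>. X s \<omega> - X t \<omega>) (\<lambda>\<omega>. X s \<omega> - X t \<omega>) * cov L L"
      using L by (intro cov_Cauchy_Schwarz lin_diff lin_X)
    also have "\<dots> \<le> C * (s - t)\<^sup>2 * cov L L"
      using inc that cov_nonneg by (intro mult_right_mono) auto
    finally have "(cov (X s) L - cov (X t) L)\<^sup>2 \<le> (C * cov L L) * (s - t)\<^sup>2"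
      by (simp add: mult_ac)
    then have "sqrt ((cov (X s) L - cov (X t) L)\<^sup>2) \<le> sqrt ((C * cov L L) * (s - t)\<^sup>2)"
      by (rule real_sqrt_le_mono)
    then show ?thesis by (simp only: real_sqrt_mult real_sqrt_abs)
  qed
  then show ?thesis using C cov_nonneg by (intro exI[of _ "sqrt (C * cov L L)"]) auto
qed

lemma cov_continuous: assumes "lin L" shows "continuous_on {a..b} (\<lambda>t. cov (X t) L)"
proof -
  obtain B where "B \<ge> 0" "\<forall>s\<in>{a..b}. \<forall>t\<in>{a..b}. \<bar>cov (X s) L - cov (X t) L\<bar> \<le> B * \<bar>s - t\<bar>"
    using cov_lipschitz[OF assms] by blast
  then have "B-lipschitz_on {a..b} (\<lambda>t. cov (X t) L)"
    by (intro lipschitz_onI) (auto simp: dist_real_def)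
  then show ?thesis by (rule lipschitz_on_continuous_on)
qed

text \<open>The level is a function because a Cameron-Martin shift turns a constant level into one
  moved by a covariance function.\<close>

definition exceeds :: "(real \<Rightarrow> real) \<Rightarrow> 'w set" where
  "exceeds w = {\<omega> \<in> space M. \<forall>t\<in>{a..b}. w t < X t \<omega>}"

text \<open>Strict inequality on a dense set gives only a weak one in the limit. By compactness the
  gap has a positive minimum, so a uniform margin 1 / (n + 1) encodes strictness by countably many
  conditions.\<close>

lemma exceeds_iff_dyadic:
  assumes w: "continuous_on {a..b} w" and \<omega>: "\<omega> \<in> space M"
  shows "(\<forall>t\<in>{a..b}. w t < X t \<omega>) \<longleftrightarrow> (\<exists>n. \<forall>t\<in>dyadic. w t + inverse (real (Suc n)) \<le> X t \<omega>)"
proof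
  have cont: "continuous_on {a..b} (\<lambda>t. X t \<omega> - w t)"
    by (intro continuous_intros path_continuous \<omega> w)
  assume *: "\<forall>t\<in>{a..b}. w t < X t \<omega>"
  obtain s where s: "s \<in> {a..b}" "\<And>t. t \<in> {a..b} \<Longrightarrow> X s \<omega> - w s \<le> X t \<omega> - w t"
    using continuous_attains_inf[OF _ _ cont] ab by auto
  have "0 < X s \<omega> - w s" using * s by simp
  then obtain n where n: "inverse (real (Suc n)) < X s \<omega> - w s" using reals_Archimedean by blast
  show "\<exists>n. \<forall>t\<in>dyadic. w t + inverse (real (Suc n)) \<le> X t \<omega>"
  proof (intro exI[of _ n] ballI)
    fix t assume "t \<in> dyadic"
    then have "X s \<omega> - w s \<le> X t \<omega> - w t" using dyadic_subset by (intro s(2)) blast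
    then show "w t + inverse (real (Suc n)) \<le> X t \<omega>" using n by linarith
  qed
next
  have cont: "continuous_on {a..b} (\<lambda>t. X t \<omega> - w t)"
    by (intro continuous_intros path_continuous \<omega> w)
  assume "\<exists>n. \<forall>t\<in>dyadic. w t + inverse (real (Suc n)) \<le> X t \<omega>"
  then obtain n where n0: "\<forall>t\<in>dyadic. w t + inverse (real (Suc n)) \<le> X t \<omega>" by blast
  have n: "inverse (real (Suc n)) \<le> X t \<omega> - w t" if "t \<in> dyadic" for t
    using n0[rule_format, OF that] by linarith
  show "\<forall>t\<in>{a..b}. w t < X t \<omega>"
  proof
    fix t assume t: "t \<in> {a..b}"
    have "inverse (real (Suc n)) \<le> X t \<omega> - w t" by (rule dyadic_dense[OF cont _ t]) (rule n)
    moreover have "0 < inverse (real (Suc n))" by simp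
    ultimately show "w t < X t \<omega>" by linarith
  qed
qed

lemma exceeds_eq_dyadic:
  assumes "continuous_on {a..b} w"
  shows "exceeds w = {\<omega> \<in> space M. \<exists>n. \<forall>t\<in>dyadic. w t + inverse (real (Suc n)) \<le> X t \<omega>}"
  unfolding exceeds_def by (rule Collect_cong, rule conj_cong[OF refl], rule exceeds_iff_dyadic[OF assms])

lemma exceeds_measurable: assumes "continuous_on {a..b} w" shows "exceeds w \<in> events"
  unfolding exceeds_eq_dyadic[OF assms] by measurable

text \<open>\<open>C\<close> is an event on which the Cameron-Martin density is bounded below. This
  one-sided bound serves both comparisons of levels: a shift leads from a constant level to a
  varying one, and the opposite shift leads back.\<close>

lemma exceeds_shift_lower:
  assumes w: "continuous_on {a..b} w" and L: "lin L" and C[measurable]: "C \<in> events"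
    and le: "\<And>\<omega>. \<omega> \<in> exceeds w \<inter> C \<Longrightarrow> k \<le> L \<omega> - cov L L / 2"
  shows "exp k * prob (exceeds w \<inter> C) \<le> prob (exceeds (\<lambda>t. w t - cov (X t) L))"
proof -
  have w': "continuous_on {a..b} (\<lambda>t. w t - cov (X t) L)"
    by (rule continuous_on_diff[OF w cov_continuous[OF L]])
  have [measurable]: "exceeds w \<in> events" by (rule exceeds_measurable[OF w])
  define B where "B = {y \<in> space (PX dyadic). \<exists>n. \<forall>t\<in>dyadic. w t + inverse (real (Suc n)) \<le> y t}"
  have [measurable]: "B \<in> sets (PX dyadic)"
    unfolding B_def by measurable
  have mem: "(\<lambda>t\<in>dyadic. f t) \<in> B \<longleftrightarrow> (\<exists>n. \<forall>t\<in>dyadic. w t + inverse (real (Suc n)) \<le> f t)" for f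
    unfolding B_def by (auto simp: space_PiM)
  have "exceeds (\<lambda>t. w t - cov (X t) L) = {\<omega> \<in> space M. (\<lambda>t\<in>dyadic. X t \<omega> + cov (X t) L) \<in> B}"
    unfolding exceeds_eq_dyadic[OF w'] mem by (simp add: algebra_simps)
  then have "emeasure M (exceeds (\<lambda>t. w t - cov (X t) L)) =
      (\<integral>\<^sup>+\<omega>. ennreal (exp (L \<omega> - cov L L / 2)) * indicator B (\<lambda>t\<in>dyadic. X t \<omega>) \<partial>M)"
    using Cameron_Martin[OF L, of B dyadic] by simp
  also have "\<dots> \<ge> (\<integral>\<^sup>+\<omega>. ennreal (exp k) * indicator (exceeds w \<inter> C) \<omega> \<partial>M)"
  proof (rule nn_integral_mono)
    fix \<omega> assume "\<omega> \<in> space M"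
    show "ennreal (exp k) * indicator (exceeds w \<inter> C) \<omega> \<le>
        ennreal (exp (L \<omega> - cov L L / 2)) * indicator B (\<lambda>t\<in>dyadic. X t \<omega>)"
    proof (cases "\<omega> \<in> exceeds w \<inter> C")
      case True
      then have "(\<lambda>t\<in>dyadic. X t \<omega>) \<in> B" unfolding exceeds_eq_dyadic[OF w] mem by auto
      then show ?thesis using le[OF True] True by (auto intro!: ennreal_leI)
    qed simp
  qed
  also have "(\<integral>\<^sup>+\<omega>. ennreal (exp k) * indicator (exceeds w \<inter> C) \<omega> \<partial>M) = ennreal (exp k * prob (exceeds w \<inter> C))"
    by (simp add: nn_integral_cmult_indicator emeasure_eq_measure ennreal_mult)
  finally show ?thesis by (simp add: emeasure_eq_measure ennreal_le_iff)
qed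

end

section \<open>Concentration of high exceedances\<close>

text \<open>The set \<open>P\<close> is where the potential of the minimizer equals its minimal value; it contains the
  support but may be larger, and then \<open>\<theta>\<close> vanishes on the extra points.\<close>

locale equilibrium = smooth_gaussian_process M X a b
  for M :: "'w measure" and X :: "real \<Rightarrow> 'w \<Rightarrow> real" and a b :: real +
  fixes P :: "real set" and \<theta> :: "real \<Rightarrow> real"
  assumes finite_P: "finite P" and P_subset: "P \<subseteq> {a..b}"
    and \<theta>_nonneg: "\<And>i. i \<in> P \<Longrightarrow> 0 \<le> \<theta> i" and \<theta>_sum: "sum \<theta> P = 1"
    and independent_P: "\<And>c. cov (\<lambda>\<omega>. \<Sum>i\<in>P. c i * X i \<omega>) (\<lambda>\<omega>. \<Sum>i\<in>P. c i * X i \<omega>) = 0 \<Longrightarrow>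
      \<forall>i\<in>P. c i = 0"
    and potential_ge: "\<And>t. t \<in> {a..b} \<Longrightarrow> cov (\<lambda>\<omega>. \<Sum>i\<in>P. \<theta> i * X i \<omega>) (\<lambda>\<omega>. \<Sum>i\<in>P. \<theta> i * X i \<omega>) \<le>
      cov (X t) (\<lambda>\<omega>. \<Sum>i\<in>P. \<theta> i * X i \<omega>)"
    and potential_eq_iff: "\<And>t. t \<in> {a..b} \<Longrightarrow> cov (X t) (\<lambda>\<omega>. \<Sum>i\<in>P. \<theta> i * X i \<omega>) =
      cov (\<lambda>\<omega>. \<Sum>i\<in>P. \<theta> i * X i \<omega>) (\<lambda>\<omega>. \<Sum>i\<in>P. \<theta> i * X i \<omega>) \<longleftrightarrow> t \<in> P"
begin

section \<open>Regression of the process on \<open>Z\<close>\<close>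

definition Z :: "'w \<Rightarrow> real" where "Z = (\<lambda>\<omega>. \<Sum>i\<in>P. \<theta> i * X i \<omega>)"

definition v :: real where "v = cov Z Z"

text \<open>The regression coefficient of X t on \<open>Z\<close>. Since
  \<open>cov (X i) Z = v\<close> for all i in \<open>P\<close>, the vector \<theta> / v is the
  inverse covariance matrix of the X i applied to the vector of ones, so \<mu> t is also the
  conditional mean of X t given X i = 1 for all i in \<open>P\<close>.\<close>

definition \<mu> :: "real \<Rightarrow> real" where "\<mu> t = cov (X t) Z / v"

definition Y :: "real \<Rightarrow> 'w \<Rightarrow> real" where "Y t \<omega> = X t \<omega> - \<mu> t * Z \<omega>"

lemma lin_Z: "lin Z"
  unfolding Z_def using finite_P by (rule lin_finite_sum)

lemma Z_measurable[measurable]: "Z \<in> borel_measurable M"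
  using lin_Z by (rule lin_measurable)

lemma v_pos: "0 < v"
proof -
  have "v \<noteq> 0"
  proof
    assume "v = 0"
    then have "cov Z Z = 0" unfolding v_def .
    then have "\<forall>i\<in>P. \<theta> i = 0" unfolding Z_def by (rule independent_P)
    then show False using \<theta>_sum by simp
  qed
  then show ?thesis using cov_nonneg[of Z] by (simp add: v_def)
qed

lemma \<mu>_ge: "t \<in> {a..b} \<Longrightarrow> 1 \<le> \<mu> t"
  using potential_ge[of t, folded Z_def, folded v_def] v_pos by (simp add: \<mu>_def)

lemma \<mu>_eq_1_iff: "t \<in> {a..b} \<Longrightarrow> \<mu> t = 1 \<longleftrightarrow> t \<in> P"
proof -
  assume "t \<in> {a..b}"
  then have "cov (X t) Z = v \<longleftrightarrow> t \<in> P" using potential_eq_iff[of t] by (simp only: v_def Z_def)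
  moreover have "\<mu> t = 1 \<longleftrightarrow> cov (X t) Z = v" using v_pos by (auto simp: \<mu>_def)
  ultimately show ?thesis by simp
qed

lemma \<mu>_P: "i \<in> P \<Longrightarrow> \<mu> i = 1"
  using \<mu>_eq_1_iff P_subset by auto

lemma \<mu>_continuous: "continuous_on {a..b} \<mu>"
  unfolding \<mu>_def using v_pos
  by (intro continuous_on_divide[OF cov_continuous[OF lin_Z] continuous_on_const]) auto

lemma lin_Y: "lin (Y t)"
  unfolding Y_def by (intro lin_diff lin_scale lin_X lin_Z)

lemma Y_measurable[measurable]: "Y t \<in> borel_measurable M"
  using lin_Y by (rule lin_measurable)

lemma cov_Y_Z: "cov (Y t) Z = 0"
proof -
  have "cov (Y t) Z = cov (X t) Z - \<mu> t * cov Z Z"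
    unfolding Y_def by (simp only: cov_diff[OF lin_X lin_scale[OF lin_Z] lin_Z] cov_scale)
  then show ?thesis using v_pos by (simp add: \<mu>_def v_def)
qed

lemma X_eq: "X t \<omega> = \<mu> t * Z \<omega> + Y t \<omega>"
  by (simp add: Y_def)

lemma Y_continuous: "\<omega> \<in> space M \<Longrightarrow> continuous_on {a..b} (\<lambda>t. Y t \<omega>)"
  unfolding Y_def
  by (rule continuous_on_diff[OF path_continuous continuous_on_mult[OF \<mu>_continuous continuous_on_const]])

text \<open>Pythagoras: an increment of \<open>X\<close> is the increment of \<open>Y\<close> plus
  an uncorrelated multiple of \<open>Z\<close>. The bound of \<open>increment_bound\<close> thus
  passes to \<open>Y\<close>.\<close>

lemma Y_increment_le:
  "cov (\<lambda>\<omega>. Y s \<omega> - Y t \<omega>) (\<lambda>\<omega>. Y s \<omega> - Y t \<omega>) \<le> cov (\<lambda>\<omega>. X s \<omega> - X t \<omega>) (\<lambda>\<omega>. X s \<omega> - X t \<omega>)"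
proof -
  let ?D = "\<lambda>\<omega>. Y s \<omega> - Y t \<omega>"
  define c where "c = \<mu> s - \<mu> t"
  have D: "lin ?D" by (intro lin_diff lin_Y)
  have DZ: "cov ?D Z = 0" by (simp add: cov_diff lin_Y lin_Z cov_Y_Z)
  have "(\<lambda>\<omega>. X s \<omega> - X t \<omega>) = (\<lambda>\<omega>. ?D \<omega> + c * Z \<omega>)"
    by (simp add: X_eq c_def algebra_simps)
  then have "cov (\<lambda>\<omega>. X s \<omega> - X t \<omega>) (\<lambda>\<omega>. X s \<omega> - X t \<omega>) = cov ?D ?D + c\<^sup>2 * cov Z Z"
    using DZ cov_commute[of Z ?D]
    by (simp add: cov_add[OF D lin_scale[OF lin_Z]] cov_add_right[OF D lin_scale[OF lin_Z]] D lin_Z lin_scale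
        lin_add cov_scale cov_scale_right power2_eq_square)
  then show ?thesis using cov_nonneg[of Z] by simp
qed

text \<open>No lower bound on \<open>Z\<close> is imposed, since exceedance itself supplies
  \<open>u - 1 < Z\<close>. Restriction to \<open>dyadic\<close> keeps the event measurable, and
  \<open>concentrated_Y\<close> extends the bound to [a,b].\<close>

definition concentrated :: "real \<Rightarrow> real \<Rightarrow> 'w set" where
  "concentrated e u = {\<omega> \<in> space M. Z \<omega> \<le> (1 + e) * u \<and> (\<forall>t\<in>dyadic. \<bar>Y t \<omega>\<bar> \<le> e * u)}"

lemma concentrated_measurable[measurable]: "concentrated e u \<in> events"
  unfolding concentrated_def by measurable

lemma concentrated_Y: assumes "\<omega> \<in> concentrated e u" "t \<in> {a..b}" shows "\<bar>Y t \<omega>\<bar> \<le> e * u"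
proof -
  have "0 \<le> e * u - \<bar>Y t \<omega>\<bar>"
  proof (rule dyadic_dense[OF _ _ assms(2)])
    show "continuous_on {a..b} (\<lambda>t. e * u - \<bar>Y t \<omega>\<bar>)"
      using assms(1) by (intro continuous_intros Y_continuous) (simp add: concentrated_def)
  qed (use assms(1) in \<open>simp add: concentrated_def\<close>)
  then show ?thesis by simp
qed

abbreviation g :: "real \<Rightarrow> real" where "g u \<equiv> prob (exceeds (\<lambda>_. u))"

lemma Y_tail:
  "\<exists>C>0. \<forall>w\<ge>0. \<forall>x\<ge>0. prob {\<omega> \<in> space M. w < Z \<omega> \<and> (\<exists>t\<in>dyadic. x < \<bar>Y t \<omega>\<bar>)} \<le>
    2 * exp (- w\<^sup>2 / (2 * v) - x\<^sup>2 / (8 * C))"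
proof -
  obtain C where C: "C > 0" and inc: "\<And>s t. s \<in> {a..b} \<Longrightarrow> t \<in> {a..b} \<Longrightarrow>
      cov (\<lambda>\<omega>. X s \<omega> - X t \<omega>) (\<lambda>\<omega>. X s \<omega> - X t \<omega>) \<le> C * (s - t)\<^sup>2"
    using increment_bound by blast
  define C' where "C' = max (C * (b - a)\<^sup>2) (cov (Y a) (Y a))"
  have "0 < C * (b - a)\<^sup>2" using C ab by simp
  then have C': "C * (b - a)\<^sup>2 \<le> C'" "cov (Y a) (Y a) \<le> C'" "0 < C'"
    unfolding C'_def by linarith+
  have inc': "cov (\<lambda>\<omega>. Y s \<omega> - Y t \<omega>) (\<lambda>\<omega>. Y s \<omega> - Y t \<omega>) \<le> C * (s - t)\<^sup>2"
    if "s \<in> {a..b}" "t \<in> {a..b}" for s t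
    using Y_increment_le inc[OF that] by (rule order_trans)
  have "prob {\<omega> \<in> space M. w < Z \<omega> \<and> (\<exists>t\<in>dyadic. x < \<bar>Y t \<omega>\<bar>)} \<le> 2 * exp (- w\<^sup>2 / (2 * v) - x\<^sup>2 / (8 * C'))"
    if "0 \<le> w" "0 \<le> x" for w x
    unfolding v_def
    by (rule joint_tail_bound[where Y=Y and C=C, OF lin_Z lin_Y cov_Y_Z inc' C'(1) C'(2) C'(3) v_pos[unfolded v_def] that(2) that(1)])
  then show ?thesis using C'(3) by (intro exI[of _ C']) simp
qed

text \<open>If Z > (1 + d) u and |Y| \<le> d u everywhere, then X = \<mu> Z + Y exceeds
  \<open>u\<close> because \<mu> \<ge> 1.\<close>

lemma g_lower:
  assumes u: "0 < u" and d: "0 < d"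
  shows "prob {\<omega> \<in> space M. (1 + d) * u < Z \<omega>} -
    prob {\<omega> \<in> space M. (1 + d) * u < Z \<omega> \<and> (\<exists>t\<in>dyadic. d * u < \<bar>Y t \<omega>\<bar>)} \<le> g u"
proof -
  let ?A = "{\<omega> \<in> space M. (1 + d) * u < Z \<omega>}"
  let ?B = "{\<omega> \<in> space M. (1 + d) * u < Z \<omega> \<and> (\<exists>t\<in>dyadic. d * u < \<bar>Y t \<omega>\<bar>)}"
  have "prob ?A - prob ?B = prob (?A - ?B)"
    by (rule finite_measure_Diff[symmetric]) auto
  also have "?A - ?B \<subseteq> exceeds (\<lambda>_. u)"
  proof
    fix \<omega> assume \<omega>: "\<omega> \<in> ?A - ?B"
    then have sp: "\<omega> \<in> space M" by simp
    have "u < X t \<omega>" if t: "t \<in> {a..b}" for t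
    proof -
      have "0 \<le> d * u - \<bar>Y t \<omega>\<bar>"
      proof (rule dyadic_dense[OF _ _ t])
        show "continuous_on {a..b} (\<lambda>t. d * u - \<bar>Y t \<omega>\<bar>)"
          by (intro continuous_intros Y_continuous sp)
      qed (use \<omega> in \<open>auto simp: not_less\<close>)
      moreover have "1 * Z \<omega> \<le> \<mu> t * Z \<omega>"
      proof (rule mult_right_mono[OF \<mu>_ge[OF t]])
        have "0 < (1 + d) * u" using u d by simp
        then show "0 \<le> Z \<omega>" using \<omega> by auto
      qed
      moreover have "(1 + d) * u < Z \<omega>" using \<omega> by simp
      ultimately show ?thesis by (simp add: X_eq[of t] distrib_right)
    qed
    then show "\<omega> \<in> exceeds (\<lambda>_. u)" using sp by (simp add: exceeds_def)
  qed
  then have "prob (?A - ?B) \<le> g u"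
    by (intro finite_measure_mono exceeds_measurable) auto
  finally show ?thesis .
qed

text \<open>Failure of concentration is of Gaussian order with exponent \<open>p1\<close> if
  \<open>Z\<close> is too large and \<open>p2\<close> if \<open>Y\<close> is; both are strictly
  above 1 / (2 v). By \<open>g_lower\<close>, \<open>g u\<close> is at least of order
  \<open>p0\<close>, which is as close to 1 / (2 v) as desired, so the failure is negligible against
  it. The level u - 1 in place of u lets the bound apply to the shifted exceedances as well.\<close>

lemma concentration:
  assumes e: "0 < e" and \<tau>: "0 < \<tau>"
  shows "eventually (\<lambda>u. prob ({\<omega> \<in> space M. u - 1 < Z \<omega>} - concentrated e u) \<le> \<tau> * g u) at_top"
proof -
  obtain C where C: "0 < C" and tail: "\<forall>w\<ge>0. \<forall>x\<ge>0.
    prob {\<omega> \<in> space M. w < Z \<omega> \<and> (\<exists>t\<in>dyadic. x < \<bar>Y t \<omega>\<bar>)} \<le> 2 * exp (- w\<^sup>2 / (2 * v) - x\<^sup>2 / (8 * C))"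
    using Y_tail by (elim exE conjE)
  define p1 where "p1 = (1 + e)\<^sup>2 / (2 * v)"
  define p2 where "p2 = 1 / (2 * v) + e\<^sup>2 / (8 * C)"
  \<comment> \<open>\<open>q\<close> is the relative gap: min p1 p2 = (1 + q) / (2 v). The choice of
    \<open>d\<close> below gives (1 + d)^2 \<le> 1 + 3 d < 1 + q, hence p0 < min p1 p2.\<close>
  define q where "q = 2 * v * (min p1 p2) - 1"
  have "1 < (1 + e)\<^sup>2" using e by (simp add: one_less_power)
  then have "1 / (2 * v) < min p1 p2" using e v_pos C by (auto simp: p1_def p2_def divide_strict_right_mono)
  moreover have "0 < 2 * v * m - 1" if "1 / (2 * v) < m" for m
    using that v_pos by (simp add: field_simps)
  ultimately have q: "0 < q" unfolding q_def by blast
  define d where "d = min 1 (q / 4)"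
  have d: "0 < d" "d \<le> 1" "d \<le> q / 4" using q by (auto simp: d_def)
  define p0 where "p0 = (1 + d)\<^sup>2 / (2 * v)"
  have "(1 + d)\<^sup>2 < 1 + q"
  proof -
    have "d * d \<le> d * 1" using d by (intro mult_left_mono) auto
    then have "(1 + d)\<^sup>2 \<le> 1 + 3 * d" by (simp add: power2_eq_square algebra_simps)
    then show ?thesis using d q by linarith
  qed
  then have "(1 + d)\<^sup>2 / (2 * v) < (1 + q) / (2 * v)" using v_pos by (intro divide_strict_right_mono) auto
  also have "(1 + q) / (2 * v) = min p1 p2" using v_pos by (simp add: q_def)
  finally have p0: "p0 < p1" "p0 < p2" by (auto simp: p0_def)
  define p3 where "p3 = p0 + d\<^sup>2 / (8 * C)"
  have p3: "p0 < p3" using d C by (simp add: p3_def)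
  \<comment> \<open>\<open>K0\<close> and \<open>q0\<close> come from expanding the square ((1 + d)
    u + 1)^2 / (2 v) in \<open>Gaussian_tail_lower\<close>.\<close>
  define K0 where "K0 = 1 / sqrt (2 * pi * v) * exp (- 1 / (2 * v))"
  have K0: "0 < K0" using v_pos by (simp add: K0_def)
  define q0 where "q0 = - (1 + d) / v"
  let ?g0 = "\<lambda>u. exp (- p0 * u\<^sup>2 + q0 * u)"
  \<comment> \<open>The event subtracted in \<open>g_lower\<close> uses up one third of the lower
    bound for \<open>g u\<close>. The two failure events may then each take \<tau> times one third,
    which together is \<tau> times the remaining two thirds.\<close>
  have "\<tau> * K0 / 3 > 0" using K0 \<tau> by simp
  then have ev: "eventually (\<lambda>u. 1 * exp (- p1 * u\<^sup>2 + 0 * u) \<le> \<tau> * K0 / 3 * ?g0 u) at_top"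
     "eventually (\<lambda>u. 2 * exp (- 1 / (2 * v)) * exp (- p2 * u\<^sup>2 + 1 / v * u) \<le> \<tau> * K0 / 3 * ?g0 u) at_top"
     "eventually (\<lambda>u. 2 * exp (- p3 * u\<^sup>2 + 0 * u) \<le> K0 / 3 * ?g0 u) at_top"
    using p0 p3 K0 by (intro gaussian_scale_dominated; simp)+
  show ?thesis
    using ev eventually_ge_at_top[of 1]
  proof eventually_elim
    case (elim u)
    then have u: "0 < u" "1 \<le> u" by auto
    have "K0 * ?g0 u = 1 / sqrt (2 * pi * v) * exp (- ((1 + d) * u + 1)\<^sup>2 / (2 * v))"
    proof -
      have "- 1 / (2 * v) + (- p0 * u\<^sup>2 + q0 * u) = - ((1 + d) * u + 1)\<^sup>2 / (2 * v)"
        using v_pos by (simp add: p0_def q0_def power2_eq_square field_simps)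
      then show ?thesis by (simp add: K0_def exp_add[symmetric])
    qed
    also have "\<dots> \<le> prob {\<omega> \<in> space M. (1 + d) * u < Z \<omega>}"
      unfolding v_def using v_pos u d by (intro Gaussian_tail_lower lin_Z) (auto simp: v_def)
    finally have 1: "K0 * ?g0 u \<le> prob {\<omega> \<in> space M. (1 + d) * u < Z \<omega>}" .
    have "prob {\<omega> \<in> space M. (1 + d) * u < Z \<omega> \<and> (\<exists>t\<in>dyadic. d * u < \<bar>Y t \<omega>\<bar>)} \<le>
        2 * exp (- ((1 + d) * u)\<^sup>2 / (2 * v) - (d * u)\<^sup>2 / (8 * C))"
      using u d by (intro tail[rule_format]) auto
    also have "- ((1 + d) * u)\<^sup>2 / (2 * v) - (d * u)\<^sup>2 / (8 * C) = - p3 * u\<^sup>2 + 0 * u"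
      unfolding p3_def p0_def power_mult_distrib by (simp add: left_diff_distrib)
    finally have 2: "prob {\<omega> \<in> space M. (1 + d) * u < Z \<omega> \<and> (\<exists>t\<in>dyadic. d * u < \<bar>Y t \<omega>\<bar>)} \<le> K0 / 3 * ?g0 u"
      using elim by linarith
    have g: "K0 * ?g0 u * (2 / 3) \<le> g u"
      using g_lower[OF u(1) d(1)] 1 2 by linarith
    have "prob ({\<omega> \<in> space M. u - 1 < Z \<omega>} - concentrated e u) \<le>
       prob ({\<omega> \<in> space M. (1 + e) * u < Z \<omega>} \<union> {\<omega> \<in> space M. u - 1 < Z \<omega> \<and> (\<exists>t\<in>dyadic. e * u < \<bar>Y t \<omega>\<bar>)})"
      by (intro finite_measure_mono) (auto simp: concentrated_def not_le)
    also have "\<dots> \<le> prob {\<omega> \<in> space M. (1 + e) * u < Z \<omega>} +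
        prob {\<omega> \<in> space M. u - 1 < Z \<omega> \<and> (\<exists>t\<in>dyadic. e * u < \<bar>Y t \<omega>\<bar>)}"
      by (intro measure_Un_le) auto
    also have "prob {\<omega> \<in> space M. (1 + e) * u < Z \<omega>} \<le> exp (- ((1 + e) * u)\<^sup>2 / (2 * v))"
      unfolding v_def using v_pos u e by (intro Chernoff_bound lin_Z) (auto simp: v_def)
    also have "- ((1 + e) * u)\<^sup>2 / (2 * v) = - p1 * u\<^sup>2 + 0 * u"
      unfolding p1_def power_mult_distrib by simp
    also have "prob {\<omega> \<in> space M. u - 1 < Z \<omega> \<and> (\<exists>t\<in>dyadic. e * u < \<bar>Y t \<omega>\<bar>)} \<le>
        2 * exp (- (u - 1)\<^sup>2 / (2 * v) - (e * u)\<^sup>2 / (8 * C))"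
      using u e by (intro tail[rule_format]) auto
    also have "- (u - 1)\<^sup>2 / (2 * v) - (e * u)\<^sup>2 / (8 * C) = - 1 / (2 * v) + (- p2 * u\<^sup>2 + 1 / v * u)"
      using v_pos C by (simp add: p2_def power2_eq_square field_simps)
    also have "2 * exp (- 1 / (2 * v) + (- p2 * u\<^sup>2 + 1 / v * u)) = 2 * exp (- 1 / (2 * v)) * exp (- p2 * u\<^sup>2 + 1 / v * u)"
      by (simp only: exp_add mult.assoc)
    finally have "prob ({\<omega> \<in> space M. u - 1 < Z \<omega>} - concentrated e u) \<le> \<tau> * K0 / 3 * ?g0 u + \<tau> * K0 / 3 * ?g0 u"
      using elim by linarith
    also have "\<dots> = \<tau> * (K0 * ?g0 u * (2 / 3))" by simp
    also have "\<dots> \<le> \<tau> * g u" using g \<tau> by (intro mult_left_mono) auto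
    finally show ?case .
  qed
qed

end

section \<open>Shifted exceedances\<close>

context centered_gaussian_process
begin

text \<open>Gram-Schmidt by induction, valid also for linearly dependent variables: if the residual
  \<open>r\<close> of the new variable has variance zero, it is almost surely zero and its
  coefficient is set to 0.\<close>

lemma projection_exists:
  assumes "finite J" "lin K"
  shows "\<exists>c. \<forall>i\<in>J. cov (\<lambda>\<omega>. K \<omega> - (\<Sum>j\<in>J. c j * X j \<omega>)) (X i) = 0"
  using assms
proof (induction J arbitrary: K rule: finite_induct)
  case empty
  then show ?case by simp
next
  case (insert j J)
  have lin_comb: "lin (\<lambda>\<omega>. \<Sum>i\<in>J. c i * X i \<omega>)" for c
    using insert.hyps(1) by (rule lin_finite_sum)
  obtain e where e: "\<forall>i\<in>J. cov (\<lambda>\<omega>. X j \<omega> - (\<Sum>i\<in>J. e i * X i \<omega>)) (X i) = 0"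
    using insert.IH[OF lin_X] by blast
  obtain c where c: "\<forall>i\<in>J. cov (\<lambda>\<omega>. K \<omega> - (\<Sum>i\<in>J. c i * X i \<omega>)) (X i) = 0"
    using insert.IH[OF insert.prems] by blast
  define r where "r = (\<lambda>\<omega>. X j \<omega> - (\<Sum>i\<in>J. e i * X i \<omega>))"
  define K' where "K' = (\<lambda>\<omega>. K \<omega> - (\<Sum>i\<in>J. c i * X i \<omega>))"
  have r: "lin r" unfolding r_def by (rule lin_diff[OF lin_X lin_comb])
  have K': "lin K'" unfolding K'_def by (rule lin_diff[OF insert.prems lin_comb])
  define \<alpha> where "\<alpha> = (if cov r r = 0 then 0 else cov K' r / cov r r)"
  define N where "N = (\<lambda>\<omega>. K' \<omega> - \<alpha> * r \<omega>)"
  have N: "lin N" unfolding N_def by (rule lin_diff[OF K' lin_scale[OF r]])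
  have cov_N: "cov N L = cov K' L - \<alpha> * cov r L" if "lin L" for L
    unfolding N_def by (simp only: cov_diff[OF K' lin_scale[OF r] that] cov_scale)
  have Nr: "cov N r = 0"
  proof (cases "cov r r = 0")
    case True
    then have "AE \<omega> in M. r \<omega> = 0" using cov_eq_0_iff[OF r] by simp
    then have "cov r K' = 0" by (rule cov_eq_0_AE[OF r _ K'])
    then have "cov K' r = 0" by (simp only: cov_commute)
    then show ?thesis using True by (simp add: cov_N[OF r] \<alpha>_def)
  qed (simp add: cov_N[OF r] \<alpha>_def)
  have NJ: "cov N (X i) = 0" if "i \<in> J" for i
    using e c that by (simp add: cov_N[OF lin_X] r_def K'_def)
  have "cov N (X j) = cov N (\<lambda>\<omega>. r \<omega> + (\<Sum>i\<in>J. e i * X i \<omega>))" by (simp add: r_def)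
  also have "\<dots> = cov N r + (\<Sum>i\<in>J. e i * cov N (X i))"
    by (simp only: cov_add_right[OF r lin_comb N] cov_sum_right[OF insert.hyps(1) lin_X N])
  also have "\<dots> = 0" using Nr NJ by simp
  finally have Nj: "cov N (X j) = 0" .
  define c' where "c' = (\<lambda>i. if i = j then \<alpha> else c i - \<alpha> * e i)"
  have "(\<Sum>i\<in>insert j J. c' i * X i \<omega>) = \<alpha> * X j \<omega> + (\<Sum>i\<in>J. (c i - \<alpha> * e i) * X i \<omega>)" for \<omega>
  proof -
    have "(\<Sum>i\<in>J. c' i * X i \<omega>) = (\<Sum>i\<in>J. (c i - \<alpha> * e i) * X i \<omega>)"
      using insert.hyps(2) by (intro sum.cong) (auto simp: c'_def)
    then show ?thesis using insert.hyps by (simp add: c'_def)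
  qed
  then have "K \<omega> - (\<Sum>i\<in>insert j J. c' i * X i \<omega>) = N \<omega>" for \<omega>
    by (simp add: N_def K'_def r_def left_diff_distrib right_diff_distrib sum_subtractf sum_distrib_left mult.assoc)
  then show ?case using Nj NJ by (intro exI[of _ c']) auto
qed

end

context equilibrium
begin

section \<open>Shifts with prescribed values at the contact points\<close>

definition comb :: "(real \<Rightarrow> real) \<Rightarrow> 'w \<Rightarrow> real" where
  "comb c = (\<lambda>\<omega>. \<Sum>i\<in>P. c i * X i \<omega>)"

definition potential :: "(real \<Rightarrow> real) \<Rightarrow> real \<Rightarrow> real" where
  "potential c t = cov (X t) (comb c)"

lemma lin_comb: "lin (comb c)"
  unfolding comb_def by (rule lin_finite_sum[OF finite_P])

lemma potential_continuous: "continuous_on {a..b} (potential c)"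
  unfolding potential_def by (rule cov_continuous[OF lin_comb])

lemma potential_eq: "potential c t = (\<Sum>i\<in>P. c i * cov (X t) (X i))"
  unfolding potential_def comb_def by (rule cov_sum_right[OF finite_P lin_X lin_X])

text \<open>Take the residual of X k after projection on the other variables. It is uncorrelated
  with them, its covariance with X k is its own variance, and independence makes this variance
  nonzero, so it can be normalized.\<close>

lemma dual_basis:
  assumes k: "k \<in> P"
  shows "\<exists>c. \<forall>j\<in>P. potential c j = of_bool (j = k)"
proof -
  have fin: "finite (P - {k})" using finite_P by simp
  obtain e where e: "\<forall>i\<in>P - {k}. cov (\<lambda>\<omega>. X k \<omega> - (\<Sum>i\<in>P - {k}. e i * X i \<omega>)) (X i) = 0"
    using projection_exists[OF fin lin_X] by blast
  define d where "d = (\<lambda>i. if i = k then 1 else - e i)"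
  have comb_d: "comb d = (\<lambda>\<omega>. X k \<omega> - (\<Sum>i\<in>P - {k}. e i * X i \<omega>))"
  proof
    fix \<omega>
    have "(\<Sum>i\<in>P - {k}. d i * X i \<omega>) = (\<Sum>i\<in>P - {k}. - (e i * X i \<omega>))"
      by (intro sum.cong) (auto simp: d_def)
    then show "comb d \<omega> = X k \<omega> - (\<Sum>i\<in>P - {k}. e i * X i \<omega>)"
      unfolding comb_def using sum.remove[OF finite_P k, of "\<lambda>i. d i * X i \<omega>"]
      by (simp add: d_def sum_negf)
  qed
  have 0: "cov (comb d) (X i) = 0" if "i \<in> P" "i \<noteq> k" for i
    using e that by (simp add: comb_d)
  have "cov (comb d) (comb d) = (\<Sum>i\<in>P. d i * cov (comb d) (X i))"
    using cov_sum_right[OF finite_P lin_X lin_comb, where c=d] by (simp add: comb_def)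
  also have "\<dots> = d k * cov (comb d) (X k) + (\<Sum>i\<in>P - {k}. d i * cov (comb d) (X i))"
    by (rule sum.remove[OF finite_P k])
  also have "(\<Sum>i\<in>P - {k}. d i * cov (comb d) (X i)) = 0"
    using 0 by (intro sum.neutral) auto
  finally have kk: "cov (comb d) (X k) = cov (comb d) (comb d)" by (simp add: d_def)
  have nz: "cov (comb d) (comb d) \<noteq> 0"
  proof
    assume "cov (comb d) (comb d) = 0"
    then have "\<forall>i\<in>P. d i = 0" unfolding comb_def by (rule independent_P)
    then have "d k = 0" using k by blast
    then show False by (simp add: d_def)
  qed
  define c where "c = (\<lambda>i. d i / cov (comb d) (comb d))"
  have "comb c = (\<lambda>\<omega>. (1 / cov (comb d) (comb d)) * comb d \<omega>)"
    unfolding comb_def c_def by (simp add: sum_distrib_left)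
  then have "potential c j = cov (comb d) (X j) / cov (comb d) (comb d)" for j
    unfolding potential_def by (simp only: cov_scale_right cov_commute[of "X j"]) simp
  then show ?thesis using 0 kk nz by (intro exI[of _ c]) auto
qed

lemma interpolation: "\<exists>c. \<forall>j\<in>P. potential c j = x j"
proof -
  have "\<forall>k\<in>P. \<exists>c. \<forall>j\<in>P. potential c j = of_bool (j = k)" using dual_basis by blast
  then obtain e where e: "\<forall>k\<in>P. \<forall>j\<in>P. potential (e k) j = of_bool (j = k)"
    using bchoice[of P "\<lambda>k c. \<forall>j\<in>P. potential c j = of_bool (j = k)"] by blast
  define c where "c = (\<lambda>i. \<Sum>k\<in>P. x k * e k i)"
  have "potential c j = x j" if j: "j \<in> P" for j
  proof -
    have "potential c j = (\<Sum>i\<in>P. \<Sum>k\<in>P. x k * (e k i * cov (X j) (X i)))"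
      unfolding potential_eq c_def by (simp add: sum_distrib_right mult.assoc)
    also have "\<dots> = (\<Sum>k\<in>P. x k * potential (e k) j)"
      unfolding potential_eq by (subst sum.swap) (simp add: sum_distrib_left)
    also have "\<dots> = (\<Sum>k\<in>P. if k = j then x k else 0)"
      using e j by (intro sum.cong) auto
    also have "\<dots> = x j" using j finite_P by simp
    finally show ?thesis .
  qed
  then show ?thesis by blast
qed

text \<open>Both sides are \<open>cov Z (comb c) / v\<close>, expanded in the second argument on the
  left, where \<open>cov Z (X i) = v\<close>, and in the first on the right. The lemma expresses the
  limiting Cameron-Martin exponent through the prescribed heights of the shift.\<close>

lemma sum_coeff: "sum c P = (\<Sum>j\<in>P. \<theta> j * potential c j) / v"
proof -
  have XZ: "cov (X i) Z = v" if "i \<in> P" for i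
    using \<mu>_P[OF that] v_pos by (simp add: \<mu>_def)
  have "cov Z (comb c) = (\<Sum>j\<in>P. \<theta> j * potential c j)"
    unfolding Z_def potential_def by (rule cov_sum[OF finite_P lin_X lin_comb])
  moreover have "cov Z (comb c) = (\<Sum>i\<in>P. c i * cov Z (X i))"
    unfolding comb_def by (rule cov_sum_right[OF finite_P lin_X lin_Z])
  moreover have "(\<Sum>i\<in>P. c i * cov Z (X i)) = sum c P * v"
    using XZ by (simp add: cov_commute[of Z] sum_distrib_right)
  ultimately show ?thesis using v_pos by (simp add: field_simps)
qed

text \<open>At points of \<open>P\<close> the factor \<mu> is 1, so X i = Z + Y i. Each of the two
  terms contributes at most e u to the distance from u; the lower bound u - 1 for \<open>Z\<close>
  fits this because 1 \<le> e u.\<close>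

lemma comb_close:
  assumes \<omega>: "\<omega> \<in> concentrated e u" "u - 1 < Z \<omega>" and e: "1 \<le> e * u"
  shows "\<bar>comb c \<omega> - u * sum c P\<bar> \<le> 2 * e * u * (\<Sum>i\<in>P. \<bar>c i\<bar>)"
proof -
  have X: "\<bar>X i \<omega> - u\<bar> \<le> 2 * e * u" if i: "i \<in> P" for i
  proof -
    have "\<bar>Y i \<omega>\<bar> \<le> e * u" using P_subset i by (intro concentrated_Y[OF \<omega>(1)]) auto
    moreover have "X i \<omega> = Z \<omega> + Y i \<omega>" using X_eq[of i \<omega>] \<mu>_P[OF i] by simp
    moreover have "Z \<omega> \<le> u + e * u" using \<omega>(1) by (simp add: concentrated_def distrib_right)
    ultimately show ?thesis using \<omega>(2) e by linarith
  qed
  have "comb c \<omega> - u * sum c P = (\<Sum>i\<in>P. c i * (X i \<omega> - u))"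
    by (simp add: comb_def right_diff_distrib sum_subtractf sum_distrib_left mult.commute)
  also have "\<bar>\<dots>\<bar> \<le> (\<Sum>i\<in>P. \<bar>c i * (X i \<omega> - u)\<bar>)" by (rule sum_abs)
  also have "\<dots> \<le> (\<Sum>i\<in>P. 2 * e * u * \<bar>c i\<bar>)"
  proof (rule sum_mono)
    fix i assume "i \<in> P"
    then show "\<bar>c i * (X i \<omega> - u)\<bar> \<le> 2 * e * u * \<bar>c i\<bar>"
      unfolding abs_mult by (subst mult.commute) (intro mult_right_mono X abs_ge_zero)
  qed
  finally show ?thesis by (simp add: sum_distrib_left)
qed

text \<open>\<open>Z\<close> is a weighted mean of the variables X i, i in \<open>P\<close>, with
  total weight 1.\<close>

lemma Z_ge:
  assumes \<omega>: "\<omega> \<in> exceeds w" and m: "\<And>i. i \<in> P \<Longrightarrow> m \<le> w i"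
  shows "m \<le> Z \<omega>"
proof -
  have "m = (\<Sum>i\<in>P. \<theta> i * m)" using \<theta>_sum by (simp add: sum_distrib_right[symmetric])
  also have "\<dots> \<le> (\<Sum>i\<in>P. \<theta> i * X i \<omega>)"
  proof (intro sum_mono mult_left_mono \<theta>_nonneg)
    fix i assume i: "i \<in> P"
    then have "w i < X i \<omega>" using \<omega> P_subset by (auto simp: exceeds_def)
    then show "m \<le> X i \<omega>" using m[OF i] by simp
  qed
  finally show ?thesis by (simp add: Z_def)
qed

lemma eventually_Z_gt:
  "eventually (\<lambda>u. \<forall>\<omega>\<in>exceeds (\<lambda>t. u + potential c t / u). u - 1 < Z \<omega>) at_top"
proof -
  define K where "K = (\<Sum>i\<in>P. \<bar>potential c i\<bar>)"
  show ?thesis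
    using eventually_gt_at_top[of 1] eventually_gt_at_top[of K]
  proof eventually_elim
    case (elim u)
    have "u - K / u \<le> u + potential c i / u" if "i \<in> P" for i
    proof -
      have "\<bar>potential c i\<bar> \<le> K" unfolding K_def using finite_P that by (intro member_le_sum) auto
      then have "- K / u \<le> potential c i / u" using elim by (intro divide_right_mono) auto
      then show ?thesis by simp
    qed
    moreover have "K / u < 1" using elim by simp
    ultimately show ?case using Z_ge[of _ "\<lambda>t. u + potential c t / u" "u - K / u"] by fastforce
  qed
qed

lemma eventually_cov_small:
  assumes "0 < \<xi>" shows "eventually (\<lambda>u. cov (comb c) (comb c) / u\<^sup>2 / 2 \<le> \<xi>) at_top"
proof -
  have "((\<lambda>u. K / u\<^sup>2 / 2) \<longlongrightarrow> 0) at_top" for K :: real by real_asymp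
  then have "eventually (\<lambda>u. cov (comb c) (comb c) / u\<^sup>2 / 2 < \<xi>) at_top"
    by (rule order_tendstoD(2)) fact
  then show ?thesis by eventually_elim simp
qed

lemma eventually_large: "0 < e \<Longrightarrow> eventually (\<lambda>u::real. 1 \<le> e * u) at_top"
  by real_asymp

text \<open>Cameron-Martin with - comb c / u leads from the constant level to u + potential / u. On
  a concentrated path the density is at least exp (- s - 2 \<xi>), one \<xi> being for the deviation
  of comb c / u from s = sum c P and one for the variance term. The intersection with
  \<open>concentrated e u\<close> costs at most a small multiple of \<open>g u\<close>.\<close>

lemma shifted_lower:
  assumes e: "0 < e" and r: "0 \<le> r" "r < exp (- sum c P)"
  shows "eventually (\<lambda>u. r * g u \<le> prob (exceeds (\<lambda>t. u + potential c t / u) \<inter> concentrated e u)) at_top"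
proof -
  define s where "s = sum c P"
  have "((\<lambda>\<xi>. exp (- s - 2 * \<xi>)) \<longlongrightarrow> exp (- s)) (at_right 0)" by real_asymp
  then have "eventually (\<lambda>\<xi>. r < exp (- s - 2 * \<xi>)) (at_right 0)"
    by (rule order_tendstoD(1)) (use r in \<open>simp add: s_def\<close>)
  moreover have "eventually (\<lambda>\<xi>::real. 0 < \<xi>) (at_right 0)" by (rule eventually_at_right_less)
  ultimately have "eventually (\<lambda>\<xi>. 0 < \<xi> \<and> r < exp (- s - 2 * \<xi>)) (at_right 0)"
    by eventually_elim simp
  then obtain \<xi> where \<xi>: "0 < \<xi>" "r < exp (- s - 2 * \<xi>)"
    using eventually_happens'[OF trivial_limit_at_right_real] by blast
  define r1 where "r1 = exp (- s - 2 * \<xi>)"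
  have r1: "r < r1" "0 < r1" using \<xi> by (auto simp: r1_def)
  \<comment> \<open>Solves r1 (1 - \<tau>) - \<tau> = r: the loss \<tau> occurs once before the
    shift, where it is multiplied by \<open>r1\<close>, and once after it.\<close>
  define \<tau> where "\<tau> = (r1 - r) / (1 + r1)"
  have \<tau>: "0 < \<tau>" "\<tau> * (1 + r1) = r1 - r" using r1 by (auto simp: \<tau>_def)
  define A where "A = (\<Sum>i\<in>P. \<bar>c i\<bar>)"
  have A: "0 \<le> A" by (simp add: A_def sum_nonneg)
  \<comment> \<open>\<open>e0\<close> is the width at which the density is controlled; the width
    \<open>e\<close> of the conclusion is unrelated to it and arbitrary.\<close>
  define e0 where "e0 = \<xi> / (2 * (A + 1))"
  have e0: "0 < e0" using \<xi> A by (simp add: e0_def)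
  have e0A: "2 * e0 * A \<le> \<xi>"
  proof -
    have "\<xi> * A \<le> \<xi> * (A + 1)" using \<xi> by simp
    then show ?thesis using A \<xi>(1) by (simp add: e0_def pos_divide_le_eq algebra_simps)
  qed
  show ?thesis
    using concentration[OF e0 \<tau>(1)] concentration[OF e \<tau>(1)] eventually_gt_at_top[of 0]
      eventually_large[OF e0] eventually_cov_small[OF \<xi>(1), of c] eventually_Z_gt[of c]
  proof eventually_elim
    case (elim u)
    define L where "L = (\<lambda>\<omega>. (- 1 / u) * comb c \<omega>)"
    have L: "lin L" unfolding L_def by (rule lin_scale[OF lin_comb])
    have covXL: "cov (X t) L = - potential c t / u" for t
      unfolding L_def cov_scale_right potential_def by simp
    have covLL: "cov L L = cov (comb c) (comb c) / u\<^sup>2"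
      unfolding L_def cov_scale_right cov_scale by (simp add: power2_eq_square)
    have Z: "u - 1 < Z \<omega>" if "\<omega> \<in> exceeds (\<lambda>_. u)" for \<omega>
      using Z_ge[OF that, of u] by simp
    have m1: "exceeds (\<lambda>_. u) \<in> events" by (intro exceeds_measurable continuous_on_const)
    have cont: "continuous_on {a..b} (\<lambda>t. u + potential c t / u)"
      using elim(3) by (intro continuous_on_add continuous_on_const continuous_on_divide potential_continuous) auto
    have m2: "exceeds (\<lambda>t. u + potential c t / u) \<in> events" by (rule exceeds_measurable[OF cont])
    have "r1 * prob (exceeds (\<lambda>_. u) \<inter> concentrated e0 u) \<le> prob (exceeds (\<lambda>t. u - cov (X t) L))"
      unfolding r1_def
    proof (rule exceeds_shift_lower[OF continuous_on_const L concentrated_measurable])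
      fix \<omega> assume \<omega>: "\<omega> \<in> exceeds (\<lambda>_. u) \<inter> concentrated e0 u"
      have "\<bar>comb c \<omega> - u * s\<bar> \<le> 2 * e0 * u * A"
        unfolding s_def A_def using \<omega> Z elim(4) by (intro comb_close) auto
      also have "2 * e0 * u * A = (2 * e0 * A) * u" by simp
      also have "\<dots> \<le> \<xi> * u" using e0A elim(3) by (intro mult_right_mono) auto
      finally have "comb c \<omega> \<le> (s + \<xi>) * u" by (simp add: algebra_simps)
      then have "comb c \<omega> / u \<le> s + \<xi>" using elim(3) by (simp add: pos_divide_le_eq)
      then show "- s - 2 * \<xi> \<le> L \<omega> - cov L L / 2"
        using elim(5) unfolding covLL by (simp add: L_def)
    qed
    then have 1: "r1 * prob (exceeds (\<lambda>_. u) \<inter> concentrated e0 u) \<le> prob (exceeds (\<lambda>t. u + potential c t / u))"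
      by (simp add: covXL)
    have "g u \<le> prob ((exceeds (\<lambda>_. u) \<inter> concentrated e0 u) \<union> ({\<omega> \<in> space M. u - 1 < Z \<omega>} - concentrated e0 u))"
      using Z m1 by (intro finite_measure_mono) (auto simp: exceeds_def)
    also have "\<dots> \<le> prob (exceeds (\<lambda>_. u) \<inter> concentrated e0 u) + prob ({\<omega> \<in> space M. u - 1 < Z \<omega>} - concentrated e0 u)"
      using m1 by (intro measure_Un_le) auto
    finally have "(1 - \<tau>) * g u \<le> prob (exceeds (\<lambda>_. u) \<inter> concentrated e0 u)"
      using elim(1) by (simp add: algebra_simps)
    then have "r1 * ((1 - \<tau>) * g u) \<le> r1 * prob (exceeds (\<lambda>_. u) \<inter> concentrated e0 u)"
      using r1 by (intro mult_left_mono) auto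
    with 1 have 2: "r1 * ((1 - \<tau>) * g u) \<le> prob (exceeds (\<lambda>t. u + potential c t / u))" by linarith
    have "prob (exceeds (\<lambda>t. u + potential c t / u)) \<le>
        prob ((exceeds (\<lambda>t. u + potential c t / u) \<inter> concentrated e u) \<union> ({\<omega> \<in> space M. u - 1 < Z \<omega>} - concentrated e u))"
      using elim(6) m2 by (intro finite_measure_mono) (auto simp: exceeds_def)
    also have "\<dots> \<le> prob (exceeds (\<lambda>t. u + potential c t / u) \<inter> concentrated e u) + prob ({\<omega> \<in> space M. u - 1 < Z \<omega>} - concentrated e u)"
      using m2 by (intro measure_Un_le) auto
    finally have 3: "prob (exceeds (\<lambda>t. u + potential c t / u)) - \<tau> * g u \<le> prob (exceeds (\<lambda>t. u + potential c t / u) \<inter> concentrated e u)"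
      using elim(2) by linarith
    have "r * g u = r1 * ((1 - \<tau>) * g u) - \<tau> * g u"
    proof -
      have "r = r1 * (1 - \<tau>) - \<tau>" using \<tau>(2) by (simp add: algebra_simps)
      then show ?thesis by (metis left_diff_distrib mult.assoc)
    qed
    then show ?case using 2 3 by linarith
  qed
qed

text \<open>The opposite shift leads from u + potential / u back to u. Here the concentrated event
  in the conclusion is the one on which the density must be bounded, hence the threshold
  \<open>e0\<close> for its width.\<close>

lemma shifted_upper:
  assumes r: "exp (- sum c P) < r"
  shows "\<exists>e0>0. \<forall>e. 0 < e \<longrightarrow> e \<le> e0 \<longrightarrow>
    eventually (\<lambda>u. prob (exceeds (\<lambda>t. u + potential c t / u) \<inter> concentrated e u) \<le> r * g u) at_top"
proof -
  define s where "s = sum c P"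
  have "((\<lambda>\<xi>. exp (- s + 2 * \<xi>)) \<longlongrightarrow> exp (- s)) (at_right 0)" by real_asymp
  then have "eventually (\<lambda>\<xi>. exp (- s + 2 * \<xi>) < r) (at_right 0)"
    by (rule order_tendstoD(2)) (use r in \<open>simp add: s_def\<close>)
  moreover have "eventually (\<lambda>\<xi>::real. 0 < \<xi>) (at_right 0)" by (rule eventually_at_right_less)
  ultimately have "eventually (\<lambda>\<xi>. 0 < \<xi> \<and> exp (- s + 2 * \<xi>) < r) (at_right 0)"
    by eventually_elim simp
  then obtain \<xi> where \<xi>: "0 < \<xi>" "exp (- s + 2 * \<xi>) < r"
    using eventually_happens'[OF trivial_limit_at_right_real] by blast
  define A where "A = (\<Sum>i\<in>P. \<bar>c i\<bar>)"
  have A: "0 \<le> A" by (simp add: A_def sum_nonneg)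
  define e0 where "e0 = \<xi> / (2 * (A + 1))"
  have e0: "0 < e0" using \<xi> A by (simp add: e0_def)
  have e0A: "2 * e0 * A \<le> \<xi>"
  proof -
    have "\<xi> * A \<le> \<xi> * (A + 1)" using \<xi> by simp
    then show ?thesis using A \<xi>(1) by (simp add: e0_def pos_divide_le_eq algebra_simps)
  qed
  have "eventually (\<lambda>u. prob (exceeds (\<lambda>t. u + potential c t / u) \<inter> concentrated e u) \<le> r * g u) at_top"
    if e: "0 < e" "e \<le> e0" for e
    using eventually_gt_at_top[of 0]
      eventually_large[OF e(1)] eventually_cov_small[OF \<xi>(1), of c] eventually_Z_gt[of c]
  proof eventually_elim
    case (elim u)
    define L where "L = (\<lambda>\<omega>. (1 / u) * comb c \<omega>)"
    have L: "lin L" unfolding L_def by (rule lin_scale[OF lin_comb])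
    have covXL: "cov (X t) L = potential c t / u" for t
      unfolding L_def cov_scale_right potential_def by simp
    have covLL: "cov L L = cov (comb c) (comb c) / u\<^sup>2"
      unfolding L_def cov_scale_right cov_scale by (simp add: power2_eq_square)
    have cont: "continuous_on {a..b} (\<lambda>t. u + potential c t / u)"
      using elim(1) by (intro continuous_on_add continuous_on_const continuous_on_divide potential_continuous) auto
    have "exp (s - 2 * \<xi>) * prob (exceeds (\<lambda>t. u + potential c t / u) \<inter> concentrated e u) \<le>
        prob (exceeds (\<lambda>t. (u + potential c t / u) - cov (X t) L))"
    proof (rule exceeds_shift_lower[OF cont L concentrated_measurable])
      fix \<omega> assume \<omega>: "\<omega> \<in> exceeds (\<lambda>t. u + potential c t / u) \<inter> concentrated e u"
      have "\<bar>comb c \<omega> - u * s\<bar> \<le> 2 * e * u * A"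
        unfolding s_def A_def using \<omega> elim(2,4) by (intro comb_close) auto
      also have "2 * e * u * A = (2 * e * A) * u" by simp
      also have "\<dots> \<le> \<xi> * u"
      proof (rule mult_right_mono)
        have "2 * e * A \<le> 2 * e0 * A" using e A by (intro mult_right_mono) auto
        then show "2 * e * A \<le> \<xi>" using e0A by linarith
      qed (use elim(1) in simp)
      finally have "(s - \<xi>) * u \<le> comb c \<omega>" by (simp add: algebra_simps)
      then have "s - \<xi> \<le> comb c \<omega> / u" using elim(1) by (simp add: pos_le_divide_eq)
      then show "s - 2 * \<xi> \<le> L \<omega> - cov L L / 2"
        using elim(3) unfolding covLL by (simp add: L_def)
    qed
    then have "exp (s - 2 * \<xi>) * prob (exceeds (\<lambda>t. u + potential c t / u) \<inter> concentrated e u) \<le> g u"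
      by (simp add: covXL)
    then have "exp (- s + 2 * \<xi>) * (exp (s - 2 * \<xi>) * prob (exceeds (\<lambda>t. u + potential c t / u) \<inter> concentrated e u)) \<le>
        exp (- s + 2 * \<xi>) * g u"
      by (intro mult_left_mono) auto
    also have "\<dots> \<le> r * g u" using \<xi>(2) by (intro mult_right_mono) auto
    also have "exp (- s + 2 * \<xi>) * (exp (s - 2 * \<xi>) * prob (exceeds (\<lambda>t. u + potential c t / u) \<inter> concentrated e u)) =
        prob (exceeds (\<lambda>t. u + potential c t / u) \<inter> concentrated e u)"
      by (simp add: mult.assoc[symmetric] exp_add[symmetric])
    finally show ?case .
  qed
  then show ?thesis using e0 by blast
qed

text \<open>\<open>concentration\<close> read backwards: with e = 1 and \<tau> = 1 it bounds
  \<open>g u\<close> below by the probability of an event that contains Z > 2 u, and this event has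
  positive probability.\<close>

lemma eventually_g_pos: "eventually (\<lambda>u. 0 < g u) at_top"
proof -
  have "eventually (\<lambda>u. prob ({\<omega> \<in> space M. u - 1 < Z \<omega>} - concentrated 1 u) \<le> 1 * g u) at_top"
    by (rule concentration) simp_all
  then show ?thesis
  using eventually_gt_at_top[of 0]
proof eventually_elim
  case (elim u)
  have "0 < 1 / sqrt (2 * pi * cov Z Z) * exp (- ((1 + 1) * u + 1)\<^sup>2 / (2 * cov Z Z))"
    using v_pos by (simp add: v_def)
  also have "\<dots> \<le> prob {\<omega> \<in> space M. (1 + 1) * u < Z \<omega>}"
    using v_pos elim by (intro Gaussian_tail_lower lin_Z) (auto simp: v_def)
  also have "\<dots> \<le> prob ({\<omega> \<in> space M. u - 1 < Z \<omega>} - concentrated 1 u)"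
    using elim by (intro finite_measure_mono) (auto simp: concentrated_def)
  also have "\<dots> \<le> g u" using elim by simp
  finally show ?case .
qed
qed

end

section \<open>The location of the minimum\<close>

context smooth_gaussian_process
begin

definition argmin :: "'w \<Rightarrow> real" where
  "argmin \<omega> = leftmost_argmin a b (\<lambda>t. X t \<omega>)"

lemma argmin_props:
  assumes \<omega>: "\<omega> \<in> space M"
  shows "argmin \<omega> \<in> {a..b}" and "\<And>t. t \<in> {a..b} \<Longrightarrow> X (argmin \<omega>) \<omega> \<le> X t \<omega>"
    and "\<And>s. s \<in> {a..b} \<Longrightarrow> (\<And>t. t \<in> {a..b} \<Longrightarrow> X s \<omega> \<le> X t \<omega>) \<Longrightarrow> argmin \<omega> \<le> s"
proof -
  have cont: "continuous_on {a..b} (\<lambda>t. X t \<omega>)" by (rule path_continuous[OF \<omega>])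
  obtain m where m: "m \<in> {a..b}" "\<And>t. t \<in> {a..b} \<Longrightarrow> X m \<omega> \<le> X t \<omega>"
    using continuous_attains_inf[OF _ _ cont] ab by auto
  define A where "A = {t \<in> {a..b}. X t \<omega> = X m \<omega>}"
  have A_iff: "is_arg_min (\<lambda>t. X t \<omega>) (\<lambda>s. s \<in> {a..b}) t \<longleftrightarrow> t \<in> A" for t
    using m unfolding A_def is_arg_min_def
    by (smt (verit, best) mem_Collect_eq)
  have "closed A"
    unfolding A_def by (rule continuous_closed_preimage_constant[OF cont]) simp
  moreover have "A \<noteq> {}" using m by (auto simp: A_def)
  moreover have "bdd_below A" by (rule bdd_belowI[of _ a]) (auto simp: A_def)
  ultimately have InfA: "Inf A \<in> A" "\<And>t. t \<in> A \<Longrightarrow> Inf A \<le> t"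
    by (auto intro: closed_contains_Inf cInf_lower)
  have "argmin \<omega> = Inf A"
    unfolding argmin_def leftmost_argmin_def A_iff by (rule Least_equality) (use InfA in auto)
  then have T: "argmin \<omega> \<in> A" "\<And>t. t \<in> A \<Longrightarrow> argmin \<omega> \<le> t" using InfA by auto
  show "argmin \<omega> \<in> {a..b}" using T(1) by (simp add: A_def)
  show "X (argmin \<omega>) \<omega> \<le> X t \<omega>" if "t \<in> {a..b}" for t
    using T(1) m(2)[OF that] by (simp add: A_def)
  show "argmin \<omega> \<le> s" if "s \<in> {a..b}" "\<And>t. t \<in> {a..b} \<Longrightarrow> X s \<omega> \<le> X t \<omega>" for s
  proof (rule T(2))
    have "X s \<omega> = X m \<omega>" using that(2)[OF m(1)] m(2)[OF that(1)] by simp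
    then show "s \<in> A" using that(1) by (simp add: A_def)
  qed
qed

text \<open>The leftmost minimizer lies in [a,c] exactly when the minimum over [a,c] is the global
  one. The margin 1 / (n + 1) is needed because the infimum over dyadic points may not be
  attained.\<close>

lemma argmin_le_iff:
  assumes \<omega>: "\<omega> \<in> space M" and c: "c \<in> {a..b}"
  shows "argmin \<omega> \<le> c \<longleftrightarrow>
    (\<forall>s\<in>dyadic. \<forall>n. \<exists>t\<in>dyadic. t \<le> c \<and> X t \<omega> < X s \<omega> + inverse (real (Suc n)))"
proof
  assume le: "argmin \<omega> \<le> c"
  show "\<forall>s\<in>dyadic. \<forall>n. \<exists>t\<in>dyadic. t \<le> c \<and> X t \<omega> < X s \<omega> + inverse (real (Suc n))"
  proof (intro ballI allI)
    fix s n assume "s \<in> dyadic"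
    then have "X (argmin \<omega>) \<omega> \<le> X s \<omega>" using dyadic_subset by (intro argmin_props(2)[OF \<omega>]) auto
    moreover have "0 < inverse (real (Suc n))" by simp
    ultimately have lt: "X (argmin \<omega>) \<omega> < X s \<omega> + inverse (real (Suc n))" by linarith
    obtain r where r: "\<And>k. r k \<in> dyadic" "\<And>k. r k \<le> argmin \<omega>" "r \<longlonglongrightarrow> argmin \<omega>"
      by (rule dyadic_approx_left[OF argmin_props(1)[OF \<omega>]]) blast
    have "isCont (\<lambda>t. X t \<omega>) (argmin \<omega>)"
      using path_continuous[OF \<omega>, of UNIV] by (simp add: continuous_on_eq_continuous_at)
    then have "(\<lambda>k. X (r k) \<omega>) \<longlonglongrightarrow> X (argmin \<omega>) \<omega>"
      using r(3) by (rule isCont_tendsto_compose)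
    then have "eventually (\<lambda>k. X (r k) \<omega> < X s \<omega> + inverse (real (Suc n))) sequentially"
      using lt by (rule order_tendstoD(2))
    then obtain k where "X (r k) \<omega> < X s \<omega> + inverse (real (Suc n))"
      using eventually_happens'[OF sequentially_bot] by blast
    then show "\<exists>t\<in>dyadic. t \<le> c \<and> X t \<omega> < X s \<omega> + inverse (real (Suc n))"
      using r(1)[of k] r(2)[of k] le by (intro bexI[of _ "r k"]) auto
  qed
next
  assume *: "\<forall>s\<in>dyadic. \<forall>n. \<exists>t\<in>dyadic. t \<le> c \<and> X t \<omega> < X s \<omega> + inverse (real (Suc n))"
  have "continuous_on {a..c} (\<lambda>t. X t \<omega>)" by (rule path_continuous[OF \<omega>])
  then obtain m where m: "m \<in> {a..c}" "\<And>t. t \<in> {a..c} \<Longrightarrow> X m \<omega> \<le> X t \<omega>"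
    using continuous_attains_inf[of "{a..c}" "\<lambda>t. X t \<omega>"] c by auto
  have 1: "X m \<omega> \<le> X s \<omega>" if s: "s \<in> dyadic" for s
  proof (rule field_le_epsilon)
    fix e :: real assume "0 < e"
    then obtain n where n: "inverse (real (Suc n)) < e" using reals_Archimedean by blast
    obtain t where t: "t \<in> dyadic" "t \<le> c" "X t \<omega> < X s \<omega> + inverse (real (Suc n))"
      using * s by blast
    have "X m \<omega> \<le> X t \<omega>" using t dyadic_subset by (intro m(2)) auto
    then show "X m \<omega> \<le> X s \<omega> + e" using t(3) n by linarith
  qed
  have "X m \<omega> \<le> X s \<omega>" if "s \<in> {a..b}" for s
    by (rule dyadic_dense[OF path_continuous[OF \<omega>] _ that]) (rule 1)
  moreover have "m \<in> {a..b}" using m(1) c by auto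
  ultimately have "argmin \<omega> \<le> m" by (intro argmin_props(3)[OF \<omega>]) auto
  then show "argmin \<omega> \<le> c" using m(1) by simp
qed

lemma argmin_measurable[measurable]: "argmin \<in> borel_measurable M"
proof (rule borel_measurableI_le)
  fix c
  consider "c < a" | "c \<in> {a..b}" | "b < c" by fastforce
  then show "{\<omega> \<in> space M. argmin \<omega> \<le> c} \<in> events"
  proof cases
    case 1
    then have "{\<omega> \<in> space M. argmin \<omega> \<le> c} = {}" using argmin_props(1) by fastforce
    then show ?thesis by (simp only: sets.empty_sets)
  next
    case 2
    have "{\<omega> \<in> space M. argmin \<omega> \<le> c} = {\<omega> \<in> space M. \<forall>s\<in>dyadic. \<forall>n. \<exists>t\<in>dyadic. t \<le> c \<and> X t \<omega> < X s \<omega> + inverse (real (Suc n))}"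
      by (rule Collect_cong, rule conj_cong[OF refl], rule argmin_le_iff[OF _ 2])
    also have "\<dots> \<in> events" by measurable
    finally show ?thesis .
  next
    case 3
    then have "{\<omega> \<in> space M. argmin \<omega> \<le> c} = space M" using argmin_props(1) by fastforce
    then show ?thesis by (simp only: sets.top)
  qed
qed

end

context equilibrium
begin

section \<open>Minima near a contact point\<close>

definition near :: "real \<Rightarrow> real \<Rightarrow> real \<Rightarrow> 'w set" where
  "near j e u = {\<omega> \<in> exceeds (\<lambda>_. u). \<bar>argmin \<omega> - j\<bar> < e}"

lemma near_measurable: "near j e u \<in> events"
proof -
  have "exceeds (\<lambda>_. u) \<in> events" by (intro exceeds_measurable continuous_on_const)
  moreover have "{\<omega> \<in> space M. \<bar>argmin \<omega> - j\<bar> < e} \<in> events" by measurable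
  moreover have "near j e u = exceeds (\<lambda>_. u) \<inter> {\<omega> \<in> space M. \<bar>argmin \<omega> - j\<bar> < e}"
    by (auto simp: near_def exceeds_def)
  ultimately show ?thesis by simp
qed

lemma \<mu>_away:
  assumes \<rho>: "0 < \<rho>"
  shows "\<exists>\<delta>>0. \<forall>t\<in>{a..b}. (\<forall>i\<in>P. \<rho> \<le> \<bar>t - i\<bar>) \<longrightarrow> 1 + \<delta> \<le> \<mu> t"
proof -
  define K where "K = {a..b} - (\<Union>i\<in>P. ball i \<rho>)"
  have K: "t \<in> K \<longleftrightarrow> t \<in> {a..b} \<and> (\<forall>i\<in>P. \<rho> \<le> \<bar>t - i\<bar>)" for t
    by (auto simp: K_def dist_real_def abs_minus_commute not_less)
  show ?thesis
  proof (cases "K = {}")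
    case True
    then have "1 + 1 \<le> \<mu> t" if "t \<in> {a..b}" "\<forall>i\<in>P. \<rho> \<le> \<bar>t - i\<bar>" for t
      using K[of t] that by blast
    then show ?thesis by (intro exI[of _ 1]) simp
  next
    case False
    have "compact K" unfolding K_def by (intro compact_diff compact_Icc open_UN) auto
    moreover have "continuous_on K \<mu>"
      by (rule continuous_on_subset[OF \<mu>_continuous]) (auto simp: K_def)
    ultimately obtain m where m: "m \<in> K" "\<And>t. t \<in> K \<Longrightarrow> \<mu> m \<le> \<mu> t"
      using continuous_attains_inf[of K \<mu>] False by auto
    have "m \<notin> P" using m(1) K \<rho> by force
    then have "1 < \<mu> m" using \<mu>_ge[of m] \<mu>_eq_1_iff[of m] m(1) K by force
    then show ?thesis using m(2) K by (intro exI[of _ "\<mu> m - 1"]) auto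
  qed
qed

lemma potential_uniform:
  assumes "0 < \<eta>"
  shows "\<exists>\<rho>>0. \<forall>s\<in>{a..b}. \<forall>t\<in>{a..b}. \<bar>t - s\<bar> < \<rho> \<longrightarrow> \<bar>potential c t - potential c s\<bar> < \<eta>"
proof -
  have "uniformly_continuous_on {a..b} (potential c)"
    by (rule compact_uniformly_continuous[OF potential_continuous]) simp
  then show ?thesis using assms unfolding uniformly_continuous_on_def dist_real_def by meson
qed

lemma potential_bounded: "\<exists>H. \<forall>t\<in>{a..b}. \<bar>potential c t\<bar> \<le> H"
proof -
  have "compact (potential c ` {a..b})" by (rule compact_continuous_image[OF potential_continuous]) simp
  then have "bounded (potential c ` {a..b})" by (rule compact_imp_bounded)
  then show ?thesis by (auto simp: bounded_iff)
qed

text \<open>Where \<mu> \<ge> 1 + \<delta> the drift exceeds the level by about \<delta> u.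
  Fluctuations of size \<delta> u / 4 leave three quarters of this, which eventually beats any
  constant \<open>H\<close>.\<close>

lemma far_above:
  assumes \<delta>: "0 < \<delta>" and e: "0 < e" "e \<le> \<delta> / 4"
  shows "eventually (\<lambda>u. \<forall>\<omega> t. \<omega> \<in> concentrated e u \<longrightarrow> u - 1 < Z \<omega> \<longrightarrow> t \<in> {a..b} \<longrightarrow> 1 + \<delta> \<le> \<mu> t \<longrightarrow> u + H < X t \<omega>) at_top"
  using eventually_gt_at_top[of 1] eventually_gt_at_top[of "(1 + \<delta> + H) / (\<delta> * 3 / 4)"]
proof eventually_elim
  case (elim u)
  have big: "1 + \<delta> + H < u * (\<delta> * 3 / 4)"
    using elim(2) \<delta> by (simp only: pos_divide_less_eq)
  show ?case
  proof (intro allI impI)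
    fix \<omega> t assume *: "\<omega> \<in> concentrated e u" "u - 1 < Z \<omega>" "t \<in> {a..b}" "1 + \<delta> \<le> \<mu> t"
    have "(1 + \<delta>) * (u - 1) \<le> \<mu> t * Z \<omega>"
      using * \<delta> elim(1) by (intro mult_mono) auto
    moreover have "\<bar>Y t \<omega>\<bar> \<le> e * u" by (rule concentrated_Y[OF *(1,3)])
    moreover have "e * u \<le> \<delta> / 4 * u" using e elim(1) by (intro mult_right_mono) auto
    moreover have "(1 + \<delta>) * (u - 1) - \<delta> / 4 * u = u + u * (\<delta> * 3 / 4) - 1 - \<delta>" by (simp add: algebra_simps)
    ultimately show "u + H < X t \<omega>" using big by (simp add: X_eq[of t])
  qed
qed

text \<open>Let \<open>h\<close> interpolate \<open>\<eta>\<close> at \<open>j\<close> and \<open>d\<close> elsewhere in \<open>P\<close>, and let \<open>h'\<close> interpolate \<open>d - 2 * \<eta>\<close>.  Up to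
  events of smaller order, exceeding \<open>u + h / u\<close> but not \<open>u + h' / u\<close> forces the minimum to lie between
  \<open>u\<close> and \<open>u + d / u\<close> and to be attained near \<open>j\<close>; paths whose minimum exceeds \<open>u + d / u\<close> are
  accounted for by the hypothesis at that level.\<close>

lemma near_step:
  assumes j: "j \<in> P" and e: "0 < e" and d: "0 < d" and \<eta>: "0 < \<eta>" "4 * \<eta> < d" and r: "0 \<le> r"
    and ev: "eventually (\<lambda>u. r * g u \<le> prob (near j e u)) at_top" and \<xi>: "0 < \<xi>"
  shows "eventually (\<lambda>u. (exp (- (\<eta> * \<theta> j + d * (1 - \<theta> j)) / v) - exp (- (d - 2 * \<eta>) / v) +
    r * exp (- (d + \<eta>) / v) - \<xi>) * g u \<le> prob (near j e u)) at_top"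
proof -
  \<comment> \<open>The value \<eta> at \<open>j\<close>, instead of 0, keeps this potential
    positive in a neighbourhood of \<open>j\<close>, so that exceeding u + potential / u still means
    exceeding u there.\<close>
  obtain cx where cx: "\<forall>i\<in>P. potential cx i = (if i = j then \<eta> else d)" using interpolation[of "\<lambda>i. if i = j then \<eta> else d"] by blast
  \<comment> \<open>The margin 2 \<eta> absorbs an oscillation \<eta>: near \<open>P\<close> this
    potential stays below d - \<eta>, while that of \<open>cx\<close> stays above d - \<eta> near
    the points other than \<open>j\<close>. A minimum below the former level can therefore only be
    near \<open>j\<close>.\<close>
  obtain cy where cy: "\<forall>i\<in>P. potential cy i = d - 2 * \<eta>" using interpolation[of "\<lambda>_. d - 2 * \<eta>"] by blast
  \<comment> \<open>Near \<open>P\<close> this potential exceeds d, so its exceedance forces the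
    constant level u + d / u. This bounds \<open>g (u + d / u)\<close> below by a multiple of
    \<open>g u\<close>.\<close>
  obtain cw where cw: "\<forall>i\<in>P. potential cw i = d + \<eta>" using interpolation[of "\<lambda>_. d + \<eta>"] by blast
  have \<theta>_rest: "sum \<theta> (P - {j}) = 1 - \<theta> j" using \<theta>_sum sum.remove[OF finite_P j, of \<theta>] by simp
  have sx: "sum cx P = (\<eta> * \<theta> j + d * (1 - \<theta> j)) / v"
  proof -
    have "(\<Sum>i\<in>P. \<theta> i * potential cx i) = \<theta> j * potential cx j + (\<Sum>i\<in>P - {j}. \<theta> i * potential cx i)"
      by (rule sum.remove[OF finite_P j])
    also have "(\<Sum>i\<in>P - {j}. \<theta> i * potential cx i) = (\<Sum>i\<in>P - {j}. \<theta> i * d)"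
      using cx by (intro sum.cong) auto
    also have "\<dots> = (1 - \<theta> j) * d" by (simp add: \<theta>_rest[symmetric] sum_distrib_right)
    finally show ?thesis using cx j unfolding sum_coeff[of cx] by (simp add: mult.commute)
  qed
  have sy: "sum cy P = (d - 2 * \<eta>) / v" unfolding sum_coeff[of cy]
    using cy \<theta>_sum by (simp add: sum_distrib_right[symmetric])
  have sw: "sum cw P = (d + \<eta>) / v" unfolding sum_coeff[of cw]
    using cw \<theta>_sum by (simp add: sum_distrib_right[symmetric])
  have n: "- sum cx P = - (\<eta> * \<theta> j + d * (1 - \<theta> j)) / v" "- sum cy P = - (d - 2 * \<eta>) / v"
    "- sum cw P = - (d + \<eta>) / v"
    unfolding sx sy sw by (rule minus_divide_left)+
  obtain \<rho>x where \<rho>x: "0 < \<rho>x" "\<forall>s\<in>{a..b}. \<forall>t\<in>{a..b}. \<bar>t - s\<bar> < \<rho>x \<longrightarrow> \<bar>potential cx t - potential cx s\<bar> < \<eta>"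
    using potential_uniform[OF \<eta>(1)] by blast
  obtain \<rho>y where \<rho>y: "0 < \<rho>y" "\<forall>s\<in>{a..b}. \<forall>t\<in>{a..b}. \<bar>t - s\<bar> < \<rho>y \<longrightarrow> \<bar>potential cy t - potential cy s\<bar> < \<eta>"
    using potential_uniform[OF \<eta>(1)] by blast
  obtain \<rho>w where \<rho>w: "0 < \<rho>w" "\<forall>s\<in>{a..b}. \<forall>t\<in>{a..b}. \<bar>t - s\<bar> < \<rho>w \<longrightarrow> \<bar>potential cw t - potential cw s\<bar> < \<eta>"
    using potential_uniform[OF \<eta>(1)] by blast
  define \<rho> where "\<rho> = min e (min \<rho>x (min \<rho>y \<rho>w))"
  have \<rho>: "0 < \<rho>" "\<rho> \<le> e" "\<rho> \<le> \<rho>x" "\<rho> \<le> \<rho>y" "\<rho> \<le> \<rho>w" using e \<rho>x \<rho>y \<rho>w by (auto simp: \<rho>_def)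
  have close: "\<bar>potential cx t - potential cx i\<bar> < \<eta>" "\<bar>potential cy t - (d - 2 * \<eta>)\<bar> < \<eta>" "\<bar>potential cw t - (d + \<eta>)\<bar> < \<eta>"
    if "i \<in> P" "t \<in> {a..b}" "\<bar>t - i\<bar> < \<rho>" for i t
  proof -
    have i: "i \<in> {a..b}" using that(1) P_subset by blast
    have lt: "\<bar>t - i\<bar> < \<rho>x" "\<bar>t - i\<bar> < \<rho>y" "\<bar>t - i\<bar> < \<rho>w" using that(3) \<rho> by linarith+
    show "\<bar>potential cx t - potential cx i\<bar> < \<eta>" using \<rho>x(2) i that(2) lt(1) by blast
    have "\<bar>potential cy t - potential cy i\<bar> < \<eta>" using \<rho>y(2) i that(2) lt(2) by blast
    then show "\<bar>potential cy t - (d - 2 * \<eta>)\<bar> < \<eta>" using cy that(1) by simp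
    have "\<bar>potential cw t - potential cw i\<bar> < \<eta>" using \<rho>w(2) i that(2) lt(3) by blast
    then show "\<bar>potential cw t - (d + \<eta>)\<bar> < \<eta>" using cw that(1) by simp
  qed
  obtain \<delta> where \<delta>: "0 < \<delta>" "\<forall>t\<in>{a..b}. (\<forall>i\<in>P. \<rho> \<le> \<bar>t - i\<bar>) \<longrightarrow> 1 + \<delta> \<le> \<mu> t"
    using \<mu>_away[OF \<rho>(1)] by blast
  obtain H0 where H0: "\<forall>t\<in>{a..b}. \<bar>potential cy t\<bar> \<le> H0" using potential_bounded by blast
  \<comment> \<open>For u \<ge> 1 the constant \<open>H\<close> dominates both d / u and the
    potential of \<open>cy\<close> divided by u, so points far from \<open>P\<close> play no part in
    either comparison.\<close>
  define H where "H = \<bar>H0\<bar> + d"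
  have sy': "exp (- sum cy P) < exp (- (d - 2 * \<eta>) / v) + \<xi> / 3" unfolding n using \<xi> by simp
  obtain e0 where e0: "0 < e0" "\<forall>\<epsilon>. 0 < \<epsilon> \<longrightarrow> \<epsilon> \<le> e0 \<longrightarrow>
    eventually (\<lambda>u. prob (exceeds (\<lambda>t. u + potential cy t / u) \<inter> concentrated \<epsilon> u) \<le> (exp (- (d - 2 * \<eta>) / v) + \<xi> / 3) * g u) at_top"
    using shifted_upper[OF sy'] by blast
  define \<epsilon> where "\<epsilon> = min e0 (\<delta> / 4)"
  have \<epsilon>: "0 < \<epsilon>" "\<epsilon> \<le> e0" "\<epsilon> \<le> \<delta> / 4" using e0 \<delta> by (auto simp: \<epsilon>_def)
  have ev2: "eventually (\<lambda>u. prob (exceeds (\<lambda>t. u + potential cy t / u) \<inter> concentrated \<epsilon> u) \<le> (exp (- (d - 2 * \<eta>) / v) + \<xi> / 3) * g u) at_top"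
    using e0(2) \<epsilon> by blast
  have ev1: "eventually (\<lambda>u. max 0 (exp (- (\<eta> * \<theta> j + d * (1 - \<theta> j)) / v) - \<xi> / 3) * g u \<le>
      prob (exceeds (\<lambda>t. u + potential cx t / u) \<inter> concentrated \<epsilon> u)) at_top"
  proof (rule shifted_lower[OF \<epsilon>(1)])
    show "max 0 (exp (- (\<eta> * \<theta> j + d * (1 - \<theta> j)) / v) - \<xi> / 3) < exp (- sum cx P)"
      unfolding n using \<xi> by simp
  qed simp
  \<comment> \<open>The allowance \<xi> is divided among three estimates. The third error is later
    multiplied by r, whence the factor r + 1.\<close>
  define \<xi>' where "\<xi>' = \<xi> / (3 * (r + 1))"
  have \<xi>': "0 < \<xi>'" "r * \<xi>' \<le> \<xi> / 3"
  proof -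
    show "0 < \<xi>'" using \<xi> r by (simp add: \<xi>'_def)
    have "r * \<xi> \<le> (r + 1) * \<xi>" using \<xi> by simp
    then show "r * \<xi>' \<le> \<xi> / 3" using r by (simp add: \<xi>'_def field_simps)
  qed
  have ev3: "eventually (\<lambda>u. max 0 (exp (- (d + \<eta>) / v) - \<xi>') * g u \<le>
      prob (exceeds (\<lambda>t. u + potential cw t / u) \<inter> concentrated \<epsilon> u)) at_top"
  proof (rule shifted_lower[OF \<epsilon>(1)])
    show "max 0 (exp (- (d + \<eta>) / v) - \<xi>') < exp (- sum cw P)"
      unfolding n using \<xi>' by simp
  qed simp
  have "filterlim (\<lambda>u::real. u + d / u) at_top at_top" by real_asymp
  then have ev4: "eventually (\<lambda>u. r * g (u + d / u) \<le> prob (near j e (u + d / u))) at_top"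
    using ev by (rule eventually_compose_filterlim[rotated])
  show ?thesis
    using ev1 ev2 ev3 ev4 far_above[OF \<delta>(1) \<epsilon>(1,3), of H]
      eventually_Z_gt[of cx] eventually_Z_gt[of cw] eventually_ge_at_top[of 1]
  proof eventually_elim
    case (elim u)
    have u: "1 \<le> u" "0 < u" using elim(8) by auto
    define E1 where "E1 = exceeds (\<lambda>t. u + potential cx t / u) \<inter> concentrated \<epsilon> u"
    define E2 where "E2 = exceeds (\<lambda>t. u + potential cy t / u) \<inter> concentrated \<epsilon> u"
    define E3 where "E3 = exceeds (\<lambda>t. u + potential cw t / u) \<inter> concentrated \<epsilon> u"
    define u' where "u' = u + d / u"
    have u': "u < u'" using d u by (simp add: u'_def)
    have m0: "exceeds (\<lambda>_. x) \<in> events" for x by (intro exceeds_measurable continuous_on_const)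
    have m: "exceeds (\<lambda>t. u + potential c t / u) \<inter> concentrated \<epsilon> u \<in> events" for c
      using u by (intro sets.Int exceeds_measurable concentrated_measurable continuous_on_add continuous_on_const continuous_on_divide potential_continuous) auto
    have m': "E1 \<in> events" "E2 \<in> events" "E3 \<in> events" unfolding E1_def E2_def E3_def by (rule m)+
    have mono_u: "x / u \<le> y / u" if "x \<le> y" for x y using that u by (simp add: divide_right_mono)
    have mono_u': "x / u < y / u" if "x < y" for x y using that u by (simp add: divide_strict_right_mono)
    have bound_u: "x / u \<le> x" if "0 \<le> x" for x
      using that u mult_left_mono[of 1 u x] by (simp add: pos_divide_le_eq)
    have far: "u + H < X t \<omega>" if "\<omega> \<in> concentrated \<epsilon> u" "u - 1 < Z \<omega>" "t \<in> {a..b}" "\<forall>i\<in>P. \<rho> \<le> \<bar>t - i\<bar>" for \<omega> t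
      using elim(5) that \<delta>(2) by blast
    have Hd: "d / u \<le> H" "potential cy t / u \<le> H" if "t \<in> {a..b}" for t
    proof -
      show "d / u \<le> H" using bound_u[of d] d by (simp add: H_def)
      have "potential cy t / u \<le> \<bar>H0\<bar> / u" using H0 that by (intro mono_u) fastforce
      then show "potential cy t / u \<le> H" using bound_u[of "\<bar>H0\<bar>"] d by (simp add: H_def)
    qed
    have E1: "\<omega> \<in> near j e u - exceeds (\<lambda>_. u')" if \<omega>: "\<omega> \<in> E1 - E2" for \<omega>
    proof -
      have sp: "\<omega> \<in> space M" and concentrated: "\<omega> \<in> concentrated \<epsilon> u" and ex: "\<And>t. t \<in> {a..b} \<Longrightarrow> u + potential cx t / u < X t \<omega>"
        using \<omega> by (auto simp: E1_def exceeds_def)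
      have Zgt: "u - 1 < Z \<omega>" using elim(6) \<omega> by (auto simp: E1_def)
      have above: "u < X t \<omega>" if t: "t \<in> {a..b}" for t
      proof (cases "\<forall>i\<in>P. \<rho> \<le> \<bar>t - i\<bar>")
        case True
        then show ?thesis using far[OF concentrated Zgt t] Hd(1)[OF t] u d by (smt (verit) divide_pos_pos)
      next
        case False
        then obtain i where i: "i \<in> P" "\<bar>t - i\<bar> < \<rho>" by (auto simp: not_le)
        have "0 < potential cx t" using close(1)[OF i(1) t i(2)] cx i(1) \<eta> by (auto split: if_splits)
        then have "0 < potential cx t / u" using u by simp
        then show ?thesis using ex[OF t] by linarith
      qed
      obtain t where t: "t \<in> {a..b}" "X t \<omega> \<le> u + potential cy t / u"
        using \<omega> concentrated sp by (auto simp: E2_def exceeds_def not_less)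
      have "\<not> (\<forall>i\<in>P. \<rho> \<le> \<bar>t - i\<bar>)" using far[OF concentrated Zgt t(1)] Hd(2)[OF t(1)] t(2) by linarith
      then obtain i where i: "i \<in> P" "\<bar>t - i\<bar> < \<rho>" by (auto simp: not_le)
      have "potential cy t / u \<le> (d - \<eta>) / u" using close(2)[OF i(1) t(1) i(2)] by (intro mono_u) linarith
      then have Xt: "X t \<omega> \<le> u + (d - \<eta>) / u" using t(2) by linarith
      define T where "T = argmin \<omega>"
      have T: "T \<in> {a..b}" "X T \<omega> \<le> X t \<omega>" using argmin_props(1,2)[OF sp] t(1) by (auto simp: T_def)
      have lt: "(d - \<eta>) / u < d / u" using \<eta> by (intro mono_u') simp
      have "\<not> (\<forall>i\<in>P. \<rho> \<le> \<bar>T - i\<bar>)"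
        using far[OF concentrated Zgt T(1)] Hd(1)[OF T(1)] T(2) Xt lt by linarith
      then obtain k where k: "k \<in> P" "\<bar>T - k\<bar> < \<rho>" by (auto simp: not_le)
      have "k = j"
      proof (rule ccontr)
        assume "k \<noteq> j"
        then have "d - \<eta> \<le> potential cx T" using close(1)[OF k(1) T(1) k(2)] cx k(1) by auto
        then have "(d - \<eta>) / u \<le> potential cx T / u" by (rule mono_u)
        then show False using ex[OF T(1)] T(2) Xt by linarith
      qed
      then have "\<bar>argmin \<omega> - j\<bar> < e" using k(2) \<rho>(2) by (simp add: T_def)
      then have "\<omega> \<in> near j e u" using above sp by (simp add: near_def exceeds_def)
      moreover have "\<not> u' < X t \<omega>" using Xt lt by (simp add: u'_def)
      then have "\<omega> \<notin> exceeds (\<lambda>_. u')" using t(1) by (auto simp: exceeds_def)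
      ultimately show ?thesis by simp
    qed
    have E3: "\<omega> \<in> exceeds (\<lambda>_. u')" if \<omega>: "\<omega> \<in> E3" for \<omega>
    proof -
      have sp: "\<omega> \<in> space M" and concentrated: "\<omega> \<in> concentrated \<epsilon> u" and ex: "\<And>t. t \<in> {a..b} \<Longrightarrow> u + potential cw t / u < X t \<omega>"
        using \<omega> by (auto simp: E3_def exceeds_def)
      have Zgt: "u - 1 < Z \<omega>" using elim(7) \<omega> by (auto simp: E3_def)
      have "u' < X t \<omega>" if t: "t \<in> {a..b}" for t
      proof (cases "\<forall>i\<in>P. \<rho> \<le> \<bar>t - i\<bar>")
        case True
        then show ?thesis using far[OF concentrated Zgt t] Hd(1)[OF t] by (simp add: u'_def)
      next
        case False
        then obtain i where i: "i \<in> P" "\<bar>t - i\<bar> < \<rho>" by (auto simp: not_le)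
        have "d / u \<le> potential cw t / u" using close(3)[OF i(1) t i(2)] by (intro mono_u) linarith
        then show ?thesis using ex[OF t] by (simp add: u'_def)
      qed
      then show ?thesis using sp by (simp add: exceeds_def)
    qed
    have "near j e u' \<subseteq> near j e u \<inter> exceeds (\<lambda>_. u')"
      using u' by (force simp: near_def exceeds_def)
    then have sub: "(E1 - E2) \<union> near j e u' \<subseteq> near j e u" and disj: "(E1 - E2) \<inter> near j e u' = {}"
      using E1 by blast+
    have "prob (E1 - E2) + prob (near j e u') = prob ((E1 - E2) \<union> near j e u')"
      by (rule finite_measure_Union[symmetric]) (use m' near_measurable disj in auto)
    also have "\<dots> \<le> prob (near j e u)"
      by (rule finite_measure_mono[OF sub near_measurable])
    finally have 1: "prob (E1 - E2) + prob (near j e u') \<le> prob (near j e u)" .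
    have "prob E1 \<le> prob ((E1 - E2) \<union> E2)" using m' by (intro finite_measure_mono) auto
    also have "\<dots> \<le> prob (E1 - E2) + prob E2" using m' by (intro measure_Un_le) auto
    finally have 2: "prob E1 - prob E2 \<le> prob (E1 - E2)" by simp
    have 3: "prob E3 \<le> g u'" using E3 m0 by (intro finite_measure_mono) auto
    have g0: "0 \<le> g u" by simp
    have "(exp (- (\<eta> * \<theta> j + d * (1 - \<theta> j)) / v) - \<xi> / 3) * g u \<le> max 0 (exp (- (\<eta> * \<theta> j + d * (1 - \<theta> j)) / v) - \<xi> / 3) * g u"
      using g0 by (intro mult_right_mono) auto
    then have 4: "(exp (- (\<eta> * \<theta> j + d * (1 - \<theta> j)) / v) - \<xi> / 3) * g u \<le> prob E1"
      using elim(1) by (simp add: E1_def)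
    have 5: "prob E2 \<le> (exp (- (d - 2 * \<eta>) / v) + \<xi> / 3) * g u" using elim(2) by (simp add: E2_def)
    have "(exp (- (d + \<eta>) / v) - \<xi>') * g u \<le> max 0 (exp (- (d + \<eta>) / v) - \<xi>') * g u"
      using g0 by (intro mult_right_mono) auto
    then have "(exp (- (d + \<eta>) / v) - \<xi>') * g u \<le> g u'" using elim(3) 3 by (simp add: E3_def)
    then have "r * ((exp (- (d + \<eta>) / v) - \<xi>') * g u) \<le> r * g u'" using r by (intro mult_left_mono)
    also have "\<dots> \<le> prob (near j e u')" using elim(4) by (simp add: u'_def)
    finally have 6: "r * ((exp (- (d + \<eta>) / v) - \<xi>') * g u) \<le> prob (near j e u')" .
    have "(r * \<xi>') * g u \<le> \<xi> / 3 * g u" using \<xi>'(2) g0 by (rule mult_right_mono)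
    then show ?case using 1 2 4 5 6 by (simp add: algebra_simps)
  qed
qed

text \<open>The supremum of the admissible \<open>r\<close> in the previous lemma satisfies a fixed-point inequality, which
  gives \<open>\<theta> j\<close> in the limit \<open>\<eta> \<rightarrow> 0\<close> and then \<open>d \<rightarrow> 0\<close>.\<close>

theorem near_lower:
  assumes j: "j \<in> P" and e: "0 < e" and r: "r < \<theta> j"
  shows "eventually (\<lambda>u. r * g u \<le> prob (near j e u)) at_top"
proof -
  define R where "R = {r. 0 \<le> r \<and> eventually (\<lambda>u. r * g u \<le> prob (near j e u)) at_top}"
  have R0: "0 \<in> R" by (simp add: R_def)
  have R1: "r \<le> 1" if "r \<in> R" for r
  proof -
    have "eventually (\<lambda>u. r * g u \<le> prob (near j e u)) at_top" using that by (simp add: R_def)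
    then have "eventually (\<lambda>u::real. r \<le> 1) at_top"
      using eventually_g_pos
    proof eventually_elim
      case (elim u)
      have "prob (near j e u) \<le> g u"
        by (intro finite_measure_mono exceeds_measurable continuous_on_const) (auto simp: near_def)
      then have "r * g u \<le> 1 * g u" using elim(1) by simp
      then show ?case using elim(2) by (simp only: mult_le_cancel_right_pos)
    qed
    then show ?thesis by simp
  qed
  define s where "s = Sup R"
  have bdd: "bdd_above R" using R1 by (rule bdd_aboveI)
  have le_s: "r \<le> s" if "r \<in> R" for r unfolding s_def using that bdd by (rule cSup_upper)
  have s0: "0 \<le> s" using le_s[OF R0] .
  define f where "f = (\<lambda>d \<eta>. exp (- (\<eta> * \<theta> j + d * (1 - \<theta> j)) / v) - exp (- (d - 2 * \<eta>) / v))"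
  have step: "f d \<eta> + r * exp (- (d + \<eta>) / v) \<le> s"
    if d: "0 < d" "0 < \<eta>" "4 * \<eta> < d" and rR: "r \<in> R" for d \<eta> r
  proof (rule field_le_epsilon)
    fix \<xi> :: real assume \<xi>: "0 < \<xi>"
    have "eventually (\<lambda>u. (f d \<eta> + r * exp (- (d + \<eta>) / v) - \<xi>) * g u \<le> prob (near j e u)) at_top"
      unfolding f_def by (rule near_step[OF j e d]) (use rR \<xi> in \<open>auto simp: R_def\<close>)
    then have "f d \<eta> + r * exp (- (d + \<eta>) / v) - \<xi> \<le> s"
    \<comment> \<open>A negative coefficient is no element of \<open>R\<close>, but then 0 \<le> s
      already gives the bound.\<close>
    proof (cases "0 \<le> f d \<eta> + r * exp (- (d + \<eta>) / v) - \<xi>")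
      case True
      assume "eventually (\<lambda>u. (f d \<eta> + r * exp (- (d + \<eta>) / v) - \<xi>) * g u \<le> prob (near j e u)) at_top"
      with True show ?thesis by (intro le_s) (simp add: R_def)
    qed (use s0 in auto)
    then show "f d \<eta> + r * exp (- (d + \<eta>) / v) \<le> s + \<xi>" by simp
  qed
  have step2: "f d \<eta> + s * exp (- (d + \<eta>) / v) \<le> s" if d: "0 < d" "0 < \<eta>" "4 * \<eta> < d" for d \<eta>
  proof -
    have "s \<le> (s - f d \<eta>) / exp (- (d + \<eta>) / v)"
      unfolding s_def
    proof (rule cSup_least)
      fix r assume "r \<in> R"
      then show "r \<le> (Sup R - f d \<eta>) / exp (- (d + \<eta>) / v)"
        using step[OF d] unfolding s_def[symmetric] by (subst pos_le_divide_eq) (auto simp: algebra_simps)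
    qed (use R0 in auto)
    then show ?thesis by (subst (asm) pos_le_divide_eq) (auto simp: algebra_simps)
  qed
  have step3: "exp (- d * (1 - \<theta> j) / v) - exp (- d / v) + s * exp (- d / v) \<le> s" if d: "0 < d" for d
  proof (rule tendsto_upperbound)
    show "((\<lambda>\<eta>. f d \<eta> + s * exp (- (d + \<eta>) / v)) \<longlongrightarrow> exp (- d * (1 - \<theta> j) / v) - exp (- d / v) + s * exp (- d / v)) (at_right 0)"
    proof -
      have "((\<lambda>\<eta>. f d \<eta> + s * exp (- (d + \<eta>) / v)) \<longlongrightarrow>
          exp (- (0 * \<theta> j + d * (1 - \<theta> j)) / v) - exp (- (d - 2 * 0) / v) + s * exp (- (d + 0) / v)) (at_right 0)"
        unfolding f_def using v_pos by (intro tendsto_intros) auto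
      then show ?thesis by simp
    qed
    have "eventually (\<lambda>\<eta>::real. \<eta> < d / 4) (at_right 0)"
      by (rule eventually_mono[OF eventually_at_right_real[of 0 "d / 4"]]) (use d in auto)
    moreover have "eventually (\<lambda>\<eta>::real. 0 < \<eta>) (at_right 0)" by (rule eventually_at_right_less)
    ultimately show "eventually (\<lambda>\<eta>. f d \<eta> + s * exp (- (d + \<eta>) / v) \<le> s) (at_right 0)"
    proof eventually_elim
      case (elim \<eta>)
      then show ?case by (intro step2[OF d]) auto
    qed
  qed simp
  have step4: "exp (- d / v) * \<theta> j \<le> s" if d: "0 < d" for d
  proof -
    \<comment> \<open>By exp x - 1 \<ge> x and 1 - exp (- x) \<le> x both sides of the fixed-point
      inequality become multiples of d / v, which cancels.\<close>
    have "exp (- d * (1 - \<theta> j) / v) = exp (- d / v) * exp (d * \<theta> j / v)"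
      unfolding exp_add[symmetric] using v_pos by (simp add: field_simps)
    then have "exp (- d / v) * (exp (d * \<theta> j / v) - 1) \<le> s * (1 - exp (- d / v))"
      using step3[OF d] by (simp add: algebra_simps)
    moreover have "exp (- d / v) * (d * \<theta> j / v) \<le> exp (- d / v) * (exp (d * \<theta> j / v) - 1)"
      using exp_ge_add_one_self[of "d * \<theta> j / v"] by (intro mult_left_mono) (linarith, simp)
    moreover have "s * (1 - exp (- d / v)) \<le> s * (d / v)"
      using exp_ge_add_one_self[of "- d / v"] s0 by (intro mult_left_mono; simp)
    ultimately have "(exp (- d / v) * \<theta> j) * (d / v) \<le> s * (d / v)" by (simp add: algebra_simps)
    then show ?thesis by (rule mult_right_le_imp_le) (use d v_pos in simp)
  qed
  have "\<theta> j \<le> s"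
  proof (rule tendsto_upperbound)
    have "((\<lambda>d. exp (- d / v) * \<theta> j) \<longlongrightarrow> exp (- 0 / v) * \<theta> j) (at_right 0)"
      using v_pos by (intro tendsto_intros) auto
    then show "((\<lambda>d. exp (- d / v) * \<theta> j) \<longlongrightarrow> \<theta> j) (at_right 0)" by simp
    have "eventually (\<lambda>d::real. 0 < d) (at_right 0)" by (rule eventually_at_right_less)
    then show "eventually (\<lambda>d. exp (- d / v) * \<theta> j \<le> s) (at_right 0)"
      by eventually_elim (rule step4)
  qed simp
  then have "r < Sup R" using r by (simp add: s_def)
  then obtain r' where r': "r' \<in> R" "r < r'" using less_cSup_iff[of R r] R0 bdd by blast
  then have "eventually (\<lambda>u. r' * g u \<le> prob (near j e u)) at_top" by (simp add: R_def)
  then show ?thesis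
  proof eventually_elim
    case (elim u)
    have "r * g u \<le> r' * g u" using r'(2) by (intro mult_right_mono) auto
    then show ?case using elim by linarith
  qed
qed

end

section \<open>Weak convergence\<close>

context equilibrium
begin

lemma INF_greater_iff:
  assumes \<omega>: "\<omega> \<in> space M"
  shows "u < (INF t\<in>{a..b}. X t \<omega>) \<longleftrightarrow> \<omega> \<in> exceeds (\<lambda>_. u)"
proof -
  have "(INF t\<in>{a..b}. X t \<omega>) = X (argmin \<omega>) \<omega>"
    by (rule cInf_eq_minimum) (use argmin_props(1,2)[OF \<omega>] in auto)
  then show ?thesis
    using argmin_props(1,2)[OF \<omega>] \<omega> by (force simp: exceeds_def)
qed

lemma cond_argmin_law_eq:
  "cond_argmin_law M X a b u = distr (uniform_measure M (exceeds (\<lambda>_. u))) (restrict_space borel {a..b}) argmin"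
proof -
  have "{\<omega> \<in> space M. (INF s\<in>{a..b}. X s \<omega>) > u} = exceeds (\<lambda>_. u)"
    using INF_greater_iff by (auto simp: exceeds_def)
  then show ?thesis unfolding cond_argmin_law_def argmin_def[abs_def] by simp
qed

lemma argmin_measurable_restrict[measurable]: "argmin \<in> measurable M (restrict_space borel {a..b})"
  by (rule measurable_restrict_space2) (use argmin_props(1) in auto)

lemma argmin_measurable_uniform: "argmin \<in> measurable (uniform_measure M A) (restrict_space borel {a..b})"
  using argmin_measurable_restrict measurable_cong_sets[OF sets_uniform_measure refl] by blast

lemma cond_argmin_law_prob:
  assumes "0 < g u" shows "prob_space (cond_argmin_law M X a b u)"
  unfolding cond_argmin_law_eq
proof (rule prob_space.prob_space_distr[OF prob_space_uniform_measure argmin_measurable_uniform])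
  show "emeasure M (exceeds (\<lambda>_. u)) \<noteq> 0" using assms by (simp add: emeasure_eq_measure)
qed simp

lemma cond_argmin_law_ball:
  assumes g: "0 < g u"
  shows "measure (cond_argmin_law M X a b u) ({a..b} \<inter> {x. \<bar>x - j\<bar> < e}) = prob (near j e u) / g u"
proof -
  have [measurable]: "exceeds (\<lambda>_. u) \<in> events" by (intro exceeds_measurable continuous_on_const)
  have B: "{a..b} \<inter> {x. \<bar>x - j\<bar> < e} \<in> sets (restrict_space borel {a..b})"
    by (auto simp: sets_restrict_space)
  have m: "argmin \<in> measurable (uniform_measure M (exceeds (\<lambda>_. u))) (restrict_space borel {a..b})"
    by (rule argmin_measurable_uniform)
  let ?B = "{\<omega> \<in> space M. \<bar>argmin \<omega> - j\<bar> < e}"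
  have "measure (cond_argmin_law M X a b u) ({a..b} \<inter> {x. \<bar>x - j\<bar> < e}) =
      measure (uniform_measure M (exceeds (\<lambda>_. u))) (argmin -` ({a..b} \<inter> {x. \<bar>x - j\<bar> < e}) \<inter> space M)"
    unfolding cond_argmin_law_eq by (subst measure_distr[OF m B]) simp
  also have "argmin -` ({a..b} \<inter> {x. \<bar>x - j\<bar> < e}) \<inter> space M = ?B"
    using argmin_props(1) by auto
  also have "measure (uniform_measure M (exceeds (\<lambda>_. u))) ?B = prob (exceeds (\<lambda>_. u) \<inter> ?B) / g u"
    using g by (intro measure_uniform_measure) (auto simp: emeasure_eq_measure)
  also have "exceeds (\<lambda>_. u) \<inter> ?B = near j e u" by (auto simp: near_def exceeds_def)
  finally show ?thesis .
qed

lemma P_separated: "\<exists>\<rho>>0. \<forall>i\<in>P. \<forall>j\<in>P. i \<noteq> j \<longrightarrow> 2 * \<rho> \<le> \<bar>i - j\<bar>"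
proof -
  \<comment> \<open>The element 1 keeps \<open>D\<close> nonempty when \<open>P\<close> has a single
    point.\<close>
  define D where "D = insert 1 ((\<lambda>(i, j). \<bar>i - j\<bar>) ` {(i, j) \<in> P \<times> P. i \<noteq> j})"
  have "finite ((P \<times> P) \<inter> {(i, j). i \<noteq> j})" using finite_P by blast
  moreover have "{(i, j) \<in> P \<times> P. i \<noteq> j} = (P \<times> P) \<inter> {(i, j). i \<noteq> j}" by auto
  ultimately have fin: "finite D" by (simp add: D_def)
  have "0 < Min D" by (subst Min_gr_iff[OF fin]) (auto simp: D_def)
  moreover have "Min D \<le> \<bar>i - j\<bar>" if "i \<in> P" "j \<in> P" "i \<noteq> j" for i j
    using that by (intro Min_le[OF fin]) (auto simp: D_def intro!: image_eqI[of _ _ "(i, j)"])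
  ultimately show ?thesis by (intro exI[of _ "Min D / 2"]) auto
qed

text \<open>A nonnegative \<open>f\<close> is bounded below by a step function supported on disjoint
  intervals around \<open>P\<close>; \<open>near_lower\<close> bounds their masses below, and all
  other mass is discarded.\<close>

lemma law_integral_lower:
  assumes f: "continuous_on {a..b} f" and f0: "\<And>x. x \<in> {a..b} \<Longrightarrow> (0::real) \<le> f x" and e: "0 < e"
  shows "eventually (\<lambda>u. (\<Sum>i\<in>P. \<theta> i * f i) - e \<le> (\<integral>x. f x \<partial>cond_argmin_law M X a b u)) at_top"
proof -
  define F where "F = (\<Sum>i\<in>P. \<bar>f i\<bar>)"
  have F: "0 \<le> F" by (simp add: F_def sum_nonneg)
  \<comment> \<open>The error is \<epsilon> from uniform continuity and at most \<epsilon> F from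
    the masses of the intervals.\<close>
  define \<epsilon> where "\<epsilon> = e / (1 + F)"
  have "\<epsilon> * (1 + F) = e" using F by (simp add: \<epsilon>_def)
  then have \<epsilon>: "0 < \<epsilon>" "\<epsilon> + \<epsilon> * F = e" using e F by (simp_all add: \<epsilon>_def distrib_left)
  have "uniformly_continuous_on {a..b} f" by (rule compact_uniformly_continuous[OF f]) simp
  then obtain \<rho>1 where \<rho>1: "0 < \<rho>1" "\<forall>s\<in>{a..b}. \<forall>t\<in>{a..b}. \<bar>t - s\<bar> < \<rho>1 \<longrightarrow> \<bar>f t - f s\<bar> < \<epsilon>"
    using \<epsilon>(1) unfolding uniformly_continuous_on_def dist_real_def by meson
  obtain \<rho>2 where \<rho>2: "0 < \<rho>2" "\<forall>i\<in>P. \<forall>j\<in>P. i \<noteq> j \<longrightarrow> 2 * \<rho>2 \<le> \<bar>i - j\<bar>" using P_separated by blast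
  define \<rho> where "\<rho> = min \<rho>1 \<rho>2"
  have \<rho>: "0 < \<rho>" "\<rho> \<le> \<rho>1" "\<rho> \<le> \<rho>2" using \<rho>1 \<rho>2 by (auto simp: \<rho>_def)
  define B where "B = (\<lambda>i. {a..b} \<inter> {x. \<bar>x - i\<bar> < \<rho>})"
  \<comment> \<open>Truncation at 0 makes the heights nonnegative, so that lower bounds for the
    masses may be multiplied by them.\<close>
  define m where "m = (\<lambda>i. max 0 (f i - \<epsilon>))"
  have m: "0 \<le> m i" "f i - \<epsilon> \<le> m i" for i by (auto simp: m_def)
  have mf: "m i \<le> \<bar>f i\<bar>" for i using \<epsilon>(1) by (auto simp: m_def)
  have low: "(\<Sum>i\<in>P. m i * indicator (B i) x) \<le> f x" if x: "x \<in> {a..b}" for x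
  proof (cases "\<exists>i\<in>P. x \<in> B i")
    case True
    then obtain i where i: "i \<in> P" "x \<in> B i" by blast
    have "x \<notin> B k" if "k \<in> P" "k \<noteq> i" for k
    proof
      assume "x \<in> B k"
      then have "\<bar>k - i\<bar> < 2 * \<rho>" using i(2) by (auto simp: B_def)
      moreover have "2 * \<rho>2 \<le> \<bar>k - i\<bar>" using \<rho>2(2) that i(1) by blast
      ultimately show False using \<rho>(3) by linarith
    qed
    then have "(\<Sum>k\<in>P - {i}. m k * indicator (B k) x) = 0" by (intro sum.neutral) auto
    then have "(\<Sum>k\<in>P. m k * indicator (B k) x) = m i"
      using sum.remove[OF finite_P i(1), of "\<lambda>k. m k * indicator (B k) x"] i(2) by simp
    moreover have "\<bar>x - i\<bar> < \<rho>1" using i(2) \<rho>(2) by (auto simp: B_def)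
    then have "\<bar>f x - f i\<bar> < \<epsilon>" using \<rho>1(2) i(1) P_subset x by blast
    ultimately show ?thesis using f0[OF x] by (auto simp: m_def)
  next
    case False
    then have "(\<Sum>i\<in>P. m i * indicator (B i) x) = 0" by (intro sum.neutral) auto
    then show ?thesis using f0[OF x] by simp
  qed
  have "compact (f ` {a..b})" by (rule compact_continuous_image[OF f]) simp
  then obtain H where H: "\<And>x. x \<in> {a..b} \<Longrightarrow> \<bar>f x\<bar> \<le> H"
    using compact_imp_bounded by (fastforce simp: bounded_iff)
  have "eventually (\<lambda>u. \<forall>i\<in>P. (\<theta> i - \<epsilon>) * g u \<le> prob (near i \<rho> u)) at_top"
    using finite_P \<rho>(1) \<epsilon>(1) by (intro eventually_ball_finite ballI near_lower) auto
  then show ?thesis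
    using eventually_g_pos
  proof eventually_elim
    case (elim u)
    define N where "N = cond_argmin_law M X a b u"
    have sN: "sets N = sets (restrict_space borel {a..b})" by (simp add: N_def cond_argmin_law_eq)
    have spN: "space N = {a..b}" using sets_eq_imp_space_eq[OF sN] by (simp add: space_restrict_space)
    interpret N: prob_space N unfolding N_def by (rule cond_argmin_law_prob[OF elim(2)])
    have "f \<in> borel_measurable (restrict_space borel {a..b})"
      by (rule borel_measurable_continuous_on_restrict[OF f])
    then have fm: "f \<in> borel_measurable N" using measurable_cong_sets[OF sN refl] by blast
    have fi: "integrable N f"
      by (rule N.integrable_const_bound[where B=H]) (use H fm spN in auto)
    have BN: "B i \<in> sets N" for i unfolding sN B_def by (auto simp: sets_restrict_space)
    have iB: "integrable N (\<lambda>x. m i * indicator (B i) x)" for i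
      using BN[of i] by (intro integrable_mult_right integrable_real_indicator) (auto simp: less_top[symmetric])
    have "(\<Sum>i\<in>P. m i * (\<theta> i - \<epsilon>)) \<le> (\<Sum>i\<in>P. m i * measure N (B i))"
    proof (intro sum_mono mult_left_mono m(1))
      fix i assume "i \<in> P"
      then have "\<theta> i - \<epsilon> \<le> prob (near i \<rho> u) / g u" using elim by (simp add: pos_le_divide_eq)
      then show "\<theta> i - \<epsilon> \<le> measure N (B i)"
        unfolding N_def B_def by (simp only: cond_argmin_law_ball[OF elim(2)])
    qed
    also have "\<dots> = (\<integral>x. (\<Sum>i\<in>P. m i * indicator (B i) x) \<partial>N)"
    proof -
      have "(\<integral>x. (\<Sum>i\<in>P. m i * indicator (B i) x) \<partial>N) = (\<Sum>i\<in>P. \<integral>x. m i * indicator (B i) x \<partial>N)"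
        by (rule Bochner_Integration.integral_sum) (rule iB)
      also have "\<dots> = (\<Sum>i\<in>P. m i * measure N (B i))"
        using BN sets.sets_into_space by (intro sum.cong refl) (simp add: Int_absorb2)
      finally show ?thesis by simp
    qed
    also have "\<dots> \<le> (\<integral>x. f x \<partial>N)"
      using iB by (intro integral_mono Bochner_Integration.integrable_sum fi low) (auto simp: spN)
    finally have 1: "(\<Sum>i\<in>P. m i * (\<theta> i - \<epsilon>)) \<le> (\<integral>x. f x \<partial>N)" .
    have "(\<Sum>i\<in>P. \<theta> i * (f i - \<epsilon>)) \<le> (\<Sum>i\<in>P. \<theta> i * m i)"
      by (intro sum_mono mult_left_mono m(2) \<theta>_nonneg)
    moreover have "(\<Sum>i\<in>P. \<theta> i * (f i - \<epsilon>)) = (\<Sum>i\<in>P. \<theta> i * f i) - \<epsilon>"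
      using \<theta>_sum by (simp add: right_diff_distrib sum_subtractf sum_distrib_right[symmetric])
    moreover have "(\<Sum>i\<in>P. m i * (\<theta> i - \<epsilon>)) = (\<Sum>i\<in>P. \<theta> i * m i) - \<epsilon> * sum m P"
      by (simp add: right_diff_distrib sum_subtractf sum_distrib_left mult.commute)
    moreover have "\<epsilon> * sum m P \<le> \<epsilon> * F"
      unfolding F_def using \<epsilon>(1) mf by (intro mult_left_mono sum_mono) auto
    ultimately show ?case using 1 \<epsilon>(2) unfolding N_def by linarith
  qed
qed

text \<open>Applying the lower bound to H + f and to H - f, with \<open>H\<close> a bound for |f|,
  yields both directions, since the conditional law and the weights \<theta> both have total mass
  1.\<close>

theorem law_integral_tendsto:
  assumes f: "continuous_on {a..b} f"
  shows "((\<lambda>u. \<integral>x. f x \<partial>cond_argmin_law M X a b u) \<longlongrightarrow> (\<Sum>i\<in>P. \<theta> i * f i)) at_top"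
proof (rule tendstoI)
  fix e :: real assume e: "0 < e"
  have "compact (f ` {a..b})" by (rule compact_continuous_image[OF f]) simp
  then obtain H where H: "\<And>x. x \<in> {a..b} \<Longrightarrow> \<bar>f x\<bar> \<le> H"
    using compact_imp_bounded by (fastforce simp: bounded_iff)
  have e2: "0 < e / 2" using e by simp
  have "eventually (\<lambda>u. (\<Sum>i\<in>P. \<theta> i * (H + f i)) - e / 2 \<le> (\<integral>x. (H + f x) \<partial>cond_argmin_law M X a b u)) at_top"
    by (rule law_integral_lower[OF continuous_on_add[OF continuous_on_const f] _ e2]) (use H in force)
  moreover have "eventually (\<lambda>u. (\<Sum>i\<in>P. \<theta> i * (H - f i)) - e / 2 \<le> (\<integral>x. (H - f x) \<partial>cond_argmin_law M X a b u)) at_top"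
    by (rule law_integral_lower[OF continuous_on_diff[OF continuous_on_const f] _ e2]) (use H in force)
  ultimately show "eventually (\<lambda>u. dist (\<integral>x. f x \<partial>cond_argmin_law M X a b u) (\<Sum>i\<in>P. \<theta> i * f i) < e) at_top"
    using eventually_g_pos
  proof eventually_elim
    case (elim u)
    define N where "N = cond_argmin_law M X a b u"
    have sN: "sets N = sets (restrict_space borel {a..b})" by (simp add: N_def cond_argmin_law_eq)
    have spN: "space N = {a..b}" using sets_eq_imp_space_eq[OF sN] by (simp add: space_restrict_space)
    interpret N: prob_space N unfolding N_def by (rule cond_argmin_law_prob[OF elim(3)])
    have "f \<in> borel_measurable (restrict_space borel {a..b})"
      by (rule borel_measurable_continuous_on_restrict[OF f])
    then have fm: "f \<in> borel_measurable N" using measurable_cong_sets[OF sN refl] by blast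
    have fi: "integrable N f"
      by (rule N.integrable_const_bound[where B=H]) (use H fm spN in auto)
    have 1: "(\<integral>x. (H + f x) \<partial>N) = H + (\<integral>x. f x \<partial>N)" "(\<integral>x. (H - f x) \<partial>N) = H - (\<integral>x. f x \<partial>N)"
      using fi by (simp_all add: N.prob_space)
    have 2: "(\<Sum>i\<in>P. \<theta> i * (H + f i)) = H + (\<Sum>i\<in>P. \<theta> i * f i)" "(\<Sum>i\<in>P. \<theta> i * (H - f i)) = H - (\<Sum>i\<in>P. \<theta> i * f i)"
      using \<theta>_sum by (simp_all add: distrib_left right_diff_distrib sum.distrib sum_subtractf sum_distrib_right[symmetric])
    show ?case using elim(1,2) e unfolding N_def[symmetric] 1 2 dist_real_def by linarith
  qed
qed

end

section \<open>Analyticity\<close>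

lemma analytic_zeros_on_reals:
  fixes G :: "complex \<Rightarrow> complex"
  assumes G: "G holomorphic_on UNIV" and x: "x islimpt T" and 0: "\<And>t. t \<in> T \<Longrightarrow> G (of_real t) = 0"
  shows "G z = 0"
proof (rule analytic_continuation[OF G open_UNIV connected_UNIV subset_UNIV UNIV_I])
  show "complex_of_real x islimpt of_real ` T"
    unfolding islimpt_approachable
  proof (intro allI impI)
    fix e :: real assume "0 < e"
    then obtain t where "t \<in> T" "t \<noteq> x" "dist t x < e" using x unfolding islimpt_approachable by blast
    then show "\<exists>y\<in>complex_of_real ` T. y \<noteq> of_real x \<and> dist y (of_real x) < e"
      by (intro bexI[of _ "of_real t"]) (auto simp: dist_of_real)
  qed
qed (use 0 in auto)

text \<open>A power series convergent at every real point defines an entire function. Infinitely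
  many solutions in a compact interval accumulate by Bolzano-Weierstrass, and the identity theorem
  applies.\<close>

lemma entire_eq_const:
  fixes A :: "nat \<Rightarrow> real"
  assumes A: "\<And>s. (\<lambda>m. A m * s ^ m) sums h s" and inf: "infinite {t \<in> {a..b}. h t = c}"
  shows "h t = c"
proof -
  define G where "G = (\<lambda>z::complex. \<Sum>m. of_real (A m) * z ^ m)"
  have sums: "(\<lambda>m. of_real (A m) * z ^ m) sums G z" for z :: complex
  proof -
    \<comment> \<open>Convergence at a real point of modulus larger than that of z gives convergence
      at z.\<close>
    have "summable (\<lambda>m. complex_of_real (A m * (norm z + 1) ^ m))"
      using A[of "norm z + 1"] by (intro summable_of_real) (auto simp: sums_iff)
    then have "summable (\<lambda>m. complex_of_real (A m) * (of_real (norm z + 1)) ^ m)"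
      by simp
    then have "summable (\<lambda>m. complex_of_real (A m) * z ^ m)"
    proof (rule powser_inside)
      have "norm (complex_of_real (norm z + 1)) = norm z + 1" unfolding norm_of_real by simp
      then show "norm z < norm (complex_of_real (norm z + 1))" by simp
    qed
    then show ?thesis unfolding G_def by (rule summable_sums)
  qed
  have "G holomorphic_on ball 0 r" for r
    by (rule power_series_holomorphic[where a="\<lambda>m. of_real (A m)"]) (use sums in simp)
  then have "G field_differentiable (at z)" for z
    by (rule holomorphic_on_imp_differentiable_at[of _ "ball 0 (norm z + 1)"]) auto
  then have hol: "(\<lambda>z. G z - of_real c) holomorphic_on UNIV"
    by (intro holomorphic_on_diff holomorphic_on_const) (simp add: holomorphic_on_def)
  have Gh: "G (of_real s) = of_real (h s)" for s
  proof -
    have "(\<lambda>m. complex_of_real (A m * s ^ m)) sums of_real (h s)" using A by (rule sums_of_real)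
    then have "(\<lambda>m. complex_of_real (A m) * of_real s ^ m) sums of_real (h s)" by simp
    then show ?thesis using sums[of "of_real s"] sums_unique2 by blast
  qed
  obtain x where x: "x islimpt {t \<in> {a..b}. h t = c}"
    using inf compact_Icc[of a b, unfolded compact_eq_Bolzano_Weierstrass]
    by (metis (no_types, lifting) mem_Collect_eq subsetI)
  have "G (of_real t) - of_real c = 0"
    by (rule analytic_zeros_on_reals[OF hol x]) (simp add: Gh)
  then show ?thesis by (simp add: Gh)
qed

text \<open>Divide by the exponential with the largest exponent among the nonzero coefficients and
  let y tend to infinity: only that coefficient survives.\<close>

lemma exp_sum_zero_imp_coeff_zero:
  fixes c :: "real \<Rightarrow> real"
  assumes J: "finite J" and 0: "\<And>y. (\<Sum>t\<in>J. c t * exp (t * y)) = 0"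
  shows "\<forall>t\<in>J. c t = 0"
proof (rule ccontr)
  assume "\<not> (\<forall>t\<in>J. c t = 0)"
  then have ne: "{t \<in> J. c t \<noteq> 0} \<noteq> {}" by auto
  have fin: "finite {t \<in> J. c t \<noteq> 0}" using J by simp
  define m where "m = Max {t \<in> J. c t \<noteq> 0}"
  have m: "m \<in> J" "c m \<noteq> 0" using Max_in[OF fin ne] by (auto simp: m_def)
  have le: "t \<le> m" if "t \<in> J" "c t \<noteq> 0" for t using Max_ge[OF fin, of t] that by (simp add: m_def)
  have "((\<lambda>y. c t * exp ((t - m) * y)) \<longlongrightarrow> (if t = m then c t else 0)) at_top" if "t \<in> J" for t
  proof (cases "c t = 0 \<or> t = m")
    case False
    then have "t - m < 0" using le[OF that] by simp
    then have "((\<lambda>y. c t * exp ((t - m) * y)) \<longlongrightarrow> 0) at_top" by real_asymp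
    then show ?thesis using False by simp
  qed auto
  then have "((\<lambda>y. \<Sum>t\<in>J. c t * exp ((t - m) * y)) \<longlongrightarrow> (\<Sum>t\<in>J. if t = m then c t else 0)) at_top"
    by (rule tendsto_sum)
  moreover have "(\<Sum>t\<in>J. c t * exp ((t - m) * y)) = 0" for y
  proof -
    have "(\<Sum>t\<in>J. c t * exp ((t - m) * y)) = (\<Sum>t\<in>J. c t * exp (t * y)) * exp (- m * y)"
      by (simp add: sum_distrib_right mult.assoc exp_add[symmetric] left_diff_distrib)
    then show ?thesis by (simp add: 0)
  qed
  ultimately have "((\<lambda>y::real. 0) \<longlongrightarrow> c m) at_top" using m(1) J by simp
  then have "c m = 0" using tendsto_unique[OF trivial_limit_at_top_linorder] tendsto_const by blast
  then show False using m(2) by simp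
qed

section \<open>Linear independence and finiteness of the contact set\<close>

context centered_gaussian_process
begin

lemma covariance_X: "covariance M (X s) (X t) = cov (X s) (X t)"
  using lin_mean[OF lin_X] by (simp add: covariance_def cov_def)

text \<open>A combination of variance zero is almost surely zero and hence uncorrelated with every X
  t, so its coefficient vector lies in the kernel of the covariance matrix. The non-singularity
  assumption is applied to the pairs (s, 0), derivatives of order zero.\<close>

lemma invertible_imp_independent:
  assumes inv: "\<And>ps. distinct ps \<Longrightarrow> invertible_mat (covariance_mat M (map (\<lambda>(s, n). path_deriv X n s) ps))"
    and J: "finite J" and 0: "cov (\<lambda>\<omega>. \<Sum>t\<in>J. c t * X t \<omega>) (\<lambda>\<omega>. \<Sum>t\<in>J. c t * X t \<omega>) = 0"
  shows "\<forall>t\<in>J. c t = 0"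
proof -
  define L where "L = (\<lambda>\<omega>. \<Sum>t\<in>J. c t * X t \<omega>)"
  have L: "lin L" unfolding L_def by (rule lin_finite_sum[OF J])
  have "AE \<omega> in M. L \<omega> = 0" using 0 cov_eq_0_iff[OF L] by (simp add: L_def)
  then have LX: "cov L (X t) = 0" for t by (rule cov_eq_0_AE[OF L _ lin_X])
  obtain xs where xs: "distinct xs" "set xs = J" using finite_distinct_list[OF J] by blast
  define n where "n = length xs"
  define G where "G = covariance_mat M (map X xs)"
  have G: "G = Matrix.mat n n (\<lambda>(i, j). cov (X (xs ! i)) (X (xs ! j)))"
    unfolding G_def covariance_mat_def n_def by (rule eq_matI) (auto simp: covariance_X)
  have Gc: "G \<in> carrier_mat n n" by (simp add: G)
  have X0: "path_deriv X 0 s = X s" for s by (rule ext) (simp add: path_deriv_def)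
  have map_X: "map (\<lambda>(s, n). path_deriv X n s) (map (\<lambda>s. (s, 0)) xs) = map X xs" by (simp add: X0)
  have "distinct (map (\<lambda>s. (s, 0::nat)) xs)" using xs(1) by (simp add: distinct_map inj_on_def)
  from inv[OF this] have "invertible_mat G" unfolding map_X G_def .
  then obtain B where B: "G * B = 1\<^sub>m (dim_row G)" "B * G = 1\<^sub>m (dim_row B)"
    unfolding invertible_mat_def inverts_mat_def by blast
  have "dim_col B = n" using arg_cong[OF B(1), of dim_col] Gc by simp
  moreover have "dim_row B = n" using arg_cong[OF B(2), of dim_col] Gc by simp
  ultimately have Bc: "B \<in> carrier_mat n n" by blast
  define w where "w = Matrix.vec n (\<lambda>i. c (xs ! i))"
  have w: "w \<in> carrier_vec n" by (simp add: w_def)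
  have "G *\<^sub>v w = 0\<^sub>v n"
  proof (rule eq_vecI)
    fix i assume "i < dim_vec (0\<^sub>v n :: real Matrix.vec)"
    then have i: "i < n" by simp
    have "vec_index (G *\<^sub>v w) i = (\<Sum>j\<in>{0..<n}. cov (X (xs ! i)) (X (xs ! j)) * c (xs ! j))"
      using i Gc by (simp add: G w_def scalar_prod_def)
    also have "\<dots> = (\<Sum>t\<in>J. cov (X (xs ! i)) (X t) * c t)"
      using xs by (intro sum.reindex_bij_betw[of "\<lambda>j. xs ! j" "{0..<n}" J "\<lambda>t. cov (X (xs ! i)) (X t) * c t"])
        (auto simp: n_def atLeast0LessThan intro: bij_betw_nth)
    also have "\<dots> = cov (X (xs ! i)) L"
      unfolding L_def using cov_sum_right[OF J lin_X lin_X, where c=c] by (simp add: mult.commute)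
    also have "\<dots> = 0" using LX by (simp add: cov_commute)
    finally show "vec_index (G *\<^sub>v w) i = vec_index (0\<^sub>v n) i" using i by simp
  qed (use Gc in simp)
  then have "w = B *\<^sub>v 0\<^sub>v n"
    using assoc_mult_mat_vec[OF Bc Gc w] B(2) Bc w by simp
  also have "\<dots> = 0\<^sub>v n" using Bc by (intro eq_vecI) (auto simp: scalar_prod_def)
  finally have "w = 0\<^sub>v n" .
  then have "c (xs ! i) = 0" if "i < n" for i
  proof -
    have "vec_index w i = 0" unfolding \<open>w = 0\<^sub>v n\<close> using that by simp
    moreover have "vec_index w i = c (xs ! i)" unfolding w_def using that by simp
    ultimately show ?thesis by simp
  qed
  then show ?thesis using xs(2) by (metis in_set_conv_nth n_def)
qed

text \<open>The iterated series is only known to be a power series in the first argument of the covariance;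
  by symmetry this suffices.\<close>

lemma contact_set_finite_a:
  fixes S :: "real set"
  assumes ser: "\<And>s t. (\<forall>m. summable (\<lambda>n. r m n * s ^ m * t ^ n)) \<and>
      (\<lambda>m. \<Sum>n. r m n * s ^ m * t ^ n) sums cov_fun M X s t"
    and lim: "\<And>s. s \<in> {a..b} \<Longrightarrow> Limsup at_top (\<lambda>t. ereal (cov_fun M X s t)) \<le> 0"
    and S: "finite S" "S \<subseteq> {a..b}" and w: "\<And>i. i \<in> S \<Longrightarrow> 0 \<le> w i" "sum w S = 1" and c: "0 < c"
  shows "finite {t \<in> {a..b}. cov (X t) (\<lambda>\<omega>. \<Sum>i\<in>S. w i * X i \<omega>) = c}"
proof (rule ccontr)
  assume inf: "\<not> ?thesis"
  define H where "H = (\<lambda>t. cov (X t) (\<lambda>\<omega>. \<Sum>i\<in>S. w i * X i \<omega>))"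
  have H_eq: "H t = (\<Sum>i\<in>S. w i * cov (X t) (X i))" for t
    unfolding H_def by (rule cov_sum_right[OF S(1) lin_X lin_X])
  define \<alpha> where "\<alpha> = (\<lambda>t m. \<Sum>n. r m n * t ^ n)"
  have \<alpha>: "(\<lambda>m. \<alpha> t m * s ^ m) sums cov (X s) (X t)" for s t
  proof -
    have "(\<Sum>n. r m n * s ^ m * t ^ n) = \<alpha> t m * s ^ m" for m
    proof -
      have "summable (\<lambda>n. r m n * 1 ^ m * t ^ n)" using ser[of 1 t] by blast
      then have "summable (\<lambda>n. r m n * t ^ n)" by simp
      then have "\<alpha> t m * s ^ m = (\<Sum>n. r m n * t ^ n * s ^ m)" unfolding \<alpha>_def by (rule suminf_mult2)
      then show ?thesis by (simp add: mult_ac)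
    qed
    then show ?thesis using ser[of s t] by (simp add: cov_fun_eq)
  qed
  have "(\<lambda>m. (\<Sum>i\<in>S. w i * \<alpha> i m) * s ^ m) sums H s" for s
  proof -
    have "(\<lambda>m. \<Sum>i\<in>S. w i * (\<alpha> i m * s ^ m)) sums (\<Sum>i\<in>S. w i * cov (X s) (X i))"
      by (intro sums_sum sums_mult \<alpha>)
    then show ?thesis by (simp add: H_eq sum_distrib_right mult.assoc)
  qed
  then have const: "H t = c" for t
    by (rule entire_eq_const[where a=a and b=b]) (use inf in \<open>simp add: H_def\<close>)
  \<comment> \<open>The potential would be the constant c > 0 on the whole line, but with
    nonnegative weights the limsup condition brings it down to c / 2 far to the right.\<close>
  have "eventually (\<lambda>t. \<forall>i\<in>S. cov_fun M X i t < c / 2) at_top"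
  proof (rule eventually_ball_finite[OF S(1)], rule ballI)
    fix i assume "i \<in> S"
    then have "Limsup at_top (\<lambda>t. ereal (cov_fun M X i t)) \<le> 0" using lim S by blast
    also have "0 < ereal (c / 2)" using c by simp
    finally have "eventually (\<lambda>t. ereal (cov_fun M X i t) < ereal (c / 2)) at_top" by (rule Limsup_lessD)
    then show "eventually (\<lambda>t. cov_fun M X i t < c / 2) at_top" by simp
  qed
  then obtain t where t: "\<forall>i\<in>S. cov_fun M X i t < c / 2"
    using eventually_happens'[OF trivial_limit_at_top_linorder] by blast
  have "H t \<le> (\<Sum>i\<in>S. w i * (c / 2))"
    unfolding H_eq
  proof (intro sum_mono mult_left_mono w(1))
    fix i assume "i \<in> S"
    then have "cov (X i) (X t) < c / 2" using t by (simp add: cov_fun_eq)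
    then show "cov (X t) (X i) \<le> c / 2" by (simp add: cov_commute)
  qed
  also have "\<dots> = sum w S * (c / 2)" by (rule sum_distrib_right[symmetric])
  also have "\<dots> = c / 2" using w(2) by simp
  finally show False using const[of t] c by simp
qed

end

section \<open>The stationary case\<close>

locale spectral_gaussian_process = centered_gaussian_process M X
  for M :: "'w measure" and X :: "real \<Rightarrow> 'w \<Rightarrow> real" +
  fixes F :: "real measure"
  assumes spectral: "is_spectral_measure M X F"
    and exp_moments: "\<And>t. (\<integral>\<^sup>+x. ennreal (exp (t * x)) \<partial>F) < \<infinity>"
    and accumulation: "\<exists>x. x islimpt measure_support F"
begin

lemma sets_F[measurable_cong, simp]: "sets F = sets borel"
  using spectral by (simp add: is_spectral_measure_def)

lemma space_F[simp]: "space F = UNIV"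
  using sets_eq_imp_space_eq[OF sets_F] by simp

lemma finite_F: "finite_measure F"
  using spectral by (simp add: is_spectral_measure_def)

lemma bounded_integrable:
  fixes f :: "real \<Rightarrow> real"
  assumes f: "f \<in> borel_measurable borel" and B: "\<And>x. \<bar>f x\<bar> \<le> B"
  shows "integrable F f"
proof (rule finite_measure.integrable_const_bound[OF finite_F])
  show "AE x in F. norm (f x) \<le> B" using B by (intro always_eventually allI) simp
  show "f \<in> borel_measurable F" using f measurable_cong_sets[OF sets_F refl] by blast
qed

lemma cov_spectral: "cov (X s) (X t) = (\<integral>x. cos ((t - s) * x) \<partial>F)"
proof -
  have "complex_of_real (cov (X s) (X t)) = (\<integral>x. iexp ((t - s) * x) \<partial>F)"
    using spectral by (simp add: is_spectral_measure_def cov_fun_eq)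
  then have "cov (X s) (X t) = Re (\<integral>x. iexp ((t - s) * x) \<partial>F)" by (metis Re_complex_of_real)
  also have "\<dots> = (\<integral>x. Re (iexp ((t - s) * x)) \<partial>F)"
    by (rule integral_Re[symmetric]) (rule finite_measure.integrable_const_bound[OF finite_F, where B=1], auto)
  finally show ?thesis by (simp add: Re_exp)
qed

text \<open>The integrand is the squared modulus of the trigonometric polynomial with coefficients
  \<open>c\<close>, written with real functions: the variance is its squared norm in L2(F).\<close>

lemma variance_spectral:
  assumes J: "finite J"
  shows "cov (\<lambda>\<omega>. \<Sum>t\<in>J. c t * X t \<omega>) (\<lambda>\<omega>. \<Sum>t\<in>J. c t * X t \<omega>) =
    (\<integral>x. (\<Sum>t\<in>J. c t * cos (t * x))\<^sup>2 + (\<Sum>t\<in>J. c t * sin (t * x))\<^sup>2 \<partial>F)"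
proof -
  have "(\<Sum>t\<in>J. c t * cos (t * x))\<^sup>2 + (\<Sum>t\<in>J. c t * sin (t * x))\<^sup>2 =
      (\<Sum>s\<in>J. \<Sum>t\<in>J. c s * (c t * cos ((t - s) * x)))" for x
    unfolding power2_eq_square sum_product sum.distrib[symmetric]
    by (intro sum.cong refl) (simp add: left_diff_distrib cos_diff algebra_simps)
  moreover have "integrable F (\<lambda>x. c s * (c t * cos ((t - s) * x)))" for s t
    by (intro integrable_mult_right bounded_integrable[where B=1]) auto
  ultimately have "(\<integral>x. (\<Sum>t\<in>J. c t * cos (t * x))\<^sup>2 + (\<Sum>t\<in>J. c t * sin (t * x))\<^sup>2 \<partial>F) =
      (\<Sum>s\<in>J. \<Sum>t\<in>J. c s * (c t * cov (X s) (X t)))"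
    by (simp add: cov_spectral)
  also have "\<dots> = cov (\<lambda>\<omega>. \<Sum>t\<in>J. c t * X t \<omega>) (\<lambda>\<omega>. \<Sum>t\<in>J. c t * X t \<omega>)"
    by (simp add: cov_sum[OF J lin_X lin_finite_sum[OF J]] cov_sum_right[OF J lin_X lin_X] sum_distrib_left)
  finally show ?thesis by simp
qed

text \<open>Variance zero makes the trigonometric polynomial vanish F-almost everywhere, hence by
  continuity on the support of \<open>F\<close>. The support has an accumulation point, so the
  entire extension is zero.\<close>

lemma independent:
  assumes J: "finite J" and 0: "cov (\<lambda>\<omega>. \<Sum>t\<in>J. c t * X t \<omega>) (\<lambda>\<omega>. \<Sum>t\<in>J. c t * X t \<omega>) = 0"
  shows "\<forall>t\<in>J. c t = 0"
proof -
  define A where "A = (\<lambda>x. \<Sum>t\<in>J. c t * cos (t * x))"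
  define B where "B = (\<lambda>x. \<Sum>t\<in>J. c t * sin (t * x))"
  define q where "q = (\<lambda>x. (A x)\<^sup>2 + (B x)\<^sup>2)"
  have contq: "continuous_on UNIV q" unfolding q_def A_def B_def by (intro continuous_intros)
  have qm: "q \<in> borel_measurable borel" using contq by (rule borel_measurable_continuous_onI)
  have q0: "0 \<le> q x" for x by (simp add: q_def)
  define K where "K = (\<Sum>t\<in>J. \<bar>c t\<bar>)"
  have sb: "\<bar>\<Sum>t\<in>J. c t * f t\<bar> \<le> K" if "\<And>t. \<bar>f t\<bar> \<le> 1" for f :: "real \<Rightarrow> real"
    unfolding K_def by (rule order_trans[OF sum_abs]) (use that in \<open>auto simp: abs_mult intro!: sum_mono mult_left_le\<close>)
  have "q x \<le> K\<^sup>2 + K\<^sup>2" for x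
  proof -
    have "\<bar>A x\<bar> \<le> K" "\<bar>B x\<bar> \<le> K" unfolding A_def B_def by (rule sb, simp)+
    then have "\<bar>A x\<bar>\<^sup>2 \<le> K\<^sup>2" "\<bar>B x\<bar>\<^sup>2 \<le> K\<^sup>2" by (intro power_mono; simp)+
    then show ?thesis by (simp add: q_def)
  qed
  then have "integrable F q" using q0 by (intro bounded_integrable[OF qm, of "K\<^sup>2 + K\<^sup>2"]) (simp add: abs_of_nonneg)
  moreover have "(\<integral>x. q x \<partial>F) = 0" using 0 variance_spectral[OF J, of c] by (simp add: q_def A_def B_def)
  ultimately have ae: "AE x in F. q x = 0" using integral_nonneg_eq_0_iff_AE[of F q] q0 by simp
  have supp: "q x = 0" if x: "x \<in> measure_support F" for x
  proof (rule ccontr)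
    assume "q x \<noteq> 0"
    then have "x \<in> q -` (- {0})" by simp
    moreover have "open (q -` (- {0}))" using contq by (intro open_vimage) auto
    ultimately have "0 < emeasure F (q -` (- {0}) \<inter> space F)" using x unfolding measure_support_def by blast
    moreover have "emeasure F (q -` (- {0}) \<inter> space F) = 0"
    proof -
      have "{x \<in> space F. \<not> q x = 0} \<in> sets F" using qm by simp
      then have "emeasure F {x \<in> space F. \<not> q x = 0} = 0" using ae by (simp add: AE_iff_measurable)
      moreover have "{x \<in> space F. \<not> q x = 0} = q -` (- {0}) \<inter> space F" by auto
      ultimately show ?thesis by simp
    qed
    ultimately show False by simp
  qed
  obtain x0 where x0: "x0 islimpt measure_support F" using accumulation by blast
  define G where "G = (\<lambda>z::complex. \<Sum>t\<in>J. of_real (c t) * exp (\<i> * of_real t * z))"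
  have hol: "G holomorphic_on UNIV" unfolding G_def by (intro holomorphic_intros)
  have "G (of_real x) = 0" if "x \<in> measure_support F" for x
  proof -
    have "A x = 0" "B x = 0" using supp[OF that] by (auto simp: q_def add_nonneg_eq_0_iff)
    moreover have "G (of_real x) = Complex (A x) (B x)"
      unfolding G_def A_def B_def
      by (rule complex_eqI) (auto simp: Re_exp Im_exp intro!: sum.cong)
    ultimately show ?thesis by (simp add: zero_complex.code)
  qed
  then have G0: "G z = 0" for z by (rule analytic_zeros_on_reals[OF hol x0])
  show ?thesis
  proof (rule exp_sum_zero_imp_coeff_zero[OF J])
    fix y
    \<comment> \<open>On the imaginary axis the polynomial becomes a sum of real exponentials with
      distinct rates, to which \<open>exp_sum_zero_imp_coeff_zero\<close> applies.\<close>
    have "\<i> * of_real t * (- \<i> * of_real y) = complex_of_real (t * y)" for t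
      by (rule complex_eqI) simp_all
    then have "G (- \<i> * of_real y) = complex_of_real (\<Sum>t\<in>J. c t * exp (t * y))"
      unfolding G_def by (simp only: of_real_sum of_real_mult[of "c _"] exp_of_real)
    then show "(\<Sum>t\<in>J. c t * exp (t * y)) = 0" using G0 by (metis of_real_eq_0_iff)
  qed
qed

lemma exp_abs_integrable: "integrable F (\<lambda>x. exp \<bar>s * x\<bar>)"
proof -
  have int: "integrable F (\<lambda>x. exp (t * x))" for t
    by (rule integrableI_bounded) (use exp_moments[of t] in auto)
  have "integrable F (\<lambda>x. exp (s * x) + exp (- s * x))" by (intro Bochner_Integration.integrable_add int)
  then show ?thesis
  proof (rule Bochner_Integration.integrable_bound)
    show "AE x in F. norm (exp \<bar>s * x\<bar>) \<le> norm (exp (s * x) + exp (- s * x))"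
    proof (intro always_eventually allI)
      fix x
      have "exp \<bar>s * x\<bar> \<le> exp (s * x) + exp (- s * x)" by (cases "0 \<le> s * x") auto
      then show "norm (exp \<bar>s * x\<bar>) \<le> norm (exp (s * x) + exp (- s * x))"
        unfolding real_norm_def abs_exp_cancel by (rule order_trans[OF _ abs_ge_self])
    qed
  qed auto
qed

text \<open>The potential is a spectral integral of bounded functions times cos (s x) and sin (s x).
  Expanding these in powers of s and integrating term by term is justified by the exponential
  moments of \<open>F\<close>.\<close>

lemma potential_entire:
  assumes S: "finite S"
  shows "\<exists>A. \<forall>s. (\<lambda>m. A m * s ^ m) sums cov (X s) (\<lambda>\<omega>. \<Sum>i\<in>S. w i * X i \<omega>)"
proof -
  define C where "C = (\<lambda>x. \<Sum>i\<in>S. w i * cos (i * x))"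
  define D where "D = (\<lambda>x. \<Sum>i\<in>S. w i * sin (i * x))"
  define K where "K = (\<Sum>i\<in>S. \<bar>w i\<bar>)"
  have sb: "\<bar>\<Sum>t\<in>S. w t * f t\<bar> \<le> K" if "\<And>t. \<bar>f t\<bar> \<le> 1" for f :: "real \<Rightarrow> real"
    unfolding K_def by (rule order_trans[OF sum_abs]) (use that in \<open>auto simp: abs_mult intro!: sum_mono mult_left_le\<close>)
  have CD: "\<bar>C x\<bar> \<le> K" "\<bar>D x\<bar> \<le> K" for x unfolding C_def D_def by (rule sb, simp)+
  have K0: "0 \<le> K" by (simp add: K_def sum_nonneg)
  have [measurable]: "C \<in> borel_measurable borel" "D \<in> borel_measurable borel" by (auto simp: C_def D_def)
  have H: "cov (X s) (\<lambda>\<omega>. \<Sum>i\<in>S. w i * X i \<omega>) = (\<integral>x. C x * cos (s * x) + D x * sin (s * x) \<partial>F)" for s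
  proof -
    have int: "integrable F (\<lambda>x. w i * cos ((i - s) * x))" for i
      by (intro integrable_mult_right bounded_integrable[where B=1]) auto
    have "C x * cos (s * x) + D x * sin (s * x) = (\<Sum>i\<in>S. w i * cos ((i - s) * x))" for x
      by (simp add: C_def D_def sum_distrib_right sum.distrib[symmetric] left_diff_distrib cos_diff distrib_left mult.assoc)
    then have "(\<integral>x. C x * cos (s * x) + D x * sin (s * x) \<partial>F) = (\<Sum>i\<in>S. w i * cov (X s) (X i))"
      using int by (simp add: cov_spectral)
    then show ?thesis by (simp add: cov_sum_right[OF S lin_X lin_X])
  qed
  define f where "f = (\<lambda>m x. (cos_coeff m * C x + sin_coeff m * D x) * x ^ m)"
  have [measurable]: "f m \<in> borel_measurable borel" for m by (simp add: f_def)
  have "(\<lambda>m. (\<integral>x. f m x \<partial>F) * s ^ m) sums cov (X s) (\<lambda>\<omega>. \<Sum>i\<in>S. w i * X i \<omega>)" for s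
  proof -
    have sums: "(\<lambda>m. f m x * s ^ m) sums (C x * cos (s * x) + D x * sin (s * x))" for x
    proof -
      have "(\<lambda>m. C x * (cos_coeff m *\<^sub>R (s * x) ^ m) + D x * (sin_coeff m *\<^sub>R (s * x) ^ m)) sums
          (C x * cos (s * x) + D x * sin (s * x))"
        by (intro sums_add sums_mult cos_converges sin_converges)
      moreover have "C x * (cos_coeff m *\<^sub>R (s * x) ^ m) + D x * (sin_coeff m *\<^sub>R (s * x) ^ m) = f m x * s ^ m" for m
        by (simp add: f_def power_mult_distrib algebra_simps)
      ultimately show ?thesis by simp
    qed
    \<comment> \<open>A majorant with sum 2 K exp |s x|, which is integrable: cosine and sine
      coefficients are at most 1 / m!, and both \<open>C\<close> and \<open>D\<close> are bounded by
      \<open>K\<close>.\<close>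
    define e where "e = (\<lambda>m x. 2 * K * (\<bar>s * x\<bar> ^ m /\<^sub>R fact m))"
    have e0: "0 \<le> e m x" for m x using K0 by (simp add: e_def)
    have fe: "\<bar>f m x * s ^ m\<bar> \<le> e m x" for m x
    proof -
      have "\<bar>cos_coeff m\<bar> \<le> inverse (fact m)" "\<bar>sin_coeff m\<bar> \<le> inverse (fact m)"
        by (auto simp: cos_coeff_def sin_coeff_def abs_mult power_abs divide_inverse)
      then have "\<bar>cos_coeff m * C x\<bar> \<le> inverse (fact m) * K" "\<bar>sin_coeff m * D x\<bar> \<le> inverse (fact m) * K"
        unfolding abs_mult using CD by (auto intro!: mult_mono)
      then have "\<bar>cos_coeff m * C x + sin_coeff m * D x\<bar> \<le> inverse (fact m) * K + inverse (fact m) * K"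
        using abs_triangle_ineq[of "cos_coeff m * C x" "sin_coeff m * D x"] by linarith
      also have "\<dots> = 2 * K * inverse (fact m)" by simp
      finally have "\<bar>cos_coeff m * C x + sin_coeff m * D x\<bar> \<le> 2 * K * inverse (fact m)" .
      then have "\<bar>cos_coeff m * C x + sin_coeff m * D x\<bar> * \<bar>s * x\<bar> ^ m \<le> 2 * K * inverse (fact m) * \<bar>s * x\<bar> ^ m"
        by (intro mult_right_mono) auto
      then show ?thesis by (simp add: f_def e_def abs_mult power_abs power_mult_distrib mult_ac)
    qed
    have e_sums: "(\<lambda>m. e m x) sums (2 * K * exp \<bar>s * x\<bar>)" for x
      unfolding e_def by (intro sums_mult exp_converges)
    have part: "(\<Sum>m<n. \<bar>f m x * s ^ m\<bar>) \<le> 2 * K * exp \<bar>s * x\<bar>" for n x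
    proof -
      have "(\<Sum>m<n. \<bar>f m x * s ^ m\<bar>) \<le> (\<Sum>m<n. e m x)" by (intro sum_mono fe)
      also have "\<dots> \<le> 2 * K * exp \<bar>s * x\<bar>"
        using sum_le_suminf[of "\<lambda>m. e m x" "{..<n}"] e_sums[of x] e0 by (simp add: sums_iff)
      finally show ?thesis .
    qed
    have ei: "integrable F (\<lambda>x. 2 * K * exp \<bar>s * x\<bar>)" by (intro integrable_mult_right exp_abs_integrable)
    have fi: "integrable F (\<lambda>x. f m x * s ^ m)" for m
    proof (rule Bochner_Integration.integrable_bound[OF ei])
      have "\<bar>f m x * s ^ m\<bar> \<le> 2 * K * exp \<bar>s * x\<bar>" for x
      proof -
        have "0 \<le> (\<Sum>k<m. \<bar>f k x * s ^ k\<bar>)" by (intro sum_nonneg) simp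
        then show ?thesis using part[of x "Suc m"] unfolding sum.lessThan_Suc by linarith
      qed
      then show "AE x in F. norm (f m x * s ^ m) \<le> norm (2 * K * exp \<bar>s * x\<bar>)" using K0 by simp
    qed simp
    have "(\<lambda>m. \<integral>x. f m x * s ^ m \<partial>F) sums (\<integral>x. (\<Sum>m. f m x * s ^ m) \<partial>F)"
    proof (rule sums_integral[OF fi])
      show "AE x in F. summable (\<lambda>m. norm (f m x * s ^ m))"
        by (intro always_eventually allI, rule summable_comparison_test'[where g="\<lambda>m. e m _" and N=0])
          (use e_sums fe in \<open>auto simp: sums_iff\<close>)
      show "summable (\<lambda>m. \<integral>x. norm (f m x * s ^ m) \<partial>F)"
      proof (rule summableI_nonneg_bounded)
        fix n
        have "(\<Sum>m<n. \<integral>x. norm (f m x * s ^ m) \<partial>F) = (\<integral>x. (\<Sum>m<n. norm (f m x * s ^ m)) \<partial>F)"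
          using fi by (intro Bochner_Integration.integral_sum[symmetric]) auto
        also have "\<dots> \<le> (\<integral>x. 2 * K * exp \<bar>s * x\<bar> \<partial>F)"
          using fi ei part by (intro integral_mono Bochner_Integration.integrable_sum) auto
        finally show "(\<Sum>m<n. \<integral>x. norm (f m x * s ^ m) \<partial>F) \<le> (\<integral>x. 2 * K * exp \<bar>s * x\<bar> \<partial>F)" .
      qed simp
    qed
    moreover have "(\<Sum>m. f m x * s ^ m) = C x * cos (s * x) + D x * sin (s * x)" for x
      using sums[of x] by (simp add: sums_iff)
    moreover have "(\<integral>x. f m x * s ^ m \<partial>F) = (\<integral>x. f m x \<partial>F) * s ^ m" for m by simp
    ultimately show ?thesis by (simp only: H)
  qed
  then show ?thesis by (intro exI[of _ "\<lambda>m. \<integral>x. f m x \<partial>F"] allI)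
qed

text \<open>If the potential of a weighted sum were constant then, by stationarity, the sum would agree
  almost surely with its translates, against linear independence.\<close>

lemma contact_set_finite_b:
  fixes S :: "real set"
  assumes S: "finite S" "S \<subseteq> {a..b}" and w: "sum w S = 1"
    and c: "c = cov (\<lambda>\<omega>. \<Sum>i\<in>S. w i * X i \<omega>) (\<lambda>\<omega>. \<Sum>i\<in>S. w i * X i \<omega>)"
  shows "finite {t \<in> {a..b}. cov (X t) (\<lambda>\<omega>. \<Sum>i\<in>S. w i * X i \<omega>) = c}"
proof (rule ccontr)
  assume inf: "\<not> ?thesis"
  define Z where "Z = (\<lambda>\<omega>. \<Sum>i\<in>S. w i * X i \<omega>)"
  have Z: "lin Z" unfolding Z_def by (rule lin_finite_sum[OF S(1)])
  obtain A where "\<And>s. (\<lambda>m. A m * s ^ m) sums cov (X s) Z"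
    using potential_entire[OF S(1), of w] unfolding Z_def by blast
  then have const: "cov (X t) Z = c" for t
    by (rule entire_eq_const[where a=a and b=b]) (use inf in \<open>simp add: Z_def\<close>)
  \<comment> \<open>A translation longer than the interval makes \<open>S\<close> and its translate
    disjoint.\<close>
  define h where "h = b - a + 1"
  define Zh where "Zh = (\<lambda>\<omega>. \<Sum>i\<in>S. w i * X (i + h) \<omega>)"
  have Zh: "lin Zh" unfolding Zh_def by (intro lin_sum S(1) lin_scale lin_X)
  have "cov Zh Zh = cov Z Z"
  proof -
    have "cov Zh Zh = (\<Sum>i\<in>S. w i * (\<Sum>j\<in>S. w j * cov (X (i + h)) (X (j + h))))"
      unfolding Zh_def
      by (subst cov_sum[OF S(1) lin_X Zh[unfolded Zh_def]]) (simp only: cov_sum_right[OF S(1) lin_X lin_X])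
    also have "\<dots> = (\<Sum>i\<in>S. w i * (\<Sum>j\<in>S. w j * cov (X i) (X j)))" by (simp add: cov_spectral)
    also have "\<dots> = cov Z Z"
      unfolding Z_def
      by (subst cov_sum[OF S(1) lin_X Z[unfolded Z_def]]) (simp only: cov_sum_right[OF S(1) lin_X lin_X])
    finally show ?thesis .
  qed
  moreover have "cov Zh Z = c"
  proof -
    have "cov Zh Z = (\<Sum>i\<in>S. w i * cov (X (i + h)) Z)" unfolding Zh_def by (rule cov_sum[OF S(1) lin_X Z])
    also have "\<dots> = sum w S * c" by (simp add: const sum_distrib_right)
    finally show ?thesis using w by simp
  qed
  \<comment> \<open>Both variances and the covariance equal \<open>c\<close>, so the variance of the
    difference is c - 2 c + c.\<close>
  ultimately have D0: "cov (\<lambda>\<omega>. Zh \<omega> - Z \<omega>) (\<lambda>\<omega>. Zh \<omega> - Z \<omega>) = 0"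
    using c by (simp add: cov_diff[OF Zh Z] cov_diff_right[OF Zh Z] Zh Z lin_diff cov_commute[of Z Zh] Z_def[symmetric])
  define T where "T = (\<lambda>i. i + h) ` S"
  have disj: "S \<inter> T = {}"
  proof -
    have "i + h \<notin> S" if "i \<in> S" for i
    proof
      assume "i + h \<in> S"
      then have "i + h \<le> b" "a \<le> i" using S(2) that by auto
      then show False by (simp add: h_def)
    qed
    then show ?thesis by (auto simp: T_def)
  qed
  have finT: "finite T" using S(1) by (simp add: T_def)
  define d where "d = (\<lambda>t. if t \<in> S then - w t else w (t - h))"
  have dX: "(\<Sum>t\<in>S \<union> T. d t * X t \<omega>) = Zh \<omega> - Z \<omega>" for \<omega>
  proof -
    have "(\<Sum>t\<in>T. d t * X t \<omega>) = (\<Sum>t\<in>T. w (t - h) * X t \<omega>)"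
      using disj by (intro sum.cong) (auto simp: d_def)
    also have "\<dots> = Zh \<omega>" unfolding T_def Zh_def by (subst sum.reindex) (auto simp: inj_on_def)
    finally have "(\<Sum>t\<in>T. d t * X t \<omega>) = Zh \<omega>" .
    moreover have "(\<Sum>t\<in>S. d t * X t \<omega>) = - Z \<omega>" by (simp add: d_def Z_def sum_negf)
    ultimately show ?thesis using sum.union_disjoint[OF S(1) finT disj, of "\<lambda>t. d t * X t \<omega>"] by simp
  qed
  have "\<forall>t\<in>S \<union> T. d t = 0"
  proof (rule independent)
    show "finite (S \<union> T)" using S(1) finT by simp
    show "cov (\<lambda>\<omega>. \<Sum>t\<in>S \<union> T. d t * X t \<omega>) (\<lambda>\<omega>. \<Sum>t\<in>S \<union> T. d t * X t \<omega>) = 0"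
      unfolding dX by (rule D0)
  qed
  then have "w t = 0" if "t \<in> S" for t
    using bspec[of "S \<union> T" "\<lambda>t. d t = 0" t] that by (simp add: d_def)
  then show False using w by simp
qed

end

section \<open>Minimal energy\<close>

lemma space_borel_probs: "\<nu> \<in> borel_probs a b \<Longrightarrow> space \<nu> = {a..b}"
  using sets_eq_imp_space_eq[of \<nu> "restrict_space borel {a..b}"]
  by (simp add: borel_probs_iff space_restrict_space)

lemma borel_probs_sets:
  assumes \<nu>: "\<nu> \<in> borel_probs a b" and B: "B \<in> sets borel"
  shows "B \<inter> {a..b} \<in> sets \<nu>"
proof -
  have "{a..b} \<inter> B \<in> (\<inter>) {a..b} ` sets borel" using B by (rule imageI)
  moreover have "sets \<nu> = (\<inter>) {a..b} ` sets borel"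
    using \<nu> by (simp add: borel_probs_iff sets_restrict_space)
  ultimately show ?thesis by (simp add: Int_commute)
qed

lemma borel_probs_singleton: "\<nu> \<in> borel_probs a b \<Longrightarrow> i \<in> {a..b} \<Longrightarrow> {i} \<in> sets \<nu>"
  using borel_probs_sets[of \<nu> a b "{i}"] by simp

text \<open>Each point off the support has an open neighbourhood of measure zero. Lindelof's theorem
  reduces the union of these uncountably many null sets to a countable one.\<close>

lemma support_complement_null:
  assumes \<nu>: "\<nu> \<in> borel_probs a b" and S: "finite (measure_support \<nu>)"
  shows "{a..b} - measure_support \<nu> \<in> null_sets \<nu>"
proof -
  note sp = space_borel_probs[OF \<nu>]
  define \<F> where "\<F> = {U. open U \<and> emeasure \<nu> (U \<inter> {a..b}) = 0}"
  have "\<exists>\<F>'. \<F>' \<subseteq> \<F> \<and> countable \<F>' \<and> \<Union>\<F>' = \<Union>\<F>"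
  proof (rule Lindelof[of \<F>])
    show "open U" if "U \<in> \<F>" for U using that by (simp add: \<F>_def)
  next
    fix \<F>' assume "\<F>' \<subseteq> \<F>" "countable \<F>'" "\<Union>\<F>' = \<Union>\<F>"
    then show ?thesis by (intro exI[of _ \<F>'] conjI)
  qed
  then obtain \<F>' where F': "\<F>' \<subseteq> \<F>" "countable \<F>'" "\<Union>\<F>' = \<Union>\<F>"
    by (elim exE conjE)
  have "U \<inter> {a..b} \<in> null_sets \<nu>" if "U \<in> \<F>'" for U
  proof -
    have "open U" "emeasure \<nu> (U \<inter> {a..b}) = 0" using that F'(1) by (auto simp: \<F>_def)
    then show ?thesis by (intro null_setsI borel_probs_sets[OF \<nu>]) auto
  qed
  then have null: "(\<Union>U\<in>\<F>'. U \<inter> {a..b}) \<in> null_sets \<nu>"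
    using F'(2) by (intro null_sets_UN') auto
  have "{a..b} - measure_support \<nu> \<subseteq> (\<Union>U\<in>\<F>'. U \<inter> {a..b})"
  proof
    fix x assume x: "x \<in> {a..b} - measure_support \<nu>"
    then obtain U where "open U" "x \<in> U" "\<not> emeasure \<nu> (U \<inter> {a..b}) > 0"
      by (auto simp: measure_support_def sp)
    then have "x \<in> \<Union>\<F>" by (auto simp: \<F>_def not_gr_zero)
    then show "x \<in> (\<Union>U\<in>\<F>'. U \<inter> {a..b})" using x F'(3) by blast
  qed
  moreover have "{a..b} - measure_support \<nu> \<in> sets \<nu>"
  proof -
    have "- measure_support \<nu> \<inter> {a..b} \<in> sets \<nu>"
      using finite_imp_closed[OF S] by (intro borel_probs_sets[OF \<nu>]) auto
    moreover have "- measure_support \<nu> \<inter> {a..b} = {a..b} - measure_support \<nu>" by auto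
    ultimately show ?thesis by simp
  qed
  ultimately show ?thesis using null_sets_subset[OF null] by blast
qed

lemma integral_finite_support:
  assumes \<nu>: "\<nu> \<in> borel_probs a b" and S: "finite (measure_support \<nu>)"
    and f: "continuous_on {a..b} (f :: real \<Rightarrow> real)"
  shows "(\<integral>x. f x \<partial>\<nu>) = (\<Sum>i\<in>measure_support \<nu>. measure \<nu> {i} * f i)"
proof -
  interpret prob_space \<nu> using \<nu> by (simp add: borel_probs_iff)
  have sets_\<nu>: "sets \<nu> = sets (restrict_space borel {a..b})" using \<nu> by (simp add: borel_probs_iff)
  note sp = space_borel_probs[OF \<nu>]
  let ?S = "measure_support \<nu>"
  have sub: "?S \<subseteq> {a..b}" by (auto simp: measure_support_def sp)
  have sing: "{i} \<in> sets \<nu>" if "i \<in> ?S" for i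
    using that sub by (intro borel_probs_singleton[OF \<nu>]) blast
  have fm: "f \<in> borel_measurable \<nu>"
    using borel_measurable_continuous_on_restrict[OF f] measurable_cong_sets[OF sets_\<nu> refl] by blast
  have "AE x in \<nu>. x \<notin> {a..b} - ?S" using support_complement_null[OF \<nu> S] by (rule AE_not_in)
  then have ae: "AE x in \<nu>. f x = (\<Sum>i\<in>?S. f i * indicator {i} x)"
  proof (rule AE_mp, intro AE_I2 impI)
    fix x assume "x \<in> space \<nu>" "x \<notin> {a..b} - ?S"
    then have x: "x \<in> ?S" using sp by auto
    have "(\<Sum>i\<in>?S. f i * indicator {i} x) = (\<Sum>i\<in>?S. if i = x then f i else 0)"
      by (intro sum.cong) (auto simp: indicator_def)
    then show "f x = (\<Sum>i\<in>?S. f i * indicator {i} x)" using x S by simp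
  qed
  have ii: "integrable \<nu> (\<lambda>x. f i * indicator {i} x)" if "i \<in> ?S" for i
    using sing[OF that] by (intro integrable_mult_right integrable_real_indicator) (auto simp: less_top[symmetric])
  have "(\<integral>x. f x \<partial>\<nu>) = (\<integral>x. (\<Sum>i\<in>?S. f i * indicator {i} x) \<partial>\<nu>)"
  proof (rule integral_cong_AE[OF fm _ ae])
    show "(\<lambda>x. \<Sum>i\<in>?S. f i * indicator {i} x) \<in> borel_measurable \<nu>"
      by (intro borel_measurable_sum borel_measurable_integrable ii)
  qed
  also have "\<dots> = (\<Sum>i\<in>?S. \<integral>x. f i * indicator {i} x \<partial>\<nu>)"
    using ii by (rule Bochner_Integration.integral_sum)
  also have "\<dots> = (\<Sum>i\<in>?S. measure \<nu> {i} * f i)"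
    using sub sp by (intro sum.cong refl) (auto simp: Int_absorb2)
  finally show ?thesis .
qed

lemma support_weights_sum:
  assumes \<nu>: "\<nu> \<in> borel_probs a b" and S: "finite (measure_support \<nu>)"
  shows "(\<Sum>i\<in>measure_support \<nu>. measure \<nu> {i}) = 1"
proof -
  interpret prob_space \<nu> using \<nu> by (simp add: borel_probs_iff)
  show ?thesis using integral_finite_support[OF \<nu> S continuous_on_const, of 1] by (simp add: prob_space)
qed

text \<open>Removing the other finitely many support points leaves an open neighbourhood of
  \<open>i\<close>. It has positive mass by definition of the support, and all of that mass sits at
  \<open>i\<close>.\<close>

lemma support_atom_pos:
  assumes \<nu>: "\<nu> \<in> borel_probs a b" and S: "finite (measure_support \<nu>)" and i: "i \<in> measure_support \<nu>"
  shows "0 < measure \<nu> {i}"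
proof -
  interpret prob_space \<nu> using \<nu> by (simp add: borel_probs_iff)
  note sp = space_borel_probs[OF \<nu>]
  let ?S = "measure_support \<nu>"
  define U where "U = - (?S - {i})"
  have "open U" unfolding U_def using S by (intro open_Compl finite_imp_closed) auto
  moreover have "i \<in> U" by (simp add: U_def)
  ultimately have pos: "0 < emeasure \<nu> (U \<inter> {a..b})" using i by (auto simp: measure_support_def sp)
  have "i \<in> {a..b}" using i by (auto simp: measure_support_def sp)
  then have sing: "{i} \<in> sets \<nu>"
    by (rule borel_probs_singleton[OF \<nu>])
  have null: "{a..b} - ?S \<in> null_sets \<nu>" by (rule support_complement_null[OF \<nu> S])
  have "emeasure \<nu> (U \<inter> {a..b}) \<le> emeasure \<nu> ({i} \<union> ({a..b} - ?S))"
    by (intro emeasure_mono sets.Un sing null_setsD2[OF null]) (auto simp: U_def)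
  also have "\<dots> = emeasure \<nu> {i}" using sing null by (rule emeasure_Un_null_set)
  finally have "0 < emeasure \<nu> {i}" using pos by simp
  then show ?thesis by (simp add: emeasure_eq_measure)
qed

lemma discrete_borel_prob:
  assumes T: "finite T" "T \<subseteq> {a..b}" and w: "\<And>i. i \<in> T \<Longrightarrow> 0 \<le> w i" "sum w T = 1"
  obtains \<rho> where "\<rho> \<in> borel_probs a b"
    "\<And>f :: real \<Rightarrow> real. continuous_on {a..b} f \<Longrightarrow> (\<integral>x. f x \<partial>\<rho>) = (\<Sum>i\<in>T. w i * f i)"
proof -
  define N where "N = point_measure T w"
  define \<rho> where "\<rho> = distr N (restrict_space borel {a..b}) (\<lambda>x. x)"
  have m: "(\<lambda>x. x) \<in> measurable N (restrict_space borel {a..b})"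
    unfolding N_def using T(2) by (simp add: measurable_def space_point_measure sets_point_measure space_restrict_space subset_eq)
  have "emeasure N (space N) = 1"
    unfolding N_def space_point_measure using T(1) w by (simp add: emeasure_point_measure_finite sum_ennreal)
  then have "prob_space N" by (rule prob_spaceI)
  then have "\<rho> \<in> borel_probs a b"
    unfolding \<rho>_def borel_probs_iff using m by (auto intro: prob_space.prob_space_distr)
  moreover have "(\<integral>x. f x \<partial>\<rho>) = (\<Sum>i\<in>T. w i * f i)" if f: "continuous_on {a..b} f" for f :: "real \<Rightarrow> real"
    unfolding \<rho>_def using integral_distr[OF m borel_measurable_continuous_on_restrict[OF f]] T(1) w(1)
    by (simp add: N_def lebesgue_integral_point_measure_finite)
  ultimately show ?thesis by (rule that)
qed

context smooth_gaussian_process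
begin

section \<open>First-order condition for the minimizer and reduction to the contact set\<close>

lemma energy_discrete:
  assumes T: "finite T"
    and int: "\<And>f :: real \<Rightarrow> real. continuous_on {a..b} f \<Longrightarrow> (\<integral>x. f x \<partial>\<rho>) = (\<Sum>i\<in>T. w i * f i)"
  shows "energy (cov_fun M X) \<rho> = cov (\<lambda>\<omega>. \<Sum>i\<in>T. w i * X i \<omega>) (\<lambda>\<omega>. \<Sum>i\<in>T. w i * X i \<omega>)"
proof -
  let ?W = "\<lambda>\<omega>. \<Sum>i\<in>T. w i * X i \<omega>"
  have W: "lin ?W" by (rule lin_finite_sum[OF T])
  have "(\<integral>s. cov (X s) (X t) \<partial>\<rho>) = cov (X t) ?W" for t
    by (simp only: int[OF cov_continuous[OF lin_X]] cov_sum_right[OF T lin_X lin_X] cov_commute[of "X t"])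
  then have "energy (cov_fun M X) \<rho> = (\<integral>t. cov (X t) ?W \<partial>\<rho>)"
    unfolding energy_def cov_fun_eq by simp
  also have "\<dots> = cov ?W ?W"
    by (simp only: int[OF cov_continuous[OF W]] cov_sum[OF T lin_X W])
  finally show ?thesis .
qed

text \<open>Moving a fraction \<epsilon> of the mass to the point \<open>t\<close> cannot lower the
  energy. The energy of the mixture is the variance of (1 - \<epsilon>) Z + \<epsilon> X t, and its
  derivative at \<epsilon> = 0 gives the inequality.\<close>

lemma minimal_energy_potential_ge:
  assumes \<nu>: "is_arg_min (energy (cov_fun M X)) (\<lambda>\<rho>. \<rho> \<in> borel_probs a b) \<nu>"
    and S: "finite (measure_support \<nu>)" and t: "t \<in> {a..b}"
  defines "Z \<equiv> \<lambda>\<omega>. \<Sum>i\<in>measure_support \<nu>. measure \<nu> {i} * X i \<omega>"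
  shows "cov Z Z \<le> cov (X t) Z"
proof -
  let ?S = "measure_support \<nu>"
  have \<nu>p: "\<nu> \<in> borel_probs a b" using \<nu> by (simp add: is_arg_min_def)
  have sub: "?S \<subseteq> {a..b}" using space_borel_probs[OF \<nu>p] by (auto simp: measure_support_def)
  have Z: "lin Z" unfolding Z_def by (rule lin_finite_sum[OF S])
  have sum1: "(\<Sum>i\<in>?S. measure \<nu> {i}) = 1" by (rule support_weights_sum[OF \<nu>p S])
  have E\<nu>: "energy (cov_fun M X) \<nu> = cov Z Z"
    unfolding Z_def by (rule energy_discrete[OF S integral_finite_support[OF \<nu>p S]])
  have ineq: "cov Z Z \<le> (1 - \<epsilon>)\<^sup>2 * cov Z Z + 2 * \<epsilon> * (1 - \<epsilon>) * cov (X t) Z + \<epsilon>\<^sup>2 * cov (X t) (X t)"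
    if \<epsilon>: "0 < \<epsilon>" "\<epsilon> < 1" for \<epsilon>
  proof -
    define T where "T = insert t ?S"
    \<comment> \<open>The two summands are kept apart because \<open>t\<close> may or may not belong
      to the support.\<close>
    define w where "w = (\<lambda>i. (1 - \<epsilon>) * (if i \<in> ?S then measure \<nu> {i} else 0) + \<epsilon> * (if i = t then 1 else 0))"
    have T: "finite T" "T \<subseteq> {a..b}" using S sub t by (auto simp: T_def)
    have wsum: "(\<Sum>i\<in>T. w i * f i) = (1 - \<epsilon>) * (\<Sum>i\<in>?S. measure \<nu> {i} * f i) + \<epsilon> * f t" for f :: "real \<Rightarrow> real"
    proof -
      have "(\<Sum>i\<in>T. w i * f i) = (1 - \<epsilon>) * (\<Sum>i\<in>T. if i \<in> ?S then measure \<nu> {i} * f i else 0) + \<epsilon> * (\<Sum>i\<in>T. if i = t then f i else 0)"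
        unfolding sum_distrib_left sum.distrib[symmetric] by (intro sum.cong refl) (simp add: w_def distrib_right)
      also have "(\<Sum>i\<in>T. if i \<in> ?S then measure \<nu> {i} * f i else 0) = (\<Sum>i\<in>?S. measure \<nu> {i} * f i)"
        using T(1) by (intro sum.mono_neutral_cong_right) (auto simp: T_def)
      also have "(\<Sum>i\<in>T. if i = t then f i else 0) = f t" using T(1) by (simp add: T_def)
      finally show ?thesis .
    qed
    have w0: "0 \<le> w i" for i using \<epsilon> by (simp add: w_def)
    have w1: "sum w T = 1" using wsum[of "\<lambda>_. 1"] sum1 by simp
    obtain \<rho> where \<rho>: "\<rho> \<in> borel_probs a b"
      "\<And>f :: real \<Rightarrow> real. continuous_on {a..b} f \<Longrightarrow> (\<integral>x. f x \<partial>\<rho>) = (\<Sum>i\<in>T. w i * f i)"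
      using discrete_borel_prob[OF T w0 w1] by blast
    have W: "(\<lambda>\<omega>. \<Sum>i\<in>T. w i * X i \<omega>) = (\<lambda>\<omega>. (1 - \<epsilon>) * Z \<omega> + \<epsilon> * X t \<omega>)"
      unfolding Z_def by (rule ext) (rule wsum)
    have "cov Z Z \<le> energy (cov_fun M X) \<rho>"
      using \<nu> \<rho>(1) unfolding is_arg_min_def E\<nu> by (auto simp: not_less)
    also have "\<dots> = cov (\<lambda>\<omega>. (1 - \<epsilon>) * Z \<omega> + \<epsilon> * X t \<omega>) (\<lambda>\<omega>. (1 - \<epsilon>) * Z \<omega> + \<epsilon> * X t \<omega>)"
      unfolding W[symmetric] by (rule energy_discrete[OF T(1)]) (rule \<rho>(2))
    also have "\<dots> = (1 - \<epsilon>)\<^sup>2 * cov Z Z + 2 * \<epsilon> * (1 - \<epsilon>) * cov (X t) Z + \<epsilon>\<^sup>2 * cov (X t) (X t)"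
    proof -
      note l = lin_scale[OF Z, of "1 - \<epsilon>"] lin_scale[OF lin_X, of \<epsilon> t]
      have "cov (\<lambda>\<omega>. (1 - \<epsilon>) * Z \<omega> + \<epsilon> * X t \<omega>) (\<lambda>\<omega>. (1 - \<epsilon>) * Z \<omega> + \<epsilon> * X t \<omega>) =
          (1 - \<epsilon>) * ((1 - \<epsilon>) * cov Z Z + \<epsilon> * cov Z (X t)) + \<epsilon> * ((1 - \<epsilon>) * cov (X t) Z + \<epsilon> * cov (X t) (X t))"
        by (simp only: cov_add[OF l lin_add[OF l]] cov_scale cov_add_right[OF l Z] cov_add_right[OF l lin_X] cov_scale_right)
      then show ?thesis unfolding cov_commute[of Z "X t"] by (simp add: power2_eq_square algebra_simps)
    qed
    finally show ?thesis .
  qed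
  \<comment> \<open>The change of energy is - 2 \<epsilon> p + \<epsilon>^2 q.\<close>
  define p where "p = cov Z Z - cov (X t) Z"
  define q where "q = cov Z Z - 2 * cov (X t) Z + cov (X t) (X t)"
  have "2 * p \<le> \<epsilon> * q" if \<epsilon>: "0 < \<epsilon>" "\<epsilon> < 1" for \<epsilon>
  proof -
    have "\<epsilon> * (2 * p) \<le> \<epsilon> * (\<epsilon> * q)"
      using ineq[OF \<epsilon>] by (simp add: p_def q_def power2_eq_square algebra_simps)
    then show ?thesis using \<epsilon>(1) by simp
  qed
  then have le: "eventually (\<lambda>\<epsilon>. 2 * p \<le> \<epsilon> * q) (at_right 0)"
    by (intro eventually_mono[OF eventually_at_right_real[of 0 1]]) auto
  have "((\<lambda>\<epsilon>. \<epsilon> * q) \<longlongrightarrow> 0 * q) (at_right 0)" by (intro tendsto_intros)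
  then have "2 * p \<le> 0 * q" by (rule tendsto_lowerbound[OF _ le]) simp
  then show ?thesis by (simp add: p_def)
qed

text \<open>This isolates what conditions (a) and (b) must supply beyond smooth paths: linear
  independence, and finiteness of the set where the potential attains the value of the
  energy.\<close>

theorem weak_conv_of_contact_set:
  assumes \<nu>: "is_arg_min (energy (cov_fun M X)) (\<lambda>\<rho>. \<rho> \<in> borel_probs a b) \<nu>"
    and S: "finite (measure_support \<nu>)"
    and indep: "\<And>J c. finite J \<Longrightarrow> cov (\<lambda>\<omega>. \<Sum>t\<in>J. c t * X t \<omega>) (\<lambda>\<omega>. \<Sum>t\<in>J. c t * X t \<omega>) = 0 \<Longrightarrow>
      \<forall>t\<in>J. c t = 0"
    and contact: "\<And>S w. finite S \<Longrightarrow> S \<subseteq> {a..b} \<Longrightarrow> (\<And>i. i \<in> S \<Longrightarrow> 0 \<le> w i) \<Longrightarrow> sum w S = 1 \<Longrightarrow>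
      finite {t \<in> {a..b}. cov (X t) (\<lambda>\<omega>. \<Sum>i\<in>S. w i * X i \<omega>) =
        cov (\<lambda>\<omega>. \<Sum>i\<in>S. w i * X i \<omega>) (\<lambda>\<omega>. \<Sum>i\<in>S. w i * X i \<omega>)}"
  shows "weak_conv_on {a..b} (cond_argmin_law M X a b) \<nu> at_top"
proof -
  let ?S = "measure_support \<nu>"
  have \<nu>p: "\<nu> \<in> borel_probs a b" using \<nu> by (simp add: is_arg_min_def)
  have sub: "?S \<subseteq> {a..b}" using space_borel_probs[OF \<nu>p] by (auto simp: measure_support_def)
  define Z where "Z = (\<lambda>\<omega>. \<Sum>i\<in>?S. measure \<nu> {i} * X i \<omega>)"
  have Z: "lin Z" unfolding Z_def by (rule lin_finite_sum[OF S])
  have sum1: "(\<Sum>i\<in>?S. measure \<nu> {i}) = 1" by (rule support_weights_sum[OF \<nu>p S])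
  have ge: "cov Z Z \<le> cov (X t) Z" if "t \<in> {a..b}" for t
    unfolding Z_def by (rule minimal_energy_potential_ge[OF \<nu> S that])
  \<comment> \<open>The weighted mean of the potential over the support is the energy itself. As the
    potential is nowhere smaller and the weights are positive, equality holds at every support
    point.\<close>
  have eq: "cov (X i) Z = cov Z Z" if i: "i \<in> ?S" for i
  proof -
    have "cov Z Z = (\<Sum>i\<in>?S. measure \<nu> {i} * cov (X i) Z)"
      using cov_sum[OF S lin_X Z, where c="\<lambda>i. measure \<nu> {i}"] by (simp add: Z_def)
    then have "(\<Sum>i\<in>?S. measure \<nu> {i} * (cov (X i) Z - cov Z Z)) = 0"
      using sum1 by (simp add: right_diff_distrib sum_subtractf sum_distrib_right[symmetric])
    then have "measure \<nu> {i} * (cov (X i) Z - cov Z Z) = 0"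
      using i ge sub by (subst (asm) sum_nonneg_eq_0_iff[OF S]) auto
    then show ?thesis using support_atom_pos[OF \<nu>p S i] by simp
  qed
  define P where "P = {t \<in> {a..b}. cov (X t) Z = cov Z Z}"
  have finP: "finite P" unfolding P_def Z_def by (rule contact[OF S sub _ sum1]) simp
  have SP: "?S \<subseteq> P" using eq sub by (auto simp: P_def)
  define \<theta> where "\<theta> = (\<lambda>i. if i \<in> ?S then measure \<nu> {i} else 0)"
  have \<theta>_sum: "(\<Sum>i\<in>P. \<theta> i * f i) = (\<Sum>i\<in>?S. measure \<nu> {i} * f i)" for f :: "real \<Rightarrow> real"
    using finP SP by (intro sum.mono_neutral_cong_right) (auto simp: \<theta>_def)
  have Z_P: "(\<lambda>\<omega>. \<Sum>i\<in>P. \<theta> i * X i \<omega>) = Z" unfolding Z_def by (rule ext) (rule \<theta>_sum)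
  interpret E: equilibrium M X a b P \<theta>
  proof
    show "finite P" by (rule finP)
    show "P \<subseteq> {a..b}" by (auto simp: P_def)
    show "0 \<le> \<theta> i" for i by (simp add: \<theta>_def)
    show "sum \<theta> P = 1" using \<theta>_sum[of "\<lambda>_. 1"] sum1 by simp
    show "\<forall>i\<in>P. c i = 0" if "cov (\<lambda>\<omega>. \<Sum>i\<in>P. c i * X i \<omega>) (\<lambda>\<omega>. \<Sum>i\<in>P. c i * X i \<omega>) = 0" for c
      by (rule indep[OF finP that])
    show "cov (\<lambda>\<omega>. \<Sum>i\<in>P. \<theta> i * X i \<omega>) (\<lambda>\<omega>. \<Sum>i\<in>P. \<theta> i * X i \<omega>) \<le> cov (X t) (\<lambda>\<omega>. \<Sum>i\<in>P. \<theta> i * X i \<omega>)"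
      if "t \<in> {a..b}" for t unfolding Z_P by (rule ge[OF that])
    show "cov (X t) (\<lambda>\<omega>. \<Sum>i\<in>P. \<theta> i * X i \<omega>) = cov (\<lambda>\<omega>. \<Sum>i\<in>P. \<theta> i * X i \<omega>) (\<lambda>\<omega>. \<Sum>i\<in>P. \<theta> i * X i \<omega>) \<longleftrightarrow> t \<in> P"
      if "t \<in> {a..b}" for t unfolding Z_P using that by (simp add: P_def)
  qed
  show ?thesis
    unfolding weak_conv_on_def
  proof (intro allI impI)
    fix f :: "real \<Rightarrow> real" assume "continuous_on {a..b} f \<and> bounded (f ` {a..b})"
    then have f: "continuous_on {a..b} f" by simp
    show "((\<lambda>u. \<integral>x. f x \<partial>cond_argmin_law M X a b u) \<longlongrightarrow> (\<integral>x. f x \<partial>\<nu>)) at_top"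
      unfolding integral_finite_support[OF \<nu>p S f] \<theta>_sum[symmetric] by (rule E.law_integral_tendsto[OF f])
  qed
qed

end

theorem theorem4p4:
  fixes M :: "'w measure" and X :: "real \<Rightarrow> 'w \<Rightarrow> real" and a b :: real
    and \<nu> :: "real measure" and S :: "real set" and \<mu> :: "real \<Rightarrow> real"
  assumes "prob_space M"
    and "a < b"
    and "gaussian_process M X"
    and "centered_process M X"
    and "\<And>\<omega>. \<omega> \<in> space M \<Longrightarrow> continuous_on UNIV (\<lambda>t. X t \<omega>)"
    and "condition_a M X a b \<or> condition_b M X"
    and "is_arg_min (energy (cov_fun M X)) (\<lambda>\<rho>. \<rho> \<in> borel_probs a b) \<nu>"
    and "S = measure_support \<nu>"
    and "finite S"
    and "\<mu> = cond_mean_given_one M X S"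
    and "\<And>t. t \<in> S \<inter> {a<..<b} \<Longrightarrow> (deriv ^^ 2) \<mu> t > 0"
  shows "weak_conv_on {a..b} (cond_argmin_law M X a b) \<nu> at_top"
proof -
  interpret prob_space M by fact
  interpret centered_gaussian_process M X by unfold_locales fact+
  have "smooth_paths M X" using assms(6) by (auto simp: condition_a_def condition_b_def)
  then interpret smooth_gaussian_process M X a b
    using \<open>a < b\<close> by (intro smooth_gaussian_process.intro smooth_gaussian_process_axioms.intro centered_gaussian_process_axioms)
  have fin: "finite (measure_support \<nu>)" using assms(8,9) by simp
  from assms(6) show ?thesis
  proof
    assume cond: "condition_a M X a b"
    then obtain r where r: "\<And>s t. (\<forall>m. summable (\<lambda>n. r m n * s ^ m * t ^ n)) \<and>
        (\<lambda>m. \<Sum>n. r m n * s ^ m * t ^ n) sums cov_fun M X s t"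
      unfolding condition_a_def by blast
    have inv: "\<And>ps :: (real \<times> nat) list. distinct ps \<Longrightarrow>
        invertible_mat (covariance_mat M (map (\<lambda>(s, n). path_deriv X n s) ps))"
      and lim: "\<And>s. s \<in> {a..b} \<Longrightarrow> Limsup at_top (\<lambda>t. ereal (cov_fun M X s t)) \<le> 0"
      using cond unfolding condition_a_def by blast+
    have indep: "\<forall>t\<in>J. c t = 0"
      if "finite J" "cov (\<lambda>\<omega>. \<Sum>t\<in>J. c t * X t \<omega>) (\<lambda>\<omega>. \<Sum>t\<in>J. c t * X t \<omega>) = 0" for J c
      by (rule invertible_imp_independent[OF _ that]) (rule inv)
    show ?thesis
    proof (rule weak_conv_of_contact_set[OF assms(7) fin indep])
      fix T :: "real set" and w :: "real \<Rightarrow> real"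
      let ?Z = "\<lambda>\<omega>. \<Sum>i\<in>T. w i * X i \<omega>"
      assume T: "finite T" "T \<subseteq> {a..b}" "\<And>i. i \<in> T \<Longrightarrow> 0 \<le> w i" "sum w T = 1"
      have "cov ?Z ?Z \<noteq> 0"
      proof
        assume "cov ?Z ?Z = 0"
        from indep[OF T(1) this] show False using T(4) by simp
      qed
      then have pos: "0 < cov ?Z ?Z" using cov_nonneg[of ?Z] by simp
      show "finite {t \<in> {a..b}. cov (X t) ?Z = cov ?Z ?Z}"
        by (rule contact_set_finite_a[OF r lim T(1,2,3,4) pos])
    qed
  next
    assume "condition_b M X"
    then obtain F where F: "is_spectral_measure M X F" "\<And>t. (\<integral>\<^sup>+x. ennreal (exp (t * x)) \<partial>F) < \<infinity>"
      "\<exists>x. x islimpt measure_support F"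
      unfolding condition_b_def by blast
    interpret F: spectral_gaussian_process M X F by unfold_locales (fact F)+
    show ?thesis
      by (rule weak_conv_of_contact_set[OF assms(7) fin F.independent F.contact_set_finite_b]) (assumption | rule refl)+
  qed
qed

end
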